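(* Let $X\subset\mathbb{P}^{s_0}$ be a closed subscheme satisfying condition $(K_2)$. For $d\geq 2$ let $v_d:\mathbb{P}^{s_0}\hookrightarrow\mathbb{P}^{N}$, $N=\binom{s_0+d}{d}-1$, be the $d$-th Veronese embedding. Then for every $d\geq 2$ the secant variety $Sec(v_d(X))\subset\mathbb{P}^N$ is set-theoretically defined by cubics, i.e. it is, as a set, the common zero locus of a collection of cubic forms.
   Context: We work over $\mathbb{C}$. A closed subscheme $Y\subset\mathbb{P}^n$ satisfies condition $(K_d)$ if $Y$ is scheme-theoretically cut out by forms $F_0,\ldots,F_s$ of degree $d$ such that the trivial (Koszul) relations among the $F_i$ are generated by linear syzygies, i.e. each relation $F_j\cdot F_i-F_i\cdot F_j=0$ lies in the submodule of the syzygy module of $(F_0,\ldots,F_s)$ generated by the syzygies with linear coefficients. For a closed subscheme $Y\subset\mathbb{P}^n$, $Sec\,Y$ denotes the (complete) variety of $2$-secant lines to $Y$: the union of all lines whose intersection with $Y$ contains a subscheme of length at least $2$ (thus including tangent lines). *)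

theory Defs
  imports Complex_Main "HOL-Library.Poly_Mapping" "HOL-Library.Multiset"
begin

section \<open>Polynomials in a finite set of variables\<close>

text \<open>
  A monomial is a finitely supported exponent function, a polynomial a finitely supported
  family of complex coefficients. The coordinates of a projective space are indexed by a
  finite nonempty set \<open>V\<close>: this space, of dimension \<open>card V - 1\<close>, has homogeneous
  coordinate ring \<open>polys V\<close>.
\<close>

type_synonym 'v mpoly = "('v \<Rightarrow>\<^sub>0 nat) \<Rightarrow>\<^sub>0 complex"

definition mdeg :: "('v \<Rightarrow>\<^sub>0 nat) \<Rightarrow> nat" where
  "mdeg m = (\<Sum>i\<in>Poly_Mapping.keys m. Poly_Mapping.lookup m i)"

definition monoms :: "'v set \<Rightarrow> nat \<Rightarrow> ('v \<Rightarrow>\<^sub>0 nat) set" where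
  "monoms V k = {m. Poly_Mapping.keys m \<subseteq> V \<and> mdeg m = k}"

definition polys :: "'v set \<Rightarrow> 'v mpoly set" where
  "polys V = {p. \<forall>m\<in>Poly_Mapping.keys p. Poly_Mapping.keys m \<subseteq> V}"

text \<open>As usual, the zero polynomial counts as a form of every degree.\<close>

definition forms :: "'v set \<Rightarrow> nat \<Rightarrow> 'v mpoly set" where
  "forms V k = {p. Poly_Mapping.keys p \<subseteq> monoms V k}"

definition hom_part :: "nat \<Rightarrow> 'v mpoly \<Rightarrow> 'v mpoly" where
  "hom_part k p =
     (\<Sum>m\<in>{m \<in> Poly_Mapping.keys p. mdeg m = k}. Poly_Mapping.single m (Poly_Mapping.lookup p m))"

text \<open>
  The value of \<open>p\<close> at \<open>f\<close> in a commutative ring into which the coefficients are mapped by \<open>c\<close>.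
\<close>

definition subst_poly :: "(complex \<Rightarrow> 'r::comm_ring_1) \<Rightarrow> ('v \<Rightarrow> 'r) \<Rightarrow> 'v mpoly \<Rightarrow> 'r" where
  "subst_poly c f p =
     (\<Sum>m\<in>Poly_Mapping.keys p. c (Poly_Mapping.lookup p m) *
        (\<Prod>i\<in>Poly_Mapping.keys m. f i ^ Poly_Mapping.lookup m i))"

definition eval_poly :: "('v \<Rightarrow>\<^sub>0 complex) \<Rightarrow> 'v mpoly \<Rightarrow> complex" where
  "eval_poly v = subst_poly (\<lambda>a. a) (Poly_Mapping.lookup v)"


section \<open>Linear algebra over the complex numbers\<close>

text \<open>
  This vector space structure is used both for coordinate vectors and for polynomials.
\<close>

definition scale :: "complex \<Rightarrow> ('a \<Rightarrow>\<^sub>0 complex) \<Rightarrow> ('a \<Rightarrow>\<^sub>0 complex)" where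
  "scale a = Poly_Mapping.map ((*) a)"

lemma lookup_scale: "Poly_Mapping.lookup (scale a x) i = a * Poly_Mapping.lookup x i"
  by (simp add: scale_def Poly_Mapping.map.rep_eq when_def)

global_interpretation lin: vector_space scale
  by unfold_locales
    (auto intro!: poly_mapping_eqI simp: lookup_scale lookup_add algebra_simps)


section \<open>Ideals and submodules of free modules\<close>

definition submodule_over :: "'r set \<Rightarrow> ('r \<Rightarrow> 'm \<Rightarrow> 'm) \<Rightarrow> 'm::ab_group_add set \<Rightarrow> bool" where
  "submodule_over R act M \<longleftrightarrow>
     0 \<in> M \<and> (\<forall>x\<in>M. \<forall>y\<in>M. x + y \<in> M) \<and> (\<forall>r\<in>R. \<forall>x\<in>M. act r x \<in> M)"

lemma submodule_over_Inter:
  assumes "\<And>M. M \<in> \<M> \<Longrightarrow> submodule_over R act M"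
  shows "submodule_over R act (\<Inter>\<M>)"
  using assms unfolding submodule_over_def by blast

lemma submodule_over_hull: "submodule_over R act (submodule_over R act hull A)"
  by (rule hull_in, rule submodule_over_Inter) blast

definition ideal_of :: "'v set \<Rightarrow> 'v mpoly set \<Rightarrow> bool" where
  "ideal_of V I \<longleftrightarrow> I \<subseteq> polys V \<and> submodule_over (polys V) (*) I"

definition ideal_gen :: "'v set \<Rightarrow> 'v mpoly set \<Rightarrow> 'v mpoly set" where
  "ideal_gen V A = submodule_over (polys V) (*) hull A"

definition homogeneous_ideal :: "'v set \<Rightarrow> 'v mpoly set \<Rightarrow> bool" where
  "homogeneous_ideal V I \<longleftrightarrow> ideal_of V I \<and> (\<forall>p\<in>I. \<forall>k. hom_part k p \<in> I)"

text \<open>Saturation with respect to the irrelevant ideal.\<close>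

definition saturation :: "'v set \<Rightarrow> 'v mpoly set \<Rightarrow> 'v mpoly set" where
  "saturation V I = {p \<in> polys V. \<exists>k. \<forall>g\<in>forms V k. g * p \<in> I}"


section \<open>Closed subschemes of projective space\<close>

text \<open>
  A closed subscheme is represented by its saturated homogeneous ideal. Two homogeneous ideals
  define the same subscheme iff their saturations agree, and \<open>Z\<close> is a subscheme of \<open>Y\<close> iff the
  ideal of \<open>Y\<close> is contained in that of \<open>Z\<close>. The empty subscheme corresponds to \<open>polys V\<close>.
\<close>

definition closed_subscheme :: "'v set \<Rightarrow> 'v mpoly set \<Rightarrow> bool" where
  "closed_subscheme V I \<longleftrightarrow> homogeneous_ideal V I \<and> saturation V I = I"

definition subscheme :: "'v mpoly set \<Rightarrow> 'v mpoly set \<Rightarrow> bool" where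
  "subscheme J I \<longleftrightarrow> I \<subseteq> J"

text \<open>The scheme-theoretic intersection.\<close>

definition scheme_inter :: "'v set \<Rightarrow> 'v mpoly set \<Rightarrow> 'v mpoly set \<Rightarrow> 'v mpoly set" where
  "scheme_inter V I J = saturation V (ideal_gen V (I \<union> J))"

definition cut_out_by :: "'v set \<Rightarrow> 'v mpoly set \<Rightarrow> 'v mpoly set \<Rightarrow> bool" where
  "cut_out_by V I A \<longleftrightarrow> I = saturation V (ideal_gen V A)"

text \<open>
  A subscheme \<open>Z\<close> with homogeneous ideal \<open>J\<close> is finite of length \<open>l\<close> iff the Hilbert function
  \<open>k \<mapsto> dim (S/J)\<^sub>k\<close> is eventually equal to \<open>l\<close>; then \<open>(S/J)\<^sub>k = H\<^sup>0(Z, O\<^sub>Z(k)) \<cong> H\<^sup>0(Z, O\<^sub>Z)\<close>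
  for large \<open>k\<close>.
\<close>

definition has_length :: "'v set \<Rightarrow> 'v mpoly set \<Rightarrow> nat \<Rightarrow> bool" where
  "has_length V J l \<longleftrightarrow>
     (\<forall>\<^sub>F k in sequentially. lin.dim (forms V k) = lin.dim (J \<inter> forms V k) + l)"


section \<open>The condition \<open>K\<^sub>d\<close>\<close>

text \<open>
  The free module on \<open>e\<^sub>0, \<dots>, e\<^sub>s\<close> consists of the finitely supported families of polynomials
  indexed by \<open>{..s}\<close>; the basis vector \<open>e\<^sub>i\<close> with coefficient \<open>p\<close> is \<open>Poly_Mapping.single i p\<close>.
\<close>

definition syzygies :: "'v set \<Rightarrow> nat \<Rightarrow> (nat \<Rightarrow> 'v mpoly) \<Rightarrow> (nat \<Rightarrow>\<^sub>0 'v mpoly) set" where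
  "syzygies V s F = {a. Poly_Mapping.keys a \<subseteq> {..s} \<and> (\<forall>i. Poly_Mapping.lookup a i \<in> polys V) \<and>
     (\<Sum>i\<le>s. Poly_Mapping.lookup a i * F i) = 0}"

definition linear_syzygies ::
    "'v set \<Rightarrow> nat \<Rightarrow> (nat \<Rightarrow> 'v mpoly) \<Rightarrow> (nat \<Rightarrow>\<^sub>0 'v mpoly) set" where
  "linear_syzygies V s F = {a \<in> syzygies V s F. \<forall>i. Poly_Mapping.lookup a i \<in> forms V 1}"

definition koszul_syzygy :: "(nat \<Rightarrow> 'v mpoly) \<Rightarrow> nat \<Rightarrow> nat \<Rightarrow> (nat \<Rightarrow>\<^sub>0 'v mpoly)" where
  "koszul_syzygy F i j = Poly_Mapping.single i (F j) - Poly_Mapping.single j (F i)"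

definition syzygies_gen ::
    "'v set \<Rightarrow> (nat \<Rightarrow>\<^sub>0 'v mpoly) set \<Rightarrow> (nat \<Rightarrow>\<^sub>0 'v mpoly) set" where
  "syzygies_gen V A = submodule_over (polys V) (\<lambda>p. Poly_Mapping.map ((*) p)) hull A"

definition cond_K :: "'v set \<Rightarrow> nat \<Rightarrow> 'v mpoly set \<Rightarrow> bool" where
  "cond_K V d I \<longleftrightarrow> (\<exists>s F. (\<forall>i\<le>s. F i \<in> forms V d) \<and> cut_out_by V I (F ` {..s}) \<and>
     (\<forall>i\<le>s. \<forall>j\<le>s. koszul_syzygy F i j \<in> syzygies_gen V (linear_syzygies V s F)))"


section \<open>Points, lines and the secant variety\<close>

definition vecs :: "'v set \<Rightarrow> ('v \<Rightarrow>\<^sub>0 complex) set" where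
  "vecs V = {v. Poly_Mapping.keys v \<subseteq> V}"

text \<open>
  Points and lines are the linear subspaces of the coordinate space of dimension one and two;
  a point \<open>P\<close> lies on a line \<open>L\<close> iff \<open>P \<subseteq> L\<close>.
\<close>

definition proj_points :: "'v set \<Rightarrow> ('v \<Rightarrow>\<^sub>0 complex) set set" where
  "proj_points V = {P. lin.subspace P \<and> P \<subseteq> vecs V \<and> lin.dim P = 1}"

definition proj_lines :: "'v set \<Rightarrow> ('v \<Rightarrow>\<^sub>0 complex) set set" where
  "proj_lines V = {L. lin.subspace L \<and> L \<subseteq> vecs V \<and> lin.dim L = 2}"

definition line_ideal :: "'v set \<Rightarrow> ('v \<Rightarrow>\<^sub>0 complex) set \<Rightarrow> 'v mpoly set" where
  "line_ideal V L = {p \<in> polys V. \<forall>v\<in>L. eval_poly v p = 0}"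

definition secant_line :: "'v set \<Rightarrow> 'v mpoly set \<Rightarrow> ('v \<Rightarrow>\<^sub>0 complex) set \<Rightarrow> bool" where
  "secant_line V I L \<longleftrightarrow> L \<in> proj_lines V \<and>
     (\<exists>J l. closed_subscheme V J \<and> subscheme J (scheme_inter V I (line_ideal V L)) \<and>
        has_length V J l \<and> l \<ge> 2)"

definition Sec :: "'v set \<Rightarrow> 'v mpoly set \<Rightarrow> ('v \<Rightarrow>\<^sub>0 complex) set set" where
  "Sec V I = {P \<in> proj_points V. \<exists>L. secant_line V I L \<and> P \<subseteq> L}"

definition zero_locus :: "'v set \<Rightarrow> 'v mpoly set \<Rightarrow> ('v \<Rightarrow>\<^sub>0 complex) set set" where
  "zero_locus V C = {P \<in> proj_points V. \<forall>p\<in>C. \<forall>v\<in>P. eval_poly v p = 0}"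


section \<open>The Veronese embedding\<close>

text \<open>
  The coordinates \<open>z\<^sub>m\<close> of the target of the \<open>d\<close>-th Veronese embedding \<open>v\<^sub>d\<close> are indexed by the
  monomials \<open>m\<close> of degree \<open>d\<close>, i.e. by \<open>monoms V d\<close>, and \<open>v\<^sub>d\<close> is given by the ring homomorphism
  \<open>z\<^sub>m \<mapsto> x\<^sup>m\<close>.
\<close>

definition veronese_hom :: "('v \<Rightarrow>\<^sub>0 nat) mpoly \<Rightarrow> 'v mpoly" where
  "veronese_hom = subst_poly (Poly_Mapping.single 0) (\<lambda>m. Poly_Mapping.single m 1)"

text \<open>
  The subscheme \<open>v\<^sub>d(X)\<close>: its ideal is the kernel of \<open>\<complex>[z] \<rightarrow> \<complex>[x]/I\<close>, where \<open>I\<close> is the saturated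
  ideal of \<open>X\<close>.
\<close>

definition veronese_image :: "'v set \<Rightarrow> nat \<Rightarrow> 'v mpoly set \<Rightarrow> ('v \<Rightarrow>\<^sub>0 nat) mpoly set" where
  "veronese_image V d I = {p \<in> polys (monoms V d). veronese_hom p \<in> I}"

text \<open>The target has dimension \<open>(n + d choose d) - 1\<close> when the source has dimension \<open>n\<close>.\<close>

lemma card_monoms:
  fixes n d :: nat
  shows "card (monoms {..n} d) = (n + d) choose d"
proof -
  have count: "count (Abs_multiset (Poly_Mapping.lookup m)) = Poly_Mapping.lookup m"
    for m :: "nat \<Rightarrow>\<^sub>0 nat"
  proof -
    have "finite {i. Poly_Mapping.lookup m i > 0}"
      using finite_lookup[of m] by simp
    then show ?thesis by (rule count_Abs_multiset)
  qed
  have keys: "set_mset (Abs_multiset (Poly_Mapping.lookup m)) = Poly_Mapping.keys m"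
    for m :: "nat \<Rightarrow>\<^sub>0 nat"
    by (auto simp: set_mset_def count in_keys_iff)
  have sz: "size (Abs_multiset (Poly_Mapping.lookup m)) = mdeg m" for m :: "nat \<Rightarrow>\<^sub>0 nat"
    by (simp add: size_multiset_overloaded_eq keys count mdeg_def)
  have inv: "Poly_Mapping.lookup (Abs_poly_mapping (count M)) = count M" for M :: "nat multiset"
    by (rule Abs_poly_mapping_inverse) simp
  have key: "Poly_Mapping.keys (Abs_poly_mapping (count M)) = set_mset M" for M :: "nat multiset"
    using keys[of "Abs_poly_mapping (count M)"] by (simp add: inv count_inverse)
  have deg: "mdeg (Abs_poly_mapping (count M)) = size M" for M :: "nat multiset"
    using sz[of "Abs_poly_mapping (count M)"] by (simp add: inv count_inverse)
  have "bij_betw (\<lambda>m. Abs_multiset (Poly_Mapping.lookup m)) (monoms {..n} d)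
          (multisets_of_size {..n} d)"
  proof (rule bij_betw_byWitness[where f' = "\<lambda>M. Abs_poly_mapping (count M)"])
    show "\<forall>m\<in>monoms {..n} d. Abs_poly_mapping (count (Abs_multiset (Poly_Mapping.lookup m))) = m"
      by (simp only: count lookup_inverse simp_thms ball_triv)
    show "\<forall>M\<in>multisets_of_size {..n} d.
            Abs_multiset (Poly_Mapping.lookup (Abs_poly_mapping (count M))) = M"
      by (simp only: inv count_inverse simp_thms ball_triv)
    show "(\<lambda>m. Abs_multiset (Poly_Mapping.lookup m)) ` monoms {..n} d \<subseteq> multisets_of_size {..n} d"
      by (rule image_subsetI) (simp only: monoms_def multisets_of_size_def mem_Collect_eq keys sz)
    show "(\<lambda>M. Abs_poly_mapping (count M)) ` multisets_of_size {..n} d \<subseteq> monoms {..n} d"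
      by (rule image_subsetI) (simp only: monoms_def multisets_of_size_def mem_Collect_eq key deg)
  qed
  then have "card (monoms {..n} d) = card (multisets_of_size {..n} d)"
    by (rule bij_betw_same_card)
  then show ?thesis by (simp add: card_multisets_of_size)
qed

end

(*
  A point of the ambient space of v_d is a functional z on the forms of degree d. The cubics are the
  3x3 minors of the catalecticant matrices z(ab), deg a + deg b = d, together with the products of the
  linear forms z -> z(p), p in the ideal of X, with two arbitrary linear forms.

  If these vanish at z, then z factors through the restriction of forms to a plane U (a line of
  projective space), and some quadric Q that is nonzero on U is apolar to z, that is z(QG) = 0 for all
  G; so z lies on the line spanned by the length two scheme v_d(U \<inter> {Q = 0}). It remains to see that
  the quadrics F_i cutting out X vanish on U \<inter> {Q = 0}. For d > 2 this follows from z(F_i G) = 0. For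
  d = 2 the functional is p -> c p(u) + c' p(w) for a basis u, w of U, whence F(u) is proportional to
  F(w); by (K_2) the F_i then restrict to U as multiples of a single quadric, which is taken as Q.

  Conversely, on a secant line the catalecticants have the form A + xB with 2x2 minors divisible by a
  quadratic polynomial in x, which makes their rank at most two. If there is no secant line at all, the
  cubes of the coordinates define the empty set; otherwise every point of v_d(X) lies on one.
*)
theory Submission
  imports Defs "HOL-Computational_Algebra.Fundamental_Theorem_Algebra"
begin

text \<open>The plane U comes from the catalecticant with deg a = 1, the quadric Q from the one with
  deg a = 2: the products of the two coordinates of U give three dependent rows. The secant is
  constructed without distinguishing two points from a tangent direction: the line is parametrised
  as u + x w with w off the scheme, the scheme is a quadratic polynomial g in x, and the remainder
  modulo g replaces the values at two points. In the converse, the 2x2 minors of catalecticants lie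
  in the ideal of v_d(X) because multiplication of forms is commutative. What separates d = 2 is
  that z(F_i G) = 0 then has only constant G, too few conditions to force Q to divide F_i on U.
  There F(u), proportional to F(w), contracts every linear syzygy to a linear form that vanishes at
  u and at w, hence on U; the Koszul relations inherit this. The case without secant lines must be
  split off because the cubics always vanish on v_d(X), also when X is a reduced point and Sec is
  empty.\<close>

declare One_nat_def [simp del]

section \<open>Monomials and forms\<close>

abbreviation const :: "complex \<Rightarrow> 'v mpoly" where
  "const c \<equiv> Poly_Mapping.single 0 c"

abbreviation var :: "'v \<Rightarrow> 'v mpoly" where
  "var i \<equiv> Poly_Mapping.single (Poly_Mapping.single i 1) 1"

lemma poly_mapping_sum_single:
  fixes p :: "'a \<Rightarrow>\<^sub>0 'b::comm_monoid_add"
  shows "p = (\<Sum>m\<in>Poly_Mapping.keys p. Poly_Mapping.single m (Poly_Mapping.lookup p m))"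
proof (rule poly_mapping_eqI)
  fix k
  have "(\<Sum>m\<in>Poly_Mapping.keys p. Poly_Mapping.lookup p m when m = k)
      = (if k \<in> Poly_Mapping.keys p then Poly_Mapping.lookup p k else 0)"
    by (simp add: when_def)
  then show "Poly_Mapping.lookup p k =
    Poly_Mapping.lookup (\<Sum>m\<in>Poly_Mapping.keys p. Poly_Mapping.single m (Poly_Mapping.lookup p m)) k"
    by (auto simp: lookup_sum lookup_single in_keys_iff)
qed

text \<open>Only monomials of \<open>p\<close> itself occur in the case \<open>single\<close>, so a
  condition on the support, such as being a form, can be used there.\<close>

lemma poly_mapping_induct_keys [case_names zero single add]:
  fixes p :: "'a \<Rightarrow>\<^sub>0 'b::comm_monoid_add"
  assumes "P 0"
    and "\<And>m c. m \<in> Poly_Mapping.keys p \<Longrightarrow> P (Poly_Mapping.single m c)"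
    and "\<And>p q. P p \<Longrightarrow> P q \<Longrightarrow> P (p + q)"
  shows "P p"
proof -
  have "P (\<Sum>m\<in>M. Poly_Mapping.single m (Poly_Mapping.lookup p m))"
    if "finite M" "M \<subseteq> Poly_Mapping.keys p" for M
    using that by (induction M) (simp_all add: assms)
  then show ?thesis
    using poly_mapping_sum_single[of p] by (metis finite_keys order_refl)
qed

lemma mdeg_altdef:
  assumes "finite A" "Poly_Mapping.keys m \<subseteq> A"
  shows "mdeg m = (\<Sum>i\<in>A. Poly_Mapping.lookup m i)"
  unfolding mdeg_def
  by (rule sum.mono_neutral_left) (use assms in \<open>auto simp: in_keys_iff\<close>)

lemma mdeg_add [simp]: "mdeg (m + n) = mdeg m + mdeg n"
proof -
  let ?A = "Poly_Mapping.keys m \<union> Poly_Mapping.keys n"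
  show ?thesis
    using keys_add[of m n]
    by (subst (1 2 3) mdeg_altdef[of ?A]) (auto simp: lookup_add sum.distrib)
qed

lemma mdeg_zero [simp]: "mdeg 0 = 0"
  by (simp add: mdeg_def)

lemma mdeg_single [simp]: "mdeg (Poly_Mapping.single i k) = k"
  by (simp add: mdeg_def)

lemma mdeg_eq_0_iff: "mdeg m = 0 \<longleftrightarrow> m = 0"
  by (auto simp: mdeg_def in_keys_iff intro!: poly_mapping_eqI)

lemma keys_add_nat:
  fixes m n :: "'a \<Rightarrow>\<^sub>0 nat"
  shows "Poly_Mapping.keys (m + n) = Poly_Mapping.keys m \<union> Poly_Mapping.keys n"
  by (auto simp: in_keys_iff lookup_add)

lemma monomial_split_var:
  fixes m :: "'a \<Rightarrow>\<^sub>0 nat"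
  assumes "i \<in> Poly_Mapping.keys m"
  obtains n where "m = Poly_Mapping.single i 1 + n"
proof
  show "m = Poly_Mapping.single i 1 + (m - Poly_Mapping.single i 1)"
    using assms by (intro poly_mapping_eqI)
      (auto simp: lookup_add lookup_minus lookup_single when_def in_keys_iff)
qed

lemma monoms_0: "monoms V 0 = {0}"
  by (auto simp: monoms_def mdeg_eq_0_iff)

lemma monoms_Suc: "monoms V (Suc k) = (\<Union>i\<in>V. (+) (Poly_Mapping.single i 1) ` monoms V k)"
proof (intro equalityI subsetI)
  fix m assume m: "m \<in> monoms V (Suc k)"
  then have "Poly_Mapping.keys m \<noteq> {}"
    by (auto simp: monoms_def)
  then obtain i where i: "i \<in> Poly_Mapping.keys m"
    by blast
  then obtain n where n: "m = Poly_Mapping.single i 1 + n"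
    by (rule monomial_split_var)
  with m i show "m \<in> (\<Union>i\<in>V. (+) (Poly_Mapping.single i 1) ` monoms V k)"
    by (auto simp: monoms_def keys_add_nat)
next
  fix m assume "m \<in> (\<Union>i\<in>V. (+) (Poly_Mapping.single i 1) ` monoms V k)"
  then show "m \<in> monoms V (Suc k)"
    by (auto simp: monoms_def keys_add_nat)
qed

lemma monoms_add: "m \<in> monoms V k \<Longrightarrow> n \<in> monoms V l \<Longrightarrow> m + n \<in> monoms V (k + l)"
  by (auto simp: monoms_def keys_add_nat)

lemma monoms_split:
  assumes "m \<in> monoms V (k + l)"
  obtains a b where "a \<in> monoms V k" "b \<in> monoms V l" "m = a + b"
proof -
  have "\<exists>a\<in>monoms V k. \<exists>b\<in>monoms V l. m = a + b"
    using assms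
  proof (induction k arbitrary: m)
    case 0
    then show ?case by (auto simp: monoms_0)
  next
    case (Suc k)
    from Suc.prems obtain i n where n: "i \<in> V" "n \<in> monoms V (k + l)" "m = Poly_Mapping.single i 1 + n"
      by (auto simp: monoms_Suc)
    from Suc.IH[OF n(2)] obtain a b where "a \<in> monoms V k" "b \<in> monoms V l" "n = a + b"
      by blast
    with n show ?case
      by (intro bexI[of _ "Poly_Mapping.single i 1 + a"] bexI[of _ b])
        (auto simp: monoms_Suc add.assoc)
  qed
  then show ?thesis using that by blast
qed

lemma finite_monoms [simp]: "finite V \<Longrightarrow> finite (monoms V k)"
  by (induction k) (simp_all add: monoms_0 monoms_Suc)

lemma polys_0 [simp]: "0 \<in> polys V"
  by (simp add: polys_def)

lemma polys_add [simp]: "p \<in> polys V \<Longrightarrow> q \<in> polys V \<Longrightarrow> p + q \<in> polys V"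
  using keys_add[of p q] by (auto simp: polys_def)

lemma polys_diff [simp]: "p \<in> polys V \<Longrightarrow> q \<in> polys V \<Longrightarrow> p - q \<in> polys V"
  using keys_diff[of p q] by (auto simp: polys_def)

lemma polys_single: "Poly_Mapping.keys m \<subseteq> V \<Longrightarrow> Poly_Mapping.single m c \<in> polys V"
  by (auto simp: polys_def)

lemma polys_const [simp]: "const c \<in> polys V"
  by (rule polys_single) simp

lemma polys_mult [simp]: "p \<in> polys V \<Longrightarrow> q \<in> polys V \<Longrightarrow> p * q \<in> polys V"
  using keys_mult[of p q] by (fastforce simp: polys_def keys_add_nat)

lemma forms_0 [simp]: "0 \<in> forms V k"
  by (simp add: forms_def)

lemma forms_add [simp]: "p \<in> forms V k \<Longrightarrow> q \<in> forms V k \<Longrightarrow> p + q \<in> forms V k"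
  using keys_add[of p q] by (auto simp: forms_def)

lemma forms_diff [simp]: "p \<in> forms V k \<Longrightarrow> q \<in> forms V k \<Longrightarrow> p - q \<in> forms V k"
  using keys_diff[of p q] by (auto simp: forms_def)

lemma forms_sum: "(\<And>x. x \<in> A \<Longrightarrow> f x \<in> forms V k) \<Longrightarrow> sum f A \<in> forms V k"
  by (induction A rule: infinite_finite_induct) auto

lemma forms_mult: "p \<in> forms V k \<Longrightarrow> q \<in> forms V l \<Longrightarrow> p * q \<in> forms V (k + l)"
  using keys_mult[of p q] monoms_add[of _ V k _ l] by (fastforce simp: forms_def)

lemma forms_mult': "p \<in> forms V k \<Longrightarrow> q \<in> forms V l \<Longrightarrow> k + l = n \<Longrightarrow> p * q \<in> forms V n"
  using forms_mult by blast

lemma forms_single: "m \<in> monoms V k \<Longrightarrow> Poly_Mapping.single m c \<in> forms V k"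
  by (auto simp: forms_def)

lemma forms_const [simp]: "const c \<in> forms V 0"
  by (auto simp: forms_def monoms_0)

lemma forms_1 [simp]: "1 \<in> forms V 0"
  by (auto simp: forms_def monoms_0)

lemma forms_cmult [simp]: "p \<in> forms V k \<Longrightarrow> const c * p \<in> forms V k"
  using forms_mult[OF forms_const] by fastforce

lemma forms_var [simp]: "i \<in> V \<Longrightarrow> var i \<in> forms V 1"
  by (auto simp: forms_def monoms_def)

lemma forms_power: "p \<in> forms V k \<Longrightarrow> p ^ n \<in> forms V (n * k)"
  by (induction n) (auto intro: forms_mult)

lemma forms_power_1 [simp]: "p \<in> forms V 1 \<Longrightarrow> p ^ n \<in> forms V n"
  using forms_power[of p V 1 n] by simp

lemma forms_polys: "p \<in> forms V k \<Longrightarrow> p \<in> polys V"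
  by (auto simp: forms_def polys_def monoms_def)

lemma forms_induct [consumes 1, case_names zero single add]:
  assumes "p \<in> forms V k"
    and "P 0"
    and "\<And>m c. m \<in> monoms V k \<Longrightarrow> P (Poly_Mapping.single m c)"
    and "\<And>p q. P p \<Longrightarrow> P q \<Longrightarrow> P (p + q)"
  shows "P p"
  by (rule poly_mapping_induct_keys[of P p]) (use assms in \<open>auto simp: forms_def\<close>)

lemma forms_0_cases: "p \<in> forms V 0 \<Longrightarrow> \<exists>c. p = const c"
  by (induction p rule: forms_induct) (auto simp: monoms_0 simp flip: single_add intro: exI[of _ 0])

text \<open>A monomial of positive degree has a variable as a factor. Induction on the degree with
  this rule replaces computations with products over exponents.\<close>

lemma forms_Suc_induct [consumes 1, case_names zero var add]:
  assumes p: "p \<in> forms V (Suc k)"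
    and zero: "P 0"
    and var: "\<And>i q. i \<in> V \<Longrightarrow> q \<in> forms V k \<Longrightarrow> P (var i * q)"
    and add: "\<And>p q. P p \<Longrightarrow> P q \<Longrightarrow> P (p + q)"
  shows "P p"
  using p zero _ add
proof (rule forms_induct)
  fix m :: "'a \<Rightarrow>\<^sub>0 nat" and c assume "m \<in> monoms V (Suc k)"
  then obtain i n where n: "i \<in> V" "n \<in> monoms V k" "m = Poly_Mapping.single i 1 + n"
    by (auto simp: monoms_Suc)
  then show "P (Poly_Mapping.single m c)"
    using var[of i "Poly_Mapping.single n c"] by (simp add: mult_single forms_single)
qed

lemma scale_eq: "scale c p = const c * p"
  by (simp add: scale_def mult_map_scale_conv_mult)

section \<open>Homogeneous parts\<close>

lemma lookup_hom_part:
  "Poly_Mapping.lookup (hom_part k p) m = (Poly_Mapping.lookup p m when mdeg m = k)"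
  unfolding hom_part_def lookup_sum lookup_single
  by (subst sum.cong[OF refl, of _ _ "\<lambda>n. if n = m then Poly_Mapping.lookup p m else 0"])
    (auto simp: when_def in_keys_iff)

lemma hom_part_0 [simp]: "hom_part k 0 = 0"
  by (rule poly_mapping_eqI) (simp add: lookup_hom_part)

lemma hom_part_add: "hom_part k (p + q) = hom_part k p + hom_part k q"
  by (rule poly_mapping_eqI) (simp add: lookup_hom_part lookup_add when_def)

lemma hom_part_sum: "hom_part k (sum f A) = (\<Sum>x\<in>A. hom_part k (f x))"
  by (induction A rule: infinite_finite_induct) (simp_all add: hom_part_add)

lemma hom_part_forms [simp]: "p \<in> polys V \<Longrightarrow> hom_part k p \<in> forms V k"
  by (auto simp: forms_def polys_def monoms_def in_keys_iff lookup_hom_part)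

lemma hom_part_of_form: "p \<in> forms V j \<Longrightarrow> hom_part k p = (if k = j then p else 0)"
  by (intro poly_mapping_eqI)
    (auto simp: lookup_hom_part when_def forms_def monoms_def in_keys_iff)

text \<open>Stated for all large \<open>K\<close>, so that a use may also ask \<open>K\<close> to
  exceed a given degree.\<close>

lemma sum_hom_parts: "\<exists>N. \<forall>K\<ge>N. (\<Sum>k\<le>K. hom_part k p) = p"
proof (intro exI allI impI)
  fix K assume K: "K \<ge> (\<Sum>m\<in>Poly_Mapping.keys p. mdeg m)"
  show "(\<Sum>k\<le>K. hom_part k p) = p"
  proof (rule poly_mapping_eqI)
    fix m
    have "m \<in> Poly_Mapping.keys p \<Longrightarrow> mdeg m \<le> K"
      using K member_le_sum[of m "Poly_Mapping.keys p" mdeg] by force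
    then show "Poly_Mapping.lookup (\<Sum>k\<le>K. hom_part k p) m = Poly_Mapping.lookup p m"
      by (auto simp: lookup_sum lookup_hom_part when_def in_keys_iff)
  qed
qed

lemma hom_part_mult_form:
  assumes f: "f \<in> forms V j" and p: "p \<in> polys V"
  shows "hom_part k (f * p) = (if j \<le> k then f * hom_part (k - j) p else 0)"
proof -
  obtain K where K: "(\<Sum>l\<le>K. hom_part l p) = p" and kK: "k \<le> K"
    using sum_hom_parts[of p] by (meson nat_le_linear)
  have "hom_part k (f * p) = (\<Sum>l\<le>K. hom_part k (f * hom_part l p))"
    by (subst K[symmetric]) (simp add: sum_distrib_left hom_part_sum)
  also have "\<dots> = (\<Sum>l\<le>K. if k = j + l then f * hom_part l p else 0)"
    using f p by (intro sum.cong refl hom_part_of_form[of _ V] forms_mult) simp_all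
  also have "\<dots> = (\<Sum>l\<le>K. if l = k - j then (if j \<le> k then f * hom_part l p else 0) else 0)"
    by (intro sum.cong) auto
  also have "\<dots> = (if j \<le> k then f * hom_part (k - j) p else 0)"
    using kK by auto
  finally show ?thesis .
qed

lemma hom_part_mult:
  assumes "p \<in> polys V" "q \<in> polys V"
  shows "hom_part k (p * q) = (\<Sum>j\<le>k. hom_part j p * hom_part (k - j) q)"
proof -
  obtain K where K: "(\<Sum>l\<le>K. hom_part l p) = p" and kK: "k \<le> K"
    using sum_hom_parts[of p] by (meson nat_le_linear)
  have "hom_part k (p * q) = (\<Sum>l\<le>K. hom_part k (hom_part l p * q))"
    by (subst K[symmetric]) (simp add: sum_distrib_right hom_part_sum)
  also have "\<dots> = (\<Sum>l\<le>K. if l \<le> k then hom_part l p * hom_part (k - l) q else 0)"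
    using assms by (intro sum.cong refl hom_part_mult_form[of _ V]) simp_all
  also have "\<dots> = (\<Sum>j\<le>k. hom_part j p * hom_part (k - j) q)"
    using kK by (intro sum.mono_neutral_cong_right) auto
  finally show ?thesis .
qed

section \<open>Substitution homomorphisms\<close>

locale coeff_hom =
  fixes c :: "complex \<Rightarrow> 'r::comm_ring_1"
  assumes c_0: "c 0 = 0" and c_1: "c 1 = 1"
    and c_add: "c (x + y) = c x + c y" and c_mult: "c (x * y) = c x * c y"
begin

lemma subst_single:
  "subst_poly c f (Poly_Mapping.single m a) =
    c a * (\<Prod>i\<in>Poly_Mapping.keys m. f i ^ Poly_Mapping.lookup m i)"
  by (simp add: subst_poly_def c_0)

lemma subst_0 [simp]: "subst_poly c f 0 = 0"
  by (simp add: subst_poly_def)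

lemma subst_add: "subst_poly c f (p + q) = subst_poly c f p + subst_poly c f q"
  unfolding subst_poly_def
  by (rule setsum_keys_plus_distrib) (simp_all add: c_0 c_add distrib_right)

lemma subst_const [simp]: "subst_poly c f (const a) = c a"
  by (simp add: subst_single)

lemma subst_1 [simp]: "subst_poly c f 1 = 1"
  using subst_const[of f 1] by (simp add: c_1)

lemma subst_var [simp]: "subst_poly c f (var i) = f i"
  by (simp add: subst_single c_1)

lemma prod_add_monomial:
  "(\<Prod>i\<in>Poly_Mapping.keys (m + n). f i ^ Poly_Mapping.lookup (m + n) i) =
   (\<Prod>i\<in>Poly_Mapping.keys m. f i ^ Poly_Mapping.lookup m i) *
   (\<Prod>i\<in>Poly_Mapping.keys n. f i ^ Poly_Mapping.lookup n i)"
    (is "?L = ?M * ?N")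
proof -
  let ?A = "Poly_Mapping.keys m \<union> Poly_Mapping.keys n"
  have "?M = (\<Prod>i\<in>?A. f i ^ Poly_Mapping.lookup m i)"
    by (rule prod.mono_neutral_left) (auto simp: in_keys_iff)
  moreover have "?N = (\<Prod>i\<in>?A. f i ^ Poly_Mapping.lookup n i)"
    by (rule prod.mono_neutral_left) (auto simp: in_keys_iff)
  ultimately show ?thesis
    by (simp add: keys_add_nat lookup_add power_add prod.distrib)
qed

lemma subst_mult_single:
  "subst_poly c f (Poly_Mapping.single m a * Poly_Mapping.single n b) =
    subst_poly c f (Poly_Mapping.single m a) * subst_poly c f (Poly_Mapping.single n b)"
  by (simp only: mult_single subst_single prod_add_monomial c_mult mult.assoc mult.left_commute)

lemma subst_mult: "subst_poly c f (p * q) = subst_poly c f p * subst_poly c f q"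
proof (induction p rule: poly_mapping_induct_keys)
  case (single m a)
  show ?case
    by (induction q rule: poly_mapping_induct_keys)
      (simp_all only: subst_mult_single subst_add distrib_left mult_zero_right subst_0)
qed (simp_all only: subst_add distrib_right mult_zero_left subst_0)

lemma subst_diff: "subst_poly c f (p - q) = subst_poly c f p - subst_poly c f q"
  using subst_add[of f "p - q" q] by simp

lemma subst_sum: "subst_poly c f (sum g A) = (\<Sum>x\<in>A. subst_poly c f (g x))"
  by (induction A rule: infinite_finite_induct) (simp_all add: subst_add)

lemma subst_power: "subst_poly c f (p ^ n) = subst_poly c f p ^ n"
  by (induction n) (simp_all add: subst_mult)

end

text \<open>Constants and variables generate the polynomial ring, so they determine a homomorphism.
  The use is to identify restriction to a line followed by evaluation at x with evaluation at the
  point u + x w.\<close>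

lemma subst_poly_eqI:
  assumes c: "coeff_hom c" and h0: "h 0 = 0" and hadd: "\<And>p q. h (p + q) = h p + h q"
    and hmult: "\<And>p q. h (p * q) = h p * h q" and hc: "\<And>a. h (const a) = c a"
    and hvar: "\<And>i. i \<in> V \<Longrightarrow> h (var i) = f i" and p: "p \<in> polys V"
  shows "h p = subst_poly c f p"
proof (induction p rule: poly_mapping_induct_keys)
  interpret coeff_hom c by fact
  case (single m a)
  with p have "m \<in> monoms V (mdeg m)"
    by (auto simp: polys_def monoms_def)
  then show ?case
  proof (induction "mdeg m" arbitrary: m)
    case 0
    then show ?case by (simp add: monoms_0 hc)
  next
    case (Suc k)
    from Suc.prems have "m \<in> monoms V (Suc k)"
      by (simp only: Suc.hyps(2))
    then obtain i n where n: "i \<in> V" "n \<in> monoms V k" "m = Poly_Mapping.single i 1 + n"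
      by (auto simp: monoms_Suc)
    from n(2) have "mdeg n = k"
      by (simp add: monoms_def)
    have eq: "Poly_Mapping.single m a = var i * Poly_Mapping.single n a"
      by (simp add: n mult_single)
    have IH: "h (Poly_Mapping.single n a) = subst_poly c f (Poly_Mapping.single n a)"
      using Suc.hyps(1)[of n] \<open>mdeg n = k\<close> n(2) by simp
    have "h (Poly_Mapping.single m a) = f i * subst_poly c f (Poly_Mapping.single n a)"
      by (simp only: eq hmult hvar[OF n(1)] IH)
    also have "\<dots> = subst_poly c f (Poly_Mapping.single m a)"
      by (simp only: eq subst_mult subst_var)
    finally show ?case .
  qed
next
  case zero
  interpret coeff_hom c by fact
  show ?case by (simp add: h0)
next
  case (add p q)
  interpret coeff_hom c by fact
  show ?case by (simp add: add hadd subst_add)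
qed

section \<open>Evaluation at points and restriction to lines\<close>

interpretation ev: coeff_hom "\<lambda>a::complex. a"
  by unfold_locales auto

interpretation polyc: coeff_hom "\<lambda>a::complex. [:a:]"
  by unfold_locales (auto simp: one_pCons)

interpretation mpolyc: coeff_hom "Poly_Mapping.single 0 :: complex \<Rightarrow> 'v mpoly"
  by unfold_locales (simp_all add: single_add mult_single)

lemma eval_poly_simps [simp]:
  "eval_poly v 0 = 0" "eval_poly v 1 = 1" "eval_poly v (const a) = a"
  "eval_poly v (p + q) = eval_poly v p + eval_poly v q"
  "eval_poly v (p - q) = eval_poly v p - eval_poly v q"
  "eval_poly v (p * q) = eval_poly v p * eval_poly v q"
  "eval_poly v (p ^ n) = eval_poly v p ^ n"
  "eval_poly v (var i) = Poly_Mapping.lookup v i"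
  by (simp_all add: eval_poly_def ev.subst_add ev.subst_diff ev.subst_mult ev.subst_power)

lemma eval_poly_sum: "eval_poly v (sum f A) = (\<Sum>x\<in>A. eval_poly v (f x))"
  by (simp add: eval_poly_def ev.subst_sum)

text \<open>The restriction of a polynomial to the parametrised affine line \<open>x \<mapsto> u + x w\<close>.\<close>

definition restr :: "('v \<Rightarrow>\<^sub>0 complex) \<Rightarrow> ('v \<Rightarrow>\<^sub>0 complex) \<Rightarrow> 'v mpoly \<Rightarrow> complex poly" where
  "restr u w = subst_poly (\<lambda>a. [:a:]) (\<lambda>i. [:Poly_Mapping.lookup u i, Poly_Mapping.lookup w i:])"

lemma restr_simps [simp]:
  "restr u w 0 = 0" "restr u w 1 = 1" "restr u w (const a) = [:a:]"
  "restr u w (p + q) = restr u w p + restr u w q"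
  "restr u w (p - q) = restr u w p - restr u w q"
  "restr u w (p * q) = restr u w p * restr u w q"
  "restr u w (p ^ n) = restr u w p ^ n"
  "restr u w (var i) = [:Poly_Mapping.lookup u i, Poly_Mapping.lookup w i:]"
  by (simp_all add: restr_def polyc.subst_add polyc.subst_diff polyc.subst_mult polyc.subst_power)

lemma restr_sum: "restr u w (sum f A) = (\<Sum>x\<in>A. restr u w (f x))"
  by (simp add: restr_def polyc.subst_sum)

lemma poly_restr: "poly (restr u w p) x = eval_poly (u + scale x w) p"
  unfolding eval_poly_def
  by (intro subst_poly_eqI[where V = UNIV and h = "\<lambda>p. poly (restr u w p) x"])
    (auto simp: ev.coeff_hom_axioms lookup_add lookup_scale polys_def)

lemma degree_restr: "p \<in> forms V k \<Longrightarrow> degree (restr u w p) \<le> k"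
proof (induction k arbitrary: p)
  case 0
  then show ?case using forms_0_cases[of p V] by auto
next
  case (Suc k)
  from Suc.prems show ?case
  proof (induction p rule: forms_Suc_induct)
    case (var i q)
    have "degree [:Poly_Mapping.lookup u i, Poly_Mapping.lookup w i:] \<le> 1"
      by simp
    then show ?case
      using Suc.IH[OF var(2)] by (simp only: restr_simps) (intro order.trans[OF degree_mult_le]; linarith)
  qed (auto intro: degree_add_le)
qed

text \<open>In the parametrisation u + x w the point \<open>w\<close> lies at infinity. Its value
  therefore sits in the coefficient of the nominal degree \<open>k\<close>, even if the restriction
  has smaller degree.\<close>

lemma coeff_restr_top: "p \<in> forms V k \<Longrightarrow> coeff (restr u w p) k = eval_poly w p"
proof (induction k arbitrary: p)
  case 0
  then show ?case using forms_0_cases[of p V] by auto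
next
  case (Suc k)
  from Suc.prems show ?case
  proof (induction p rule: forms_Suc_induct)
    case (var i q)
    have "coeff (restr u w q) (Suc k) = 0"
      using degree_restr[OF var(2), of u w] by (simp add: coeff_eq_0)
    then show ?case
      using Suc.IH[OF var(2)] by (simp)
  qed auto
qed

lemma restr_linear: "p \<in> forms V 1 \<Longrightarrow> restr u w p = [:eval_poly u p, eval_poly w p:]"
proof (rule poly_eqI)
  fix n :: nat assume p: "p \<in> forms V 1"
  have "poly (restr u w p) 0 = eval_poly u p"
    by (simp add: poly_restr)
  then have 0: "coeff (restr u w p) 0 = eval_poly u p"
    by (simp add: poly_0_coeff_0)
  consider "n = 0" | "n = 1" | "n > 1" by fastforce
  then show "coeff (restr u w p) n = coeff [:eval_poly u p, eval_poly w p:] n"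
  proof cases
    case 3
    then show ?thesis
      using degree_restr[OF p, of u w] by (simp add: coeff_eq_0 coeff_pCons split: nat.split)
  qed (use 0 coeff_restr_top[OF p, of u w] in \<open>auto simp: One_nat_def\<close>)
qed

lemma eval_poly_scale:
  assumes "p \<in> forms V k"
  shows "eval_poly (scale c v) p = c ^ k * eval_poly v p"
  using assms
proof (induction k arbitrary: p)
  case 0
  then show ?case using forms_0_cases[of p V] by auto
next
  case (Suc k)
  from Suc.prems show ?case
    by (induction p rule: forms_Suc_induct)
      (auto simp: Suc.IH lookup_scale algebra_simps)
qed

lemma eval_poly_linear:
  assumes "p \<in> forms V 1"
  shows "eval_poly (scale s u + scale t w) p = s * eval_poly u p + t * eval_poly w p"
proof -
  have "eval_poly (u' + w') p = eval_poly u' p + eval_poly w' p" for u' w'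
    using poly_restr[of u' w' p 1] restr_linear[OF assms, of u' w']
    by (simp add: lin.scale_one)
  then show ?thesis
    by (simp add: eval_poly_scale[OF assms])
qed

text \<open>Along the ray x v a form of degree l is a multiple of x^l, so the coefficients separate
  the homogeneous parts. This is how the ideal of a line is seen to be homogeneous.\<close>

lemma coeff_restr_hom_part: "coeff (restr 0 v p) k = eval_poly v (hom_part k p)"
proof -
  have p: "p \<in> polys UNIV"
    by (simp add: polys_def)
  obtain K where K: "(\<Sum>l\<le>K. hom_part l p) = p" and kK: "k \<le> K"
    using sum_hom_parts[of p] by (meson nat_le_linear)
  have mon: "restr 0 v q = monom (eval_poly v q) l" if q: "q \<in> forms UNIV l" for q l
  proof (rule poly_eq_poly_eq_iff[THEN iffD1], rule ext)
    fix x show "poly (restr 0 v q) x = poly (monom (eval_poly v q) l) x"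
      by (simp add: poly_restr eval_poly_scale[OF q] poly_monom mult.commute)
  qed
  have "restr 0 v p = (\<Sum>l\<le>K. monom (eval_poly v (hom_part l p)) l)"
    by (subst K[symmetric]) (simp add: restr_sum mon[OF hom_part_forms[OF p]])
  then show ?thesis
    using kK by (simp add: coeff_sum)
qed

text \<open>The affine line reaches every point of the projective line except \<open>w\<close>; that
  point is the case \<open>s = 0\<close> and is supplied by the top coefficient.\<close>

lemma vanish_on_plane:
  assumes p: "p \<in> forms V k" and 0: "restr u w p = 0"
  shows "eval_poly (scale s u + scale t w) p = 0"
proof (cases "s = 0")
  case True
  then show ?thesis
    using coeff_restr_top[OF p, of u w] 0 by (simp add: eval_poly_scale[OF p])
next
  case False
  have "scale s u + scale t w = scale s (u + scale (t / s) w)"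
    using False by (intro poly_mapping_eqI) (simp add: lookup_add lookup_scale algebra_simps)
  then show ?thesis
    using poly_restr[of u w p "t / s"] 0 by (simp add: eval_poly_scale[OF p])
qed

lemma restr_eq_0I:
  assumes "\<And>s t. eval_poly (scale s u + scale t w) p = 0"
  shows "restr u w p = 0"
proof -
  have "poly (restr u w p) x = 0" for x
    using assms[of 1 x] by (simp add: poly_restr)
  then show ?thesis
    using poly_all_0_iff_0 by blast
qed

section \<open>Planes with dual linear forms\<close>

definition frame :: "'v set \<Rightarrow> ('v \<Rightarrow>\<^sub>0 complex) \<Rightarrow> ('v \<Rightarrow>\<^sub>0 complex) \<Rightarrow> 'v mpoly \<Rightarrow> 'v mpoly \<Rightarrow> bool" where
  "frame V u w l m \<longleftrightarrow> u \<in> vecs V \<and> w \<in> vecs V \<and> l \<in> forms V 1 \<and> m \<in> forms V 1 \<and>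
     eval_poly u l = 1 \<and> eval_poly w l = 0 \<and> eval_poly u m = 0 \<and> eval_poly w m = 1"

text \<open>Thus \<open>l\<close> dehomogenises and \<open>m\<close> becomes the coordinate x:
  multiplying by a power of \<open>l\<close> raises the degree of a form without changing its
  restriction.\<close>

lemma frame_restr:
  assumes "frame V u w l m"
  shows "restr u w l = 1" "restr u w m = [:0, 1:]"
  using assms by (auto simp: frame_def restr_linear one_pCons)

lemma frame_swap: "frame V u w l m \<Longrightarrow> frame V w u m l"
  by (auto simp: frame_def)

lemma vecs_0 [simp]: "0 \<in> vecs V"
  by (simp add: vecs_def)

lemma vecs_lincomb [simp]:
  "u \<in> vecs V \<Longrightarrow> w \<in> vecs V \<Longrightarrow> scale s u + scale t w \<in> vecs V"
  unfolding vecs_def in_keys_iff subset_iff mem_Collect_eq lookup_add lookup_scale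
  by (metis add_0 mult_zero_right)

lemma vecs_scale [simp]: "u \<in> vecs V \<Longrightarrow> scale s u \<in> vecs V"
  using vecs_lincomb[of u V 0 s 0] by simp

lemma vecs_add [simp]: "u \<in> vecs V \<Longrightarrow> w \<in> vecs V \<Longrightarrow> u + w \<in> vecs V"
  using vecs_lincomb[of u V w 1 1] by simp

lemma restr_change_eq_0:
  assumes p: "p \<in> forms V k" and 0: "restr u w p = 0"
  shows "restr (scale a u + scale b w) (scale c u + scale d w) p = 0"
proof (rule restr_eq_0I)
  fix s t
  have "scale s (scale a u + scale b w) + scale t (scale c u + scale d w) =
    scale (s * a + t * c) u + scale (s * b + t * d) w"
    by (intro poly_mapping_eqI) (simp add: lookup_add lookup_scale algebra_simps)
  then show "eval_poly (scale s (scale a u + scale b w) +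
      scale t (scale c u + scale d w)) p = 0"
    using vanish_on_plane[OF p 0] by simp
qed

text \<open>Dual forms change by the inverse transpose of the matrix with rows (a, b) and (c, d),
  which explains the entries over the determinant.\<close>

lemma frame_change:
  assumes fr: "frame V u w l m" and D: "a * d - b * c \<noteq> 0"
    and u': "u' = scale a u + scale b w" and w': "w' = scale c u + scale d w"
  defines "D \<equiv> a * d - b * c"
  shows "frame V u' w' (const (d / D) * l - const (c / D) * m) (const (a / D) * m - const (b / D) * l)"
proof -
  have D0: "D \<noteq> 0" using D by (simp add: D_def)
  have l: "l \<in> forms V 1" and m: "m \<in> forms V 1"
    using fr by (auto simp: frame_def)
  show ?thesis
    using fr D0 unfolding frame_def u' w'
    by (simp add: eval_poly_linear[OF l] eval_poly_linear[OF m] diff_divide_distrib[symmetric])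
      (simp add: D_def mult.commute)
qed

text \<open>The homogenisation of \<open>r\<close> to degree \<open>k\<close> in the binary
  coordinates \<open>l\<close> and \<open>m\<close>; it loses nothing as long as
  \<open>degree r \<le> k\<close>.\<close>

definition bform :: "'v mpoly \<Rightarrow> 'v mpoly \<Rightarrow> nat \<Rightarrow> complex poly \<Rightarrow> 'v mpoly" where
  "bform l m k r = (\<Sum>j\<le>k. const (coeff r j) * l ^ (k - j) * m ^ j)"

lemma bform_0 [simp]: "bform l m k 0 = 0"
  by (simp add: bform_def)

lemma bform_add: "bform l m k (r + s) = bform l m k r + bform l m k s"
  by (simp add: bform_def single_add distrib_right sum.distrib)

lemma bform_forms: "l \<in> forms V 1 \<Longrightarrow> m \<in> forms V 1 \<Longrightarrow> bform l m k r \<in> forms V k"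
  unfolding bform_def
  by (intro forms_sum) (auto intro!: forms_mult'[OF forms_cmult[OF forms_power_1] forms_power_1])

lemma restr_bform:
  assumes "frame V u w l m" "degree r \<le> k"
  shows "restr u w (bform l m k r) = r"
proof -
  have x: "[:0, 1:] ^ j = (monom 1 j :: complex poly)" for j
    by (simp add: monom_altdef)
  have "restr u w (bform l m k r) = (\<Sum>j\<le>k. monom (coeff r j) j)"
    by (simp add: bform_def restr_sum frame_restr[OF assms(1)] x smult_monom)
  also have "\<dots> = r"
    using assms(2) by (rule poly_as_sum_of_monoms')
  finally show ?thesis .
qed

lemma const_mult: "const (a * b) = const a * const b"
  by (simp add: mult_single)

text \<open>Homogenisation is multiplicative in a linear factor. Since \<open>l\<close> and
  \<open>m\<close> are arbitrary forms here, the identity is available before a frame is known, and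
  also with \<open>m = 0\<close>.\<close>

lemma bform_Suc:
  assumes "degree r \<le> k"
  shows "bform l m (Suc k) ([:a, b:] * r) = (const a * l + const b * m) * bform l m k r"
proof -
  have "coeff r (Suc k) = 0"
    using assms by (simp add: coeff_eq_0)
  then have A: "bform l m (Suc k) (smult a r) = const a * l * bform l m k r"
    by (simp add: bform_def sum_distrib_left Suc_diff_le const_mult mult_ac cong: sum.cong_simp)
  have B: "bform l m (Suc k) (pCons 0 (smult b r)) = const b * m * bform l m k r"
    unfolding bform_def
    by (subst sum.atMost_Suc_shift)
      (simp add: sum_distrib_left const_mult mult_ac)
  have "[:a, b:] * r = smult a r + pCons 0 (smult b r)"
    by simp
  then show ?thesis
    by (simp only: bform_add A B distrib_right)
qed

section \<open>Dimensions, points and lines\<close>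

lemma subspace_forms: "lin.subspace (forms V k)"
  by (rule lin.subspaceI) (simp_all add: scale_eq)

lemma forms_subset_span: "forms V k \<subseteq> lin.span ((\<lambda>m. Poly_Mapping.single m 1) ` monoms V k)"
proof
  fix p assume "p \<in> forms V k"
  then show "p \<in> lin.span ((\<lambda>m. Poly_Mapping.single m 1) ` monoms V k)"
  proof (induction p rule: forms_induct)
    case (single m c)
    have "Poly_Mapping.single m c = scale c (Poly_Mapping.single m 1)"
      by (simp add: scale_def)
    with single show ?case
      by (simp add: lin.span_base lin.span_scale)
  qed (auto intro: lin.span_zero lin.span_add)
qed

text \<open>A basis of \<open>B\<close> is extended by the single vector \<open>e\<close>. The
  finite spanning set \<open>F\<close> makes this basis finite, so that \<open>lin.dim\<close>
  really counts it.\<close>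

lemma dim_codim_1:
  assumes B: "lin.subspace B" and BA: "B \<subseteq> A" and F: "finite F" "A \<subseteq> lin.span F"
    and e: "e \<in> A" "e \<notin> B" and dec: "\<And>a. a \<in> A \<Longrightarrow> \<exists>c. a - scale c e \<in> B"
  shows "lin.dim A = lin.dim B + 1"
proof -
  obtain S where S: "S \<subseteq> B" "lin.independent S" "B \<subseteq> lin.span S" "card S = lin.dim B"
    using lin.basis_exists[of B] by blast
  have "finite S"
    using lin.independent_span_bound[OF F(1) S(2)] S(1) BA F(2) by blast
  have spanS: "lin.span S = B"
    using S B by (simp add: lin.span_minimal subset_antisym)
  show ?thesis
  proof (rule lin.dim_unique)
    show "insert e S \<subseteq> A" using S BA e by blast
    show "lin.independent (insert e S)"
      using S(2) e spanS by (simp add: lin.independent_insert)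
    show "A \<subseteq> lin.span (insert e S)"
      using dec spanS by (auto simp: lin.span_insert)
    show "card (insert e S) = lin.dim B + 1"
      using \<open>finite S\<close> S e by (auto simp: card_insert_if)
  qed
qed

lemma dim_le_codim_1:
  assumes B: "lin.subspace B" and BA: "B \<subseteq> A" and F: "finite F" "A \<subseteq> lin.span F"
    and dec: "\<And>e a. e \<in> A \<Longrightarrow> a \<in> A \<Longrightarrow> e \<notin> B \<Longrightarrow> \<exists>c. a - scale c e \<in> B"
  shows "lin.dim A \<le> lin.dim B + 1"
proof (cases "A = B")
  case False
  with BA obtain e where "e \<in> A" "e \<notin> B" by blast
  then show ?thesis
    using dim_codim_1[OF B BA F, of e] dec by fastforce
qed simp

lemma span_pair: "lin.span {u, w} = {scale s u + scale t w | s t. True}"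
proof -
  have "x \<in> lin.span {u, w} \<longleftrightarrow> (\<exists>s t. x = scale s u + scale t w)" for x
    by (auto simp: lin.span_insert lin.span_singleton algebra_simps)
  then show ?thesis by auto
qed

lemma frame_unique:
  assumes "frame V u w l m"
  shows "scale s u + scale t w = 0 \<longleftrightarrow> s = 0 \<and> t = 0"
proof -
  have "eval_poly (scale s u + scale t w) l = s" "eval_poly (scale s u + scale t w) m = t"
    using assms eval_poly_linear[of l V s u t w] eval_poly_linear[of m V s u t w]
    by (auto simp: frame_def)
  moreover have "eval_poly 0 l = 0" "eval_poly 0 m = 0"
    using assms eval_poly_linear[of l V 0 u 0 w] eval_poly_linear[of m V 0 u 0 w]
    by (auto simp: frame_def)
  ultimately show ?thesis by auto
qed

lemma frame_line: "frame V u w l m \<Longrightarrow> lin.span {u, w} \<in> proj_lines V"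
proof -
  assume fr: "frame V u w l m"
  have uw: "u \<in> vecs V" "w \<in> vecs V"
    using fr by (auto simp: frame_def)
  have w: "w \<noteq> 0"
    using frame_unique[OF fr, of 0 1] by auto
  have u: "u \<notin> lin.span {w}"
  proof
    assume "u \<in> lin.span {w}"
    then obtain t where "u = scale t w" by (auto simp: lin.span_singleton)
    then show False using frame_unique[OF fr, of 1 "- t"] by auto
  qed
  have "u \<noteq> w" using u lin.span_base[of w "{w}"] by auto
  have "lin.independent {u, w}"
    using u w \<open>u \<noteq> w\<close> by (simp add: lin.independent_insert lin.dependent_single)
  then have "lin.dim (lin.span {u, w}) = 2"
    using \<open>u \<noteq> w\<close> lin.dim_span_eq_card_independent[of "{u, w}"] by simp
  moreover have "lin.span {u, w} \<subseteq> vecs V"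
    using uw by (auto simp: span_pair)
  ultimately show ?thesis
    by (simp add: proj_lines_def)
qed

text \<open>Independence yields a nonzero 2x2 minor of the two coordinate vectors, and Cramer's rule
  in those two coordinates writes down the dual forms.\<close>

lemma frame_exists:
  assumes uw: "u \<in> vecs V" "w \<in> vecs V"
    and indep: "\<And>s t. scale s u + scale t w = 0 \<Longrightarrow> s = 0 \<and> t = 0"
  obtains l m where "frame V u w l m"
proof -
  let ?u = "Poly_Mapping.lookup u" and ?w = "Poly_Mapping.lookup w"
  have "\<exists>i j. ?u i * ?w j - ?u j * ?w i \<noteq> 0"
  proof (rule ccontr)
    assume *: "\<not> ?thesis"
    have "u \<noteq> 0" using indep[of 1 0] by auto
    then obtain i where i: "?u i \<noteq> 0"
      by (metis poly_mapping_eqI lookup_zero)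
    have "scale (?w i) u + scale (- ?u i) w = 0"
      using * by (intro poly_mapping_eqI) (simp add: lookup_add lookup_minus lookup_scale algebra_simps)
    from indep[OF this] i show False by simp
  qed
  then obtain i j where D: "?u i * ?w j - ?u j * ?w i \<noteq> 0" by blast
  have "i \<in> V" "j \<in> V"
    using uw D by (auto simp: vecs_def in_keys_iff subset_iff) (metis mult_zero_left mult_zero_right)+
  define D where "D = ?u i * ?w j - ?u j * ?w i"
  have "D \<noteq> 0" using D by (simp add: D_def)
  show ?thesis
  proof
    show "frame V u w (const (?w j / D) * var i - const (?w i / D) * var j)
        (const (?u i / D) * var j - const (?u j / D) * var i)"
      using uw \<open>i \<in> V\<close> \<open>j \<in> V\<close> \<open>D \<noteq> 0\<close>
      by (simp add: frame_def diff_divide_distrib[symmetric]) (simp add: D_def mult.commute)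
  qed
qed

lemma line_frame:
  assumes "L \<in> proj_lines V"
  obtains u w l m where "frame V u w l m" "L = lin.span {u, w}"
proof -
  have L: "lin.subspace L" "L \<subseteq> vecs V" "lin.dim L = 2"
    using assms by (auto simp: proj_lines_def)
  obtain S where S: "S \<subseteq> L" "lin.independent S" "L \<subseteq> lin.span S" "card S = 2"
    using lin.basis_exists[of L] L by metis
  then obtain u w where uw: "S = {u, w}" "u \<noteq> w"
    by (auto simp: card_2_iff)
  have span: "L = lin.span {u, w}"
    using S L uw by (metis lin.span_minimal subset_antisym)
  have dep: "x \<notin> lin.span {y}" if "{x, y} = {u, w}" for x y
    using that S(2) uw lin.dependent_def[of S] by (auto simp: doubleton_eq_iff insert_Diff_if)
  have "s = 0 \<and> t = 0" if st: "scale s u + scale t w = 0" for s t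
  proof -
    have aux: "a = 0" if "{x, y} = {u, w}" "scale a x + scale b y = 0" for a b x y
    proof (rule ccontr)
      assume a: "a \<noteq> 0"
      have "x = scale (- b / a) y"
      proof (rule poly_mapping_eqI)
        fix i
        have "Poly_Mapping.lookup (scale a x + scale b y) i = 0"
          by (simp add: that)
        then show "Poly_Mapping.lookup x i = Poly_Mapping.lookup (scale (- b / a) y) i"
          using a by (simp add: lookup_add lookup_scale field_simps eq_neg_iff_add_eq_0)
      qed
      then show False
        using dep[OF that(1)] lin.span_singleton[of y] by blast
    qed
    show ?thesis
      using aux[of u w s t] aux[of w u t s] st by (auto simp: add.commute)
  qed
  with S L uw obtain l m where "frame V u w l m"
    using frame_exists[of u V w] by (metis insert_subset subset_iff)
  with span show ?thesis by (rule that[rotated])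
qed

lemma proj_point_iff:
  "P \<in> proj_points V \<longleftrightarrow> (\<exists>z\<in>vecs V. z \<noteq> 0 \<and> P = lin.span {z})"
proof
  assume "P \<in> proj_points V"
  then have P: "lin.subspace P" "P \<subseteq> vecs V" "lin.dim P = 1"
    by (auto simp: proj_points_def)
  obtain S where S: "S \<subseteq> P" "lin.independent S" "P \<subseteq> lin.span S" "card S = 1"
    using lin.basis_exists[of P] P by metis
  then obtain z where z: "S = {z}"
    by (metis card_1_singletonE)
  with S P have "P = lin.span {z}"
    by (metis lin.span_minimal subset_antisym)
  moreover have "z \<noteq> 0"
    using S z by (auto simp: lin.dependent_single)
  ultimately show "\<exists>z\<in>vecs V. z \<noteq> 0 \<and> P = lin.span {z}"
    using S z P by blast
next
  assume "\<exists>z\<in>vecs V. z \<noteq> 0 \<and> P = lin.span {z}"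
  then obtain z where z: "z \<in> vecs V" "z \<noteq> 0" "P = lin.span {z}" by blast
  have "lin.dim P = 1"
    using z lin.dim_span_eq_card_independent[of "{z}"] by (simp add: lin.dependent_single)
  moreover have "P \<subseteq> vecs V"
    using z by (auto simp: lin.span_singleton)
  ultimately show "P \<in> proj_points V"
    using z by (simp add: proj_points_def)
qed

section \<open>Subschemes of length at least two on a line\<close>

lemma hull_ideal_subset: "ideal_of V J \<Longrightarrow> A \<subseteq> J \<Longrightarrow> ideal_gen V A \<subseteq> J"
  unfolding ideal_gen_def ideal_of_def by (rule hull_minimal) auto

lemma saturation_mono: "I \<subseteq> J \<Longrightarrow> saturation V I \<subseteq> saturation V J"
  unfolding saturation_def by blast

lemma ideal_gen_subset_saturation:
  assumes "A \<subseteq> polys V"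
  shows "A \<subseteq> saturation V (ideal_gen V A)"
proof
  fix p assume p: "p \<in> A"
  have "\<forall>g\<in>forms V 0. g * p \<in> ideal_gen V A"
    using submodule_over_hull[of "polys V" "(*)" A] p hull_subset[of A "submodule_over (polys V) (*)"]
    by (auto simp: ideal_gen_def submodule_over_def forms_polys)
  with p assms show "p \<in> saturation V (ideal_gen V A)"
    unfolding saturation_def by blast
qed

locale proj_scheme =
  fixes V :: "'v set" and J :: "'v mpoly set"
  assumes closed: "closed_subscheme V J"
begin

lemma polysI: "p \<in> J \<Longrightarrow> p \<in> polys V"
  using closed by (auto simp: closed_subscheme_def homogeneous_ideal_def ideal_of_def)

lemma zero_in: "0 \<in> J"
  using closed by (auto simp: closed_subscheme_def homogeneous_ideal_def ideal_of_def submodule_over_def)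

lemma add_in: "p \<in> J \<Longrightarrow> q \<in> J \<Longrightarrow> p + q \<in> J"
  using closed by (auto simp: closed_subscheme_def homogeneous_ideal_def ideal_of_def submodule_over_def)

lemma mult_in: "r \<in> polys V \<Longrightarrow> p \<in> J \<Longrightarrow> r * p \<in> J"
  using closed by (auto simp: closed_subscheme_def homogeneous_ideal_def ideal_of_def submodule_over_def)

lemma diff_in: "p \<in> J \<Longrightarrow> q \<in> J \<Longrightarrow> p - q \<in> J"
  using add_in[of p "const (-1) * q"] mult_in[OF polys_const, of q "-1"] by (simp add: single_uminus)

lemma sum_in: "(\<And>x. x \<in> A \<Longrightarrow> f x \<in> J) \<Longrightarrow> sum f A \<in> J"
  by (induction A rule: infinite_finite_induct) (auto intro: zero_in add_in)

lemma hom_part_in: "p \<in> J \<Longrightarrow> hom_part k p \<in> J"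
  using closed by (auto simp: closed_subscheme_def homogeneous_ideal_def)

lemma saturatedI: "p \<in> polys V \<Longrightarrow> (\<And>g. g \<in> forms V k \<Longrightarrow> g * p \<in> J) \<Longrightarrow> p \<in> J"
  using closed unfolding closed_subscheme_def saturation_def by blast

lemma subspace_in: "lin.subspace J"
  by (rule lin.subspaceI) (auto simp: zero_in scale_eq intro: add_in mult_in)

end

locale line_scheme = proj_scheme V J
  for V :: "'v set" and J :: "'v mpoly set" +
  fixes u w l m
  assumes fr: "frame V u w l m"
    and line: "line_ideal V (lin.span {u, w}) \<subseteq> J"
begin

lemma l_form: "l \<in> forms V 1" and m_form: "m \<in> forms V 1"
  using fr by (auto simp: frame_def)

lemma l_poly [simp]: "l ^ k \<in> polys V" and m_poly [simp]: "m ^ k \<in> polys V"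
  using l_form m_form forms_polys forms_power_1 by blast+

lemma restr_0_in: "p \<in> forms V k \<Longrightarrow> restr u w p = 0 \<Longrightarrow> p \<in> J"
  using line vanish_on_plane[of p V k u w] by (auto simp: line_ideal_def span_pair forms_polys)

lemma restr_eq_in:
  "p \<in> forms V k \<Longrightarrow> q \<in> forms V k \<Longrightarrow> restr u w p = restr u w q \<Longrightarrow> q \<in> J \<Longrightarrow> p \<in> J"
  using restr_0_in[of "p - q" k] add_in[of "p - q" q] by simp

lemma restr_ideal:
  assumes "p \<in> J"
  shows "\<exists>q\<in>J. restr u w q = r * restr u w p"
  using assms restr_bform[OF fr order_refl, of r] bform_forms[OF l_form m_form, of "degree r" r]
  by (intro bexI[of _ "bform l m (degree r) r * p"]) (auto intro!: mult_in forms_polys)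

text \<open>On the line \<open>l\<close> vanishes only at \<open>w\<close>, and \<open>h\<close>
  keeps the scheme away from \<open>w\<close>. So \<open>l\<close> and \<open>h\<close> generate all
  forms of large degree modulo the line ideal; a polynomial killed by \<open>l\<close> modulo
  \<open>J\<close> is then killed by all such forms, and saturation puts it into
  \<open>J\<close>.\<close>

lemma colon_power:
  assumes h: "h \<in> J" "h \<in> forms V e" "eval_poly w h \<noteq> 0"
    and q: "q \<in> polys V" "l ^ N * q \<in> J"
  shows "q \<in> J"
proof -
  have "\<exists>n. \<forall>k\<ge>n. \<forall>f\<in>forms V k. f * q \<in> J"
    using q
  proof (induction N arbitrary: q)
    case 0
    then show ?case by (auto intro!: mult_in forms_polys)
  next
    case (Suc N)
    have "l * q \<in> polys V" "l ^ N * (l * q) \<in> J"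
      using Suc.prems l_poly[of 1] by (auto simp: mult_ac)
    from Suc.IH[OF this] obtain n where n: "\<And>k f. k \<ge> n \<Longrightarrow> f \<in> forms V k \<Longrightarrow> f * (l * q) \<in> J"
      by blast
    \<comment> \<open>The bound leaves room for the factor \<open>m ^ (k - e)\<close> next to
      \<open>h\<close>, and for a cofactor of \<open>l\<close> of degree \<open>k - 1\<close>, which
      is at least \<open>n\<close>.\<close>
    have "f * q \<in> J" if k: "k \<ge> n + e + 1" and f: "f \<in> forms V k" for k f
    proof -
      define c where "c = eval_poly w f / eval_poly w h"
      \<comment> \<open>The multiple of \<open>h\<close> is chosen so that \<open>f'\<close>
        vanishes at \<open>w\<close>. Its restriction then drops in degree, which makes
        \<open>f'\<close> a multiple of \<open>l\<close> modulo the line ideal.\<close>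
      define f' where "f' = f - const c * (h * m ^ (k - e))"
      have hm: "const c * (h * m ^ (k - e)) \<in> forms V k"
        using k h(2) m_form by (intro forms_cmult forms_mult'[OF h(2) forms_power_1]) auto
      have f': "f' \<in> forms V k"
        unfolding f'_def using f hm by simp
      have "eval_poly w f' = 0"
        using h(3) fr by (simp add: f'_def c_def frame_def)
      then have "coeff (restr u w f') k = 0"
        using coeff_restr_top[OF f'] by simp
      then have deg: "degree (restr u w f') \<le> k - 1"
        using degree_restr[OF f', of u w] k
        by (intro degree_le) (metis Suc_diff_1 add_gr_0 coeff_eq_0 le_neq_implies_less le_simps(3)
            less_le_trans zero_less_one)
      define t where "t = bform l m (k - 1) (restr u w f')"
      have t: "t \<in> forms V (k - 1)"
        unfolding t_def by (rule bform_forms[OF l_form m_form])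
      have "l * t \<in> forms V k"
        using k by (intro forms_mult'[OF l_form t]) auto
      moreover have "restr u w (l * t) = restr u w f'"
        using restr_bform[OF fr deg] frame_restr[OF fr] by (simp add: t_def)
      ultimately have "f' - l * t \<in> J"
        using f' by (intro restr_0_in[of _ k]) auto
      then have "(f' - l * t) * q \<in> J"
        using Suc.prems(1) mult_in by (simp add: mult.commute)
      moreover have "t * (l * q) \<in> J"
        using n[OF _ t] k by simp
      moreover have "const c * m ^ (k - e) * q * h \<in> J"
        using Suc.prems(1) h(1) by (intro mult_in) auto
      ultimately have "(f' - l * t) * q + t * (l * q) + const c * m ^ (k - e) * q * h \<in> J"
        by (intro add_in)
      also have "(f' - l * t) * q + t * (l * q) + const c * m ^ (k - e) * q * h = f * q"
        by (simp add: f'_def algebra_simps)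
      finally show ?thesis .
    qed
    then show ?case by blast
  qed
  then obtain n where "\<And>f. f \<in> forms V n \<Longrightarrow> f * q \<in> J" by blast
  with q(1) show ?thesis by (rule saturatedI)
qed

text \<open>The affine restriction of \<open>J\<close> determines the forms in \<open>J\<close>:
  both sides are brought to a common degree by powers of \<open>l\<close>, compared on the line, and
  the power of \<open>l\<close> is cancelled by \<open>colon_power\<close>.\<close>

lemma restr_in:
  assumes h: "h \<in> J" "h \<in> forms V e" "eval_poly w h \<noteq> 0"
    and p: "p \<in> J" and q: "q \<in> forms V k" and eq: "restr u w q = restr u w p"
  shows "q \<in> J"
proof -
  obtain K where K: "(\<Sum>j\<le>K. hom_part j p) = p" and kK: "k \<le> K"
    using sum_hom_parts[of p] by (meson nat_le_linear)
  define p' where "p' = (\<Sum>j\<le>K. l ^ (K - j) * hom_part j p)"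
  have p'J: "p' \<in> J"
    unfolding p'_def by (intro sum_in mult_in hom_part_in p) auto
  have p'K: "p' \<in> forms V K"
    unfolding p'_def
    by (intro forms_sum forms_mult'[OF forms_power_1[OF l_form] hom_part_forms[OF polysI[OF p]]]) auto
  have "restr u w p' = restr u w (\<Sum>j\<le>K. hom_part j p)"
    by (simp add: p'_def restr_sum frame_restr[OF fr])
  then have "restr u w p' = restr u w p"
    by (simp only: K)
  moreover have "l ^ (K - k) * q \<in> forms V K"
    using kK by (intro forms_mult'[OF forms_power_1[OF l_form] q]) simp
  ultimately have "l ^ (K - k) * q \<in> J"
    using p'J p'K by (intro restr_eq_in[OF _ p'K _ p'J]) (simp_all add: eq frame_restr[OF fr])
  then show ?thesis
    using colon_power[OF h forms_polys[OF q]] by blast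
qed

text \<open>
  If the ideal \<open>restr u w ` J\<close> of \<open>\<complex>[x]\<close> had a generator of degree at most one, a form would lie in
  \<open>J\<close> as soon as it vanishes at one suitable point.
\<close>

lemma quadratic_divisor:
  assumes V: "finite V" and len: "has_length V J n" "n \<ge> 2"
    and h: "h \<in> J" "h \<in> forms V e" "eval_poly w h \<noteq> 0"
  shows "\<exists>a b. \<forall>p\<in>J. [:- a, 1:] * [:- b, 1:] dvd restr u w p"
proof -
  have nz: "restr u w h \<noteq> 0"
    using coeff_restr_top[OF h(2), of u w] h(3) by auto
  \<comment> \<open>A nonzero element of least degree generates the ideal of restrictions, by
    division with remainder.\<close>
  define g where "g = arg_min degree (\<lambda>g. g \<in> restr u w ` J \<and> g \<noteq> 0)"
  have g: "g \<in> restr u w ` J" "g \<noteq> 0"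
    using arg_min_natI[of "\<lambda>g. g \<in> restr u w ` J \<and> g \<noteq> 0" "restr u w h" degree] h nz
    by (auto simp: g_def)
  have gmin: "degree g \<le> degree f" if "f \<in> restr u w ` J" "f \<noteq> 0" for f
    using arg_min_nat_le[of "\<lambda>g. g \<in> restr u w ` J \<and> g \<noteq> 0" f degree] that by (auto simp: g_def)
  obtain p0 where p0: "p0 \<in> J" "g = restr u w p0"
    using g by blast
  have dvd: "g dvd restr u w p" if p: "p \<in> J" for p
  proof (rule ccontr)
    assume "\<not> g dvd restr u w p"
    then have nz: "restr u w p mod g \<noteq> 0"
      by (simp add: dvd_eq_mod_eq_0)
    obtain q where q: "q \<in> J" "restr u w q = (restr u w p div g) * g"
      using restr_ideal[OF p0(1)] p0(2) by metis
    have "restr u w p mod g = restr u w (p - q)"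
      by (simp add: q minus_div_mult_eq_mod)
    then have "restr u w p mod g \<in> restr u w ` J"
      using diff_in[OF p q(1)] by (metis imageI)
    with nz have "degree g \<le> degree (restr u w p mod g)"
      by (intro gmin)
    then show False
      using degree_mod_less[OF g(2), of "restr u w p"] nz by simp
  qed
  have in_J: "q \<in> J" if q: "q \<in> forms V k" and gq: "g dvd restr u w q" for q k
  proof -
    from gq obtain r where "restr u w q = r * g"
      by (metis dvdE mult.commute)
    then obtain p where "p \<in> J" "restr u w q = restr u w p"
      using restr_ideal[OF p0(1)] p0(2) by metis
    then show ?thesis
      using restr_in[OF h _ q] by blast
  qed
  have root: "\<exists>a. [:- a, 1:] dvd f" if "degree f \<noteq> 0" for f :: "complex poly"
    using fundamental_theorem_of_algebra[of f] that
    by (metis constant_degree poly_eq_0_iff_dvd)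
  have "degree g \<ge> 2"
  proof (rule ccontr)
    assume "\<not> degree g \<ge> 2"
    then have dg: "degree g \<le> 1" by simp
    \<comment> \<open>The point is the root of \<open>g\<close> if \<open>g\<close> is linear, and
      arbitrary (here 0) if \<open>g\<close> is a unit.\<close>
    have "\<exists>a. \<forall>r. poly r a = 0 \<longrightarrow> g dvd r"
    proof (cases "degree g = 0")
      case True
      with g(2) have "is_unit g"
        by (simp add: is_unit_iff_degree)
      then show ?thesis
        by (intro exI[of _ 0]) (simp add: unit_imp_dvd)
    next
      case False
      then obtain a g' where g': "g = [:- a, 1:] * g'"
        using root[of g] by (auto elim: dvdE)
      have "g' \<noteq> 0" using g' g(2) by auto
      then have "degree g = 1 + degree g'"
        unfolding g' by (subst degree_mult_eq) auto
      with dg \<open>g' \<noteq> 0\<close> have "is_unit g'"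
        by (simp add: is_unit_iff_degree)
      then show ?thesis
        unfolding g' by (metis mult_unit_dvd_iff poly_eq_0_iff_dvd)
    qed
    then obtain a where a: "\<And>r. poly r a = 0 \<Longrightarrow> g dvd r" by blast
    \<comment> \<open>Evaluation at \<open>a\<close> is a single functional whose kernel on forms
      lies in \<open>J\<close>, so the Hilbert function is at most one in every degree, against
      length at least two.\<close>
    have "lin.dim (forms V k) \<le> lin.dim (J \<inter> forms V k) + 1" for k
    proof (rule dim_le_codim_1)
      show "lin.subspace (J \<inter> forms V k)"
        by (intro lin.subspace_inter subspace_in subspace_forms)
      show "finite ((\<lambda>m. Poly_Mapping.single m (1::complex)) ` monoms V k)"
        using V by simp
      show "forms V k \<subseteq> lin.span ((\<lambda>m. Poly_Mapping.single m 1) ` monoms V k)"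
        by (rule forms_subset_span)
      fix p q assume pq: "p \<in> forms V k" "q \<in> forms V k" "p \<notin> J \<inter> forms V k"
      then have "poly (restr u w p) a \<noteq> 0"
        using a in_J by blast
      moreover define c where "c = poly (restr u w q) a / poly (restr u w p) a"
      ultimately have "poly (restr u w (q - scale c p)) a = 0"
        by (simp add: scale_eq)
      moreover have "q - scale c p \<in> forms V k"
        using pq by (simp add: scale_eq)
      ultimately show "\<exists>c. q - scale c p \<in> J \<inter> forms V k"
        using a in_J by blast
    qed auto
    moreover obtain k where "lin.dim (forms V k) = lin.dim (J \<inter> forms V k) + n"
      using len(1) by (auto simp: has_length_def eventually_sequentially)
    ultimately have "n \<le> 1"
      by (metis add_le_cancel_left)
    with len(2) show False by simp
  qed
  from root[of g] obtain a g1 where g1: "g = [:- a, 1:] * g1"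
    using \<open>degree g \<ge> 2\<close> by auto
  have "g1 \<noteq> 0" using g1 g(2) by auto
  then have "degree g = 1 + degree g1"
    unfolding g1 by (subst degree_mult_eq) auto
  with root[of g1] obtain b where "[:- b, 1:] dvd g1"
    using \<open>degree g \<ge> 2\<close> by auto
  then have "[:- a, 1:] * [:- b, 1:] dvd g"
    unfolding g1 by (rule mult_dvd_mono[OF dvd_refl])
  then show ?thesis
    using dvd dvd_trans by blast
qed

end

text \<open>\<open>quadratic_divisor\<close> asks for a form of \<open>J\<close> that does not
  vanish at the point at infinity, so the frame is changed to move that point off the scheme. If
  every element of \<open>J\<close> restricts to 0, any two roots serve.\<close>

lemma length_two_on_line:
  assumes "finite V" "closed_subscheme V J" "has_length V J n" "n \<ge> 2"
    and L: "L \<in> proj_lines V" and line: "line_ideal V L \<subseteq> J"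
  obtains u w l m a b where "frame V u w l m" "L = lin.span {u, w}"
    "\<And>p. p \<in> J \<Longrightarrow> [:- a, 1:] * [:- b, 1:] dvd restr u w p"
proof -
  interpret proj_scheme V J by unfold_locales fact
  obtain u w l m where fr: "frame V u w l m" and Luw: "L = lin.span {u, w}"
    using line_frame[OF L] .
  show ?thesis
  proof (cases "\<forall>p\<in>J. restr u w p = 0")
    case True
    then show ?thesis
      using that[OF fr Luw, of 0 0] by simp
  next
    case False
    then obtain p where p: "p \<in> J" "restr u w p \<noteq> 0" by blast
    obtain K where "(\<Sum>l\<le>K. hom_part l p) = p"
      using sum_hom_parts[of p] by blast
    then obtain e where e: "restr u w (hom_part e p) \<noteq> 0"
      using p(2) restr_sum[of u w "\<lambda>l. hom_part l p" "{..K}"] by (metis sum.neutral)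
    then obtain x where x: "eval_poly (u + scale x w) (hom_part e p) \<noteq> 0"
      by (metis poly_all_0_iff_0 poly_restr)
    define u' where "u' = scale 0 u + scale 1 w"
    define w' where "w' = scale 1 u + scale x w"
    obtain l' m' where fr': "frame V u' w' l' m'"
      using frame_change[OF fr _ u'_def w'_def] by auto
    have L': "L = lin.span {u', w'}"
    proof -
      have "{u', w'} \<subseteq> lin.span {u, w}"
        unfolding span_pair u'_def w'_def by blast
      then have "lin.span {u', w'} \<subseteq> lin.span {u, w}"
        by (rule lin.span_minimal[OF _ lin.subspace_span])
      moreover have "u = scale (- x) u' + scale 1 w'" "w = scale 1 u' + scale 0 w'"
        unfolding u'_def w'_def
        by (rule poly_mapping_eqI, simp only: lookup_add lookup_scale, simp add: algebra_simps)+
      then have "{u, w} \<subseteq> lin.span {u', w'}"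
        unfolding span_pair by blast
      then have "lin.span {u, w} \<subseteq> lin.span {u', w'}"
        by (rule lin.span_minimal[OF _ lin.subspace_span])
      ultimately show ?thesis using Luw by blast
    qed
    interpret line_scheme V J u' w' l' m'
      by unfold_locales (use fr' L' line in auto)
    obtain a b where "\<forall>p\<in>J. [:- a, 1:] * [:- b, 1:] dvd restr u' w' p"
      using quadratic_divisor[OF assms(1,3,4) hom_part_in[OF p(1)], of e e] x hom_part_forms[OF polysI[OF p(1)]]
      by (auto simp: w'_def)
    then show ?thesis
      using that[OF fr' L'] by blast
  qed
qed

lemma forms_scale [simp]: "p \<in> forms V k \<Longrightarrow> scale c p \<in> forms V k"
  by (simp add: scale_eq)

section \<open>Length two subschemes defined by a quadratic polynomial on a line\<close>

lemma quad_mod_coeff: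
  fixes g r :: "complex poly"
  assumes "degree g = 2"
  shows "r mod g = [:coeff (r mod g) 0, coeff (r mod g) 1:]"
    and "g dvd r \<longleftrightarrow> coeff (r mod g) 0 = 0 \<and> coeff (r mod g) 1 = 0"
proof -
  have "g \<noteq> 0" using assms by auto
  then have "r mod g = 0 \<or> degree (r mod g) < 2"
    using degree_mod_less[of g r] assms by simp
  then have "coeff (r mod g) n = 0" if "n \<ge> 2" for n
    using that by (auto intro: coeff_eq_0)
  then show 1: "r mod g = [:coeff (r mod g) 0, coeff (r mod g) 1:]"
    by (intro poly_eqI) (auto simp: coeff_pCons One_nat_def numeral_2_eq_2 split: nat.split)
  show "g dvd r \<longleftrightarrow> coeff (r mod g) 0 = 0 \<and> coeff (r mod g) 1 = 0"
    by (metis 1 coeff_0 dvd_eq_mod_eq_0 pCons_0_0)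
qed

lemma one_mod_quad: "degree g = 2 \<Longrightarrow> 1 mod g = (1 :: complex poly)"
  by (rule mod_poly_less) simp

lemma linear_mod_quad: "degree g = 2 \<Longrightarrow> [:a, b:] mod g = [:a, b :: complex:]"
  by (rule mod_poly_less) (auto intro: le_less_trans[OF degree_pCons_le])

text \<open>The ideal of the scheme \<open>g = 0\<close> on the line. Divisibility is imposed on
  each homogeneous part because restriction to the affine line forgets degrees: \<open>l - 1\<close>
  restricts to 0.\<close>

definition dvd_ideal ::
    "'v set \<Rightarrow> ('v \<Rightarrow>\<^sub>0 complex) \<Rightarrow> ('v \<Rightarrow>\<^sub>0 complex) \<Rightarrow> complex poly \<Rightarrow> 'v mpoly set" where
  "dvd_ideal V u w g = {p \<in> polys V. \<forall>k. g dvd restr u w (hom_part k p)}"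

text \<open>Saturation costs nothing because \<open>l ^ n\<close> restricts to 1, so a multiple of
  \<open>p\<close> by it has the divisibility of \<open>p\<close> itself.\<close>

lemma dvd_ideal_closed:
  assumes fr: "frame V u w l m"
  shows "closed_subscheme V (dvd_ideal V u w g)"
proof -
  let ?J = "dvd_ideal V u w g"
  have mult: "r * p \<in> ?J" if "r \<in> polys V" "p \<in> ?J" for r p
    using that by (auto simp: dvd_ideal_def hom_part_mult[of _ V] restr_sum intro!: dvd_sum)
  have ideal: "ideal_of V ?J"
    unfolding ideal_of_def submodule_over_def using mult
    by (auto simp: dvd_ideal_def hom_part_add)
  have hom: "hom_part k p \<in> ?J" if "p \<in> ?J" for p k
    using that hom_part_of_form[OF hom_part_forms, of p V]
    by (auto simp: dvd_ideal_def forms_polys[OF hom_part_forms])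
  have "saturation V ?J \<subseteq> ?J"
  proof
    fix p assume "p \<in> saturation V ?J"
    then obtain n where p: "p \<in> polys V" and n: "\<And>f. f \<in> forms V n \<Longrightarrow> f * p \<in> ?J"
      by (auto simp: saturation_def)
    have l: "l ^ n \<in> forms V n"
      using fr by (simp add: frame_def)
    have "g dvd restr u w (hom_part k p)" for k
    proof -
      have "g dvd restr u w (hom_part (n + k) (l ^ n * p))"
        using n[OF l] by (auto simp: dvd_ideal_def)
      then show ?thesis
        by (simp add: hom_part_mult_form[OF l p] frame_restr[OF fr])
    qed
    with p show "p \<in> ?J" by (auto simp: dvd_ideal_def)
  qed
  moreover have "?J \<subseteq> saturation V ?J"
  proof
    fix p assume p: "p \<in> ?J"
    then have "\<forall>f\<in>forms V 0. f * p \<in> ?J"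
      using mult forms_polys by blast
    with p show "p \<in> saturation V ?J"
      unfolding saturation_def by (auto simp: dvd_ideal_def)
  qed
  ultimately show ?thesis
    using ideal hom by (auto simp: closed_subscheme_def homogeneous_ideal_def)
qed

lemma dvd_ideal_form:
  "p \<in> forms V k \<Longrightarrow> p \<in> dvd_ideal V u w g \<longleftrightarrow> g dvd restr u w p"
  by (auto simp: dvd_ideal_def hom_part_of_form forms_polys)

text \<open>From degree 1 on, both coefficients of the remainder modulo \<open>g\<close> are
  realised independently, by \<open>l ^ k\<close> and \<open>l ^ (k - 1) * m\<close>. The two
  functionals are split off one at a time.\<close>

lemma dvd_ideal_length:
  assumes V: "finite V" and fr: "frame V u w l m" and g: "degree g = 2"
  shows "has_length V (dvd_ideal V u w g) 2"
proof -
  have "lin.dim (forms V k) = lin.dim (dvd_ideal V u w g \<inter> forms V k) + 2" if k: "k \<ge> 1" for k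
  proof -
    define \<phi> where "\<phi> i p = coeff (restr u w p mod g) i" for i p
    have add: "\<phi> i (p + q) = \<phi> i p + \<phi> i q" for i p q
      by (simp add: \<phi>_def poly_mod_add_left)
    have diff: "\<phi> i (p - q) = \<phi> i p - \<phi> i q" for i p q
      by (simp add: \<phi>_def poly_mod_diff_left)
    have scale: "\<phi> i (scale c p) = c * \<phi> i p" for i c p
      by (simp add: \<phi>_def scale_eq mod_smult_left)
    have zero: "\<phi> i 0 = 0" for i
      by (simp add: \<phi>_def)
    have e0: "l ^ k \<in> forms V k" "\<phi> 0 (l ^ k) = 1" "\<phi> 1 (l ^ k) = 0"
      using fr by (auto simp: frame_def \<phi>_def frame_restr[OF fr] one_mod_quad[OF g] One_nat_def)
    have e1: "l ^ (k - 1) * m \<in> forms V k" "\<phi> 1 (l ^ (k - 1) * m) = 1"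
      using fr k linear_mod_quad[OF g, of 0 1]
      by (auto simp: frame_def \<phi>_def frame_restr[OF fr] One_nat_def intro!: forms_mult'[of _ V "k - 1"])
    let ?B = "{p \<in> forms V k. \<phi> 1 p = 0}"
    have "p \<in> dvd_ideal V u w g \<longleftrightarrow> \<phi> 0 p = 0 \<and> \<phi> 1 p = 0" if "p \<in> forms V k" for p
      by (simp only: dvd_ideal_form[OF that] quad_mod_coeff(2)[OF g] \<phi>_def)
    then have J: "dvd_ideal V u w g \<inter> forms V k = {p \<in> forms V k. \<phi> 0 p = 0 \<and> \<phi> 1 p = 0}"
      by blast
    have fin: "finite ((\<lambda>m. Poly_Mapping.single m (1::complex)) ` monoms V k)"
      using V by simp
    note span = forms_subset_span[of V k]
    have "lin.dim (forms V k) = lin.dim ?B + 1"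
    proof (rule dim_codim_1[OF _ _ fin span, of _ "l ^ (k - 1) * m"])
      show "lin.subspace ?B"
        by (rule lin.subspaceI) (auto simp: add scale zero)
      show "\<exists>c. p - scale c (l ^ (k - 1) * m) \<in> ?B" if "p \<in> forms V k" for p
        using that e1 by (intro exI[of _ "\<phi> 1 p"]) (auto simp: diff scale)
    qed (use e1 in auto)
    moreover have "lin.dim ?B = lin.dim {p \<in> forms V k. \<phi> 0 p = 0 \<and> \<phi> 1 p = 0} + 1"
    proof (rule dim_codim_1[OF _ _ fin, of _ _ "l ^ k"])
      show "lin.subspace {p \<in> forms V k. \<phi> 0 p = 0 \<and> \<phi> 1 p = 0}"
        by (rule lin.subspaceI) (auto simp: add scale zero)
      show "\<exists>c. p - scale c (l ^ k) \<in> {p \<in> forms V k. \<phi> 0 p = 0 \<and> \<phi> 1 p = 0}" if "p \<in> ?B" for p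
        using that e0 by (intro exI[of _ "\<phi> 0 p"]) (auto simp: diff scale)
    qed (use e0 span in auto)
    ultimately show ?thesis
      using J by simp
  qed
  then show ?thesis
    unfolding has_length_def eventually_sequentially by blast
qed

lemma secant_lineI:
  assumes V: "finite V" and I: "I \<subseteq> polys V" "\<And>p k. p \<in> I \<Longrightarrow> hom_part k p \<in> I"
    and fr: "frame V u w l m" and g: "degree g = 2"
    and dvd: "\<And>p. p \<in> I \<Longrightarrow> g dvd restr u w p"
  shows "secant_line V I (lin.span {u, w})"
proof -
  let ?J = "dvd_ideal V u w g"
  have closed: "closed_subscheme V ?J"
    by (rule dvd_ideal_closed[OF fr])
  have "I \<subseteq> ?J"
    using I dvd by (auto simp: dvd_ideal_def)
  moreover have "line_ideal V (lin.span {u, w}) \<subseteq> ?J"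
  proof
    fix p assume p: "p \<in> line_ideal V (lin.span {u, w})"
    have "restr u w (hom_part k p) = 0" for k
    proof (rule restr_eq_0I)
      fix s t
      let ?v = "scale s u + scale t w"
      \<comment> \<open>The line is closed under scaling, so \<open>p\<close> vanishes on the whole
        ray through the point, and hence so does each homogeneous part.\<close>
      have "poly (restr 0 ?v p) x = 0" for x
      proof -
        have "?v \<in> lin.span {u, w}"
          unfolding span_pair by blast
        then have "scale x ?v \<in> lin.span {u, w}"
          by (rule lin.span_scale)
        then show ?thesis
          using p by (simp add: poly_restr line_ideal_def)
      qed
      then have "restr 0 ?v p = 0"
        using poly_all_0_iff_0 by blast
      then show "eval_poly ?v (hom_part k p) = 0"
        by (simp flip: coeff_restr_hom_part)
    qed
    with p show "p \<in> ?J"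
      by (auto simp: dvd_ideal_def line_ideal_def)
  qed
  ultimately have "ideal_gen V (I \<union> line_ideal V (lin.span {u, w})) \<subseteq> ?J"
    using closed by (intro hull_ideal_subset) (auto simp: closed_subscheme_def homogeneous_ideal_def)
  then have "scheme_inter V I (line_ideal V (lin.span {u, w})) \<subseteq> saturation V ?J"
    unfolding scheme_inter_def by (rule saturation_mono)
  then have "subscheme ?J (scheme_inter V I (line_ideal V (lin.span {u, w})))"
    using closed by (simp add: subscheme_def closed_subscheme_def)
  then show ?thesis
    using closed dvd_ideal_length[OF V fr g] frame_line[OF fr] by (auto simp: secant_line_def)
qed

section \<open>The Veronese embedding\<close>

text \<open>A vector \<open>z\<close> on \<open>monoms V d\<close> is regarded as a linear functional on forms of degree \<open>d\<close>.\<close>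

definition pair :: "(('v \<Rightarrow>\<^sub>0 nat) \<Rightarrow>\<^sub>0 complex) \<Rightarrow> 'v mpoly \<Rightarrow> complex" where
  "pair z p = (\<Sum>m\<in>Poly_Mapping.keys z. Poly_Mapping.lookup z m * Poly_Mapping.lookup p m)"

lemma pair_superset:
  "finite A \<Longrightarrow> Poly_Mapping.keys z \<subseteq> A \<Longrightarrow>
    pair z p = (\<Sum>m\<in>A. Poly_Mapping.lookup z m * Poly_Mapping.lookup p m)"
  unfolding pair_def by (rule sum.mono_neutral_left) (auto simp: in_keys_iff)

lemma pair_simps [simp]:
  "pair z 0 = 0" "pair z (p + q) = pair z p + pair z q" "pair z (p - q) = pair z p - pair z q"
  by (simp_all add: pair_def lookup_add lookup_minus distrib_left right_diff_distrib
      sum.distrib sum_subtractf)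

lemma pair_const_mult [simp]: "pair z (const c * p) = c * pair z p"
  unfolding pair_def scale_eq[symmetric] lookup_scale by (simp add: sum_distrib_left mult.left_commute)

lemma pair_single [simp]: "pair z (Poly_Mapping.single m c) = c * Poly_Mapping.lookup z m"
proof -
  have "pair z (Poly_Mapping.single m c) = (\<Sum>n\<in>Poly_Mapping.keys z. if n = m then c * Poly_Mapping.lookup z m else 0)"
    unfolding pair_def by (intro sum.cong) (auto simp: lookup_single when_def)
  then show ?thesis by (simp add: in_keys_iff)
qed

lemma pair_lincomb [simp]:
  "pair (scale s y + scale t z) p = s * pair y p + t * pair z p"
proof -
  let ?A = "Poly_Mapping.keys y \<union> Poly_Mapping.keys z"
  have "Poly_Mapping.keys (scale s y + scale t z) \<subseteq> ?A"
    by (auto simp: in_keys_iff lookup_add lookup_scale)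
  then show ?thesis
    by (simp add: pair_superset[of ?A] lookup_add lookup_scale distrib_right sum.distrib
        sum_distrib_left mult.assoc)
qed

lemma pair_eqI:
  assumes "y \<in> vecs (monoms V d)" "z \<in> vecs (monoms V d)"
    and "\<And>p. p \<in> forms V d \<Longrightarrow> pair y p = pair z p"
  shows "y = z"
proof (rule poly_mapping_eqI)
  fix m
  show "Poly_Mapping.lookup y m = Poly_Mapping.lookup z m"
  proof (cases "m \<in> monoms V d")
    case True
    then show ?thesis
      using assms(3)[OF forms_single[of m V d 1]] by simp
  next
    case False
    then have "m \<notin> Poly_Mapping.keys y" "m \<notin> Poly_Mapping.keys z"
      using assms by (auto simp: vecs_def)
    then show ?thesis by (simp add: in_keys_iff)
  qed
qed

text \<open>A linear form on the target of the Veronese embedding, namely the one that pulls back to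
  \<open>p\<close>.\<close>

definition lform :: "'v mpoly \<Rightarrow> ('v \<Rightarrow>\<^sub>0 nat) mpoly" where
  "lform p = (\<Sum>m\<in>Poly_Mapping.keys p. const (Poly_Mapping.lookup p m) * var m)"

lemma lform_forms: "p \<in> forms V d \<Longrightarrow> lform p \<in> forms (monoms V d) 1"
  unfolding lform_def by (intro forms_sum forms_cmult forms_var) (auto simp: forms_def)

lemma eval_lform [simp]: "eval_poly z (lform p) = pair z p"
proof -
  let ?A = "Poly_Mapping.keys z \<union> Poly_Mapping.keys p"
  have "eval_poly z (lform p) = (\<Sum>m\<in>Poly_Mapping.keys p. Poly_Mapping.lookup p m * Poly_Mapping.lookup z m)"
    by (simp add: lform_def eval_poly_sum)
  also have "\<dots> = (\<Sum>m\<in>?A. Poly_Mapping.lookup p m * Poly_Mapping.lookup z m)"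
    by (rule sum.mono_neutral_left) (auto simp: in_keys_iff)
  also have "\<dots> = pair z p"
    by (simp add: pair_superset[of ?A] mult.commute)
  finally show ?thesis .
qed

lemma restr_lform: "p \<in> forms V d \<Longrightarrow> restr y z (lform p) = [:pair y p, pair z p:]"
  using restr_linear[OF lform_forms] by simp

lemma veronese_simps [simp]:
  "veronese_hom 0 = 0" "veronese_hom (const a) = const a"
  "veronese_hom (p + q) = veronese_hom p + veronese_hom q"
  "veronese_hom (p - q) = veronese_hom p - veronese_hom q"
  "veronese_hom (p * q) = veronese_hom p * veronese_hom q"
  "veronese_hom (var m) = Poly_Mapping.single m 1"
  by (simp_all add: veronese_hom_def mpolyc.subst_add mpolyc.subst_diff mpolyc.subst_mult)

lemma veronese_sum: "veronese_hom (sum f A) = (\<Sum>x\<in>A. veronese_hom (f x))"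
  by (simp add: veronese_hom_def mpolyc.subst_sum)

lemma veronese_lform [simp]: "veronese_hom (lform p) = p"
proof -
  have "veronese_hom (lform p) = (\<Sum>m\<in>Poly_Mapping.keys p. Poly_Mapping.single m (Poly_Mapping.lookup p m))"
    by (simp add: lform_def veronese_sum) (simp add: mult_single)
  then show ?thesis
    using poly_mapping_sum_single[of p] by simp
qed

lemma veronese_forms: "p \<in> forms (monoms V d) k \<Longrightarrow> veronese_hom p \<in> forms V (d * k)"
proof (induction k arbitrary: p)
  case 0
  then show ?case using forms_0_cases[of p] by fastforce
next
  case (Suc k)
  from Suc.prems show ?case
  proof (induction p rule: forms_Suc_induct)
    case (var m q)
    then show ?case
      using Suc.IH[of q] by (auto intro: forms_mult' forms_single)
  qed auto
qed

lemma veronese_hom_part: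
  assumes "p \<in> polys (monoms V d)" "d \<ge> 1"
  shows "veronese_hom (hom_part k p) = hom_part (d * k) (veronese_hom p)"
proof -
  obtain K where K: "(\<Sum>j\<le>K. hom_part j p) = p" and kK: "k \<le> K"
    using sum_hom_parts[of p] by (meson nat_le_linear)
  have "hom_part (d * k) (veronese_hom p) = (\<Sum>j\<le>K. hom_part (d * k) (veronese_hom (hom_part j p)))"
    by (subst K[symmetric]) (simp add: veronese_sum hom_part_sum)
  \<comment> \<open>As \<open>d \<ge> 1\<close>, the degrees \<open>d * j\<close> are distinct and
    only the part \<open>j = k\<close> survives.\<close>
  also have "\<dots> = (\<Sum>j\<le>K. if j = k then veronese_hom (hom_part j p) else 0)"
    using assms hom_part_of_form[OF veronese_forms[OF hom_part_forms[OF assms(1)]]]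
    by (intro sum.cong) auto
  finally show ?thesis using kK by simp
qed

lemma veronese_image_hom_part:
  assumes "homogeneous_ideal V X" "d \<ge> 1" "p \<in> veronese_image V d X"
  shows "hom_part k p \<in> veronese_image V d X"
  using assms veronese_hom_part[of p V d k]
  by (auto simp: veronese_image_def homogeneous_ideal_def forms_polys[OF hom_part_forms])

text \<open>
  A parametrised line \<open>u + x w\<close> with a length two subscheme, the zeros of \<open>g\<close>, that lies in \<open>X\<close>.
  Modulo \<open>g\<close> its image under \<open>v\<^sub>d\<close> is again a parametrised line, with coefficient vectors
  \<open>vcoeff V d u w g 0\<close> and \<open>vcoeff V d u w g 1\<close>.
\<close>

definition bisecant ::
    "'v set \<Rightarrow> 'v mpoly set \<Rightarrow> ('v \<Rightarrow>\<^sub>0 complex) \<Rightarrow> ('v \<Rightarrow>\<^sub>0 complex) \<Rightarrow> complex poly \<Rightarrow> bool" where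
  "bisecant V X u w g \<longleftrightarrow> (\<exists>l m. frame V u w l m) \<and> degree g = 2 \<and> (\<forall>F\<in>X. g dvd restr u w F)"

definition vcoeff :: "'v set \<Rightarrow> nat \<Rightarrow> ('v \<Rightarrow>\<^sub>0 complex) \<Rightarrow> ('v \<Rightarrow>\<^sub>0 complex) \<Rightarrow> complex poly \<Rightarrow>
    nat \<Rightarrow> ('v \<Rightarrow>\<^sub>0 nat) \<Rightarrow>\<^sub>0 complex" where
  "vcoeff V d u w g i = (\<Sum>m\<in>monoms V d.
     Poly_Mapping.single m (coeff (restr u w (Poly_Mapping.single m 1) mod g) i))"

lemma lookup_vcoeff:
  assumes "finite V" "m \<in> monoms V d"
  shows "Poly_Mapping.lookup (vcoeff V d u w g i) m = coeff (restr u w (Poly_Mapping.single m 1) mod g) i"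
  using assms by (simp add: vcoeff_def lookup_sum lookup_single when_def)

lemma vcoeff_vecs: "vcoeff V d u w g i \<in> vecs (monoms V d)"
proof -
  have sum_vecs: "sum f A \<in> vecs W" if "\<And>x. x \<in> A \<Longrightarrow> f x \<in> vecs W" for f :: "'b \<Rightarrow> 'c \<Rightarrow>\<^sub>0 complex" and A W
    using that by (induction A rule: infinite_finite_induct) auto
  show ?thesis
    unfolding vcoeff_def by (rule sum_vecs) (auto simp: vecs_def)
qed

lemma pair_vcoeff:
  assumes "finite V" "p \<in> forms V d"
  shows "pair (vcoeff V d u w g i) p = coeff (restr u w p mod g) i"
  using assms(2)
proof (induction p rule: forms_induct)
  case (single m c)
  have eq: "Poly_Mapping.single m c = const c * Poly_Mapping.single m 1"
    by (simp add: mult_single)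
  show ?case
    by (subst (2) eq) (simp add: lookup_vcoeff[OF assms(1) single] mod_smult_left)
qed (simp_all add: poly_mod_add_left)

text \<open>Modulo \<open>g\<close>, substituting the line through the two coefficient vectors for
  the coordinates gives the same as substituting u + x w into the monomials. Hence whatever pulls
  back into \<open>X\<close> restricts to a multiple of \<open>g\<close>.\<close>

lemma bisecant_secant_line:
  assumes V: "finite V" and X: "homogeneous_ideal V X" and d: "d \<ge> 1"
    and bi: "bisecant V X u w g"
  shows "secant_line (monoms V d) (veronese_image V d X)
    (lin.span {vcoeff V d u w g 0, vcoeff V d u w g 1})"
proof -
  obtain l m where fr: "frame V u w l m" and g: "degree g = 2"
    and dvd: "\<And>F. F \<in> X \<Longrightarrow> g dvd restr u w F"
    using bi by (auto simp: bisecant_def)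
  let ?y = "vcoeff V d u w g 0" and ?z = "vcoeff V d u w g 1"
  have l: "l \<in> forms V 1" "l ^ d \<in> forms V d" "l ^ (d - 1) * m \<in> forms V d"
    using fr d by (auto simp: frame_def intro!: forms_mult'[of _ V "d - 1"])
  \<comment> \<open>The forms \<open>l ^ d\<close> and \<open>l ^ (d - 1) * m\<close> restrict to 1
    and x, which are their own remainders modulo the quadratic \<open>g\<close>; hence they are dual
    to the two vectors.\<close>
  have fr': "frame (monoms V d) ?y ?z (lform (l ^ d)) (lform (l ^ (d - 1) * m))"
    using l lform_forms[OF l(2)] lform_forms[OF l(3)] linear_mod_quad[OF g, of 0 1] one_mod_quad[OF g]
    by (simp add: frame_def vcoeff_vecs pair_vcoeff[OF V] frame_restr[OF fr] One_nat_def)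
  have cong: "g dvd restr ?y ?z p - restr u w (veronese_hom p)" if "p \<in> forms (monoms V d) k" for p k
    using that
  proof (induction k arbitrary: p)
    case 0
    then show ?case using forms_0_cases[of p] by fastforce
  next
    case (Suc k)
    from Suc.prems show ?case
    proof (induction p rule: forms_Suc_induct)
      case (var i q)
      let ?a = "restr u w (Poly_Mapping.single i 1)"
      have "restr ?y ?z (var i) = ?a mod g"
        using quad_mod_coeff(1)[OF g, of ?a] by (simp add: lookup_vcoeff[OF V var(1)])
      moreover have "g dvd ?a mod g - ?a"
        by (metis dvd_minus_iff dvd_minus_mod minus_diff_eq)
      ultimately have a: "g dvd restr ?y ?z (var i) - ?a" by simp
      have "restr ?y ?z (var i * q) - restr u w (veronese_hom (var i * q)) =
        restr ?y ?z (var i) * (restr ?y ?z q - restr u w (veronese_hom q)) +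
        (restr ?y ?z (var i) - ?a) * restr u w (veronese_hom q)"
        by (simp add: algebra_simps del: restr_simps(8))
      then show ?case
        using a Suc.IH[OF var(2)] by (simp only: dvd_add dvd_mult dvd_mult2)
    next
      case (add p q)
      then show ?case
        using dvd_add[OF add] by (simp add: algebra_simps)
    qed simp
  qed
  show ?thesis
  proof (rule secant_lineI[OF _ _ _ fr' g])
    fix p assume p: "p \<in> veronese_image V d X"
    then have pp: "p \<in> polys (monoms V d)" and pX: "veronese_hom p \<in> X"
      by (auto simp: veronese_image_def)
    obtain K where K: "(\<Sum>j\<le>K. hom_part j p) = p"
      using sum_hom_parts[of p] by blast
    have "g dvd (\<Sum>j\<le>K. restr ?y ?z (hom_part j p) - restr u w (veronese_hom (hom_part j p)))"
      by (intro dvd_sum cong[OF hom_part_forms[OF pp]])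
    also have "\<dots> = restr ?y ?z p - restr u w (veronese_hom p)"
      by (subst (3 4) K[symmetric]) (simp add: sum_subtractf restr_sum veronese_sum)
    finally show "g dvd restr ?y ?z p"
      using dvd[OF pX] by (metis dvd_diff_right_iff dvd_diff_commute dvd_diffD1 diff_add_cancel dvd_add)
  qed (use V veronese_image_hom_part[OF X d] in \<open>auto simp: veronese_image_def\<close>)
qed

lemma bisecant_point:
  assumes V: "finite V" and X: "homogeneous_ideal V X" and d: "d \<ge> 1"
    and bi: "bisecant V X u w g" and z: "z \<in> vecs (monoms V d)"
    and pz: "\<And>p. p \<in> forms V d \<Longrightarrow> pair z p =
      a * coeff (restr u w p mod g) 0 + b * coeff (restr u w p mod g) 1"
  shows "\<exists>L. secant_line (monoms V d) (veronese_image V d X) L \<and> lin.span {z} \<subseteq> L"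
proof (intro exI conjI)
  show "secant_line (monoms V d) (veronese_image V d X)
      (lin.span {vcoeff V d u w g 0, vcoeff V d u w g 1})"
    by (rule bisecant_secant_line[OF V X d bi])
  have "z = scale a (vcoeff V d u w g 0) + scale b (vcoeff V d u w g 1)"
    using z by (intro pair_eqI[of _ V d]) (auto simp: vcoeff_vecs pz pair_vcoeff[OF V])
  then have "z \<in> lin.span {vcoeff V d u w g 0, vcoeff V d u w g 1}"
    unfolding span_pair by blast
  then show "lin.span {z} \<subseteq> lin.span {vcoeff V d u w g 0, vcoeff V d u w g 1}"
    by (intro lin.span_minimal) auto
qed

section \<open>Cubics vanishing on the secant variety\<close>

definition det3 :: "('a \<Rightarrow> 'b \<Rightarrow> 'r::comm_ring_1) \<Rightarrow> 'a \<Rightarrow> 'a \<Rightarrow> 'a \<Rightarrow> 'b \<Rightarrow> 'b \<Rightarrow> 'b \<Rightarrow> 'r" where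
  "det3 f a1 a2 a3 b1 b2 b3 =
     f a1 b1 * (f a2 b2 * f a3 b3 - f a2 b3 * f a3 b2) -
     f a1 b2 * (f a2 b1 * f a3 b3 - f a2 b3 * f a3 b1) +
     f a1 b3 * (f a2 b1 * f a3 b2 - f a2 b2 * f a3 b1)"

lemma det3_rank_2:
  assumes "\<And>a b. a \<in> {a1, a2, a3} \<Longrightarrow> b \<in> {b1, b2, b3} \<Longrightarrow> f a b = r a * s b + r' a * s' b"
  shows "det3 f a1 a2 a3 b1 b2 b3 = 0"
proof -
  have "f a b = r a * s b + r' a * s' b" if "a = a1 \<or> a = a2 \<or> a = a3" "b = b1 \<or> b = b2 \<or> b = b3" for a b
    using assms that by blast
  then show ?thesis
    unfolding det3_def by (simp add: algebra_simps)
qed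

definition secant_cubics :: "'v set \<Rightarrow> nat \<Rightarrow> 'v mpoly set \<Rightarrow> ('v \<Rightarrow>\<^sub>0 nat) mpoly set" where
  "secant_cubics V d X =
     {det3 (\<lambda>a b. lform (a * b)) a1 a2 a3 b1 b2 b3 | a1 a2 a3 b1 b2 b3 k. k \<le> d \<and>
        {a1, a2, a3} \<subseteq> forms V k \<and> {b1, b2, b3} \<subseteq> forms V (d - k)} \<union>
     {lform p * lform q * lform r | p q r. p \<in> X \<and> {p, q, r} \<subseteq> forms V d}"

text \<open>The vanishing of the cubics at a nonzero functional, where a product of three linear
  forms is reduced to its factor coming from \<open>X\<close>.\<close>

definition secant_eqs :: "'v set \<Rightarrow> nat \<Rightarrow> 'v mpoly set \<Rightarrow> (('v \<Rightarrow>\<^sub>0 nat) \<Rightarrow>\<^sub>0 complex) \<Rightarrow> bool" where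
  "secant_eqs V d X z \<longleftrightarrow> (\<forall>p\<in>X \<inter> forms V d. pair z p = 0) \<and>
     (\<forall>k a1 a2 a3 b1 b2 b3. k \<le> d \<longrightarrow> {a1, a2, a3} \<subseteq> forms V k \<longrightarrow> {b1, b2, b3} \<subseteq> forms V (d - k) \<longrightarrow>
       det3 (\<lambda>a b. pair z (a * b)) a1 a2 a3 b1 b2 b3 = 0)"

lemma secant_cubics_forms: "secant_cubics V d X \<subseteq> forms (monoms V d) 3"
proof -
  have "det3 (\<lambda>a b. lform (a * b)) a1 a2 a3 b1 b2 b3 \<in> forms (monoms V d) 3"
    if "k \<le> d" "{a1, a2, a3} \<subseteq> forms V k" "{b1, b2, b3} \<subseteq> forms V (d - k)" for a1 a2 a3 b1 b2 b3 k
  proof -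
    have l: "lform (a * b) \<in> forms (monoms V d) 1" if "a \<in> forms V k" "b \<in> forms V (d - k)" for a b
      using that \<open>k \<le> d\<close> by (intro lform_forms forms_mult'[OF that]) simp
    have 3: "x * (y * z - y' * z') \<in> forms (monoms V d) 3"
      if "{x, y, z, y', z'} \<subseteq> forms (monoms V d) 1" for x y z y' z' :: "('a \<Rightarrow>\<^sub>0 nat) mpoly"
    proof -
      have "y * z - y' * z' \<in> forms (monoms V d) (1 + 1)"
        using that by (intro forms_diff forms_mult) simp_all
      then have "x * (y * z - y' * z') \<in> forms (monoms V d) (1 + (1 + 1))"
        using that by (intro forms_mult) simp_all
      then show ?thesis by simp
    qed
    show ?thesis
      unfolding det3_def using that(2,3) by (intro forms_add forms_diff 3) (simp add: l)+
  qed
  moreover have "lform p * lform q * lform r \<in> forms (monoms V d) 3" if "{p, q, r} \<subseteq> forms V d" for p q r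
  proof -
    have "lform p \<in> forms (monoms V d) 1" "lform q \<in> forms (monoms V d) 1" "lform r \<in> forms (monoms V d) 1"
      using that lform_forms by blast+
    from forms_mult[OF forms_mult[OF this(1,2)] this(3)] show ?thesis
      by simp
  qed
  ultimately show ?thesis
    unfolding secant_cubics_def by (intro Un_least subsetI) (elim CollectE exE conjE, simp only:)+
qed

lemma eval_det3: "eval_poly z (det3 (\<lambda>a b. lform (a * b)) a1 a2 a3 b1 b2 b3) =
    det3 (\<lambda>a b. pair z (a * b)) a1 a2 a3 b1 b2 b3"
  by (simp add: det3_def)

lemma secant_eqs_eval:
  assumes "secant_eqs V d X z" "c \<in> secant_cubics V d X"
  shows "eval_poly z c = 0"
  using assms(2) unfolding secant_cubics_def
proof (elim UnE CollectE exE conjE)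
  fix a1 a2 a3 b1 b2 b3 k
  assume "c = det3 (\<lambda>a b. lform (a * b)) a1 a2 a3 b1 b2 b3" "k \<le> d"
    "{a1, a2, a3} \<subseteq> forms V k" "{b1, b2, b3} \<subseteq> forms V (d - k)"
  then show ?thesis
    using assms(1) unfolding secant_eqs_def by (simp only: eval_det3)
next
  fix p q r
  assume "c = lform p * lform q * lform r" "p \<in> X" "{p, q, r} \<subseteq> forms V d"
  then show ?thesis
    using assms(1) by (simp add: secant_eqs_def)
qed

lemma pair_nonzero:
  assumes "z \<in> vecs (monoms V d)" "z \<noteq> 0" "k \<le> d"
  obtains a b where "a \<in> forms V k" "b \<in> forms V (d - k)" "pair z (a * b) \<noteq> 0"
proof -
  obtain m where m: "Poly_Mapping.lookup z m \<noteq> 0"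
    using assms(2) by (metis poly_mapping_eqI lookup_zero)
  then have "m \<in> monoms V (k + (d - k))"
    using assms(1,3) by (auto simp: vecs_def in_keys_iff)
  then obtain a b where "a \<in> monoms V k" "b \<in> monoms V (d - k)" "m = a + b"
    by (rule monoms_split)
  then show ?thesis
    using that[of "Poly_Mapping.single a 1" "Poly_Mapping.single b 1"] m
    by (simp add: forms_single mult_single)
qed

text \<open>A nonzero functional is nonzero on some form of degree \<open>d\<close>; the linear form
  of that one fills both free factors of the product and can be cancelled.\<close>

lemma secant_cubics_eqs:
  assumes z: "z \<in> vecs (monoms V d)" "z \<noteq> 0"
    and 0: "\<And>c. c \<in> secant_cubics V d X \<Longrightarrow> eval_poly z c = 0"
  shows "secant_eqs V d X z"
  unfolding secant_eqs_def
proof (intro conjI ballI allI impI)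
  fix p assume p: "p \<in> X \<inter> forms V d"
  obtain q r where "q \<in> forms V d" "r \<in> forms V (d - d)" "pair z (q * r) \<noteq> 0"
    using pair_nonzero[OF z order_refl] .
  then have q: "q * r \<in> forms V d" "pair z (q * r) \<noteq> 0"
    using forms_mult[of q V d r "d - d"] by auto
  have "lform p * lform (q * r) * lform (q * r) \<in> secant_cubics V d X"
    unfolding secant_cubics_def using p q by blast
  from 0[OF this] q show "pair z p = 0" by simp
next
  fix k a1 a2 a3 b1 b2 b3
  assume "k \<le> d" "{a1, a2, a3} \<subseteq> forms V k" "{b1, b2, b3} \<subseteq> forms V (d - k)"
  then have "det3 (\<lambda>a b. lform (a * b)) a1 a2 a3 b1 b2 b3 \<in> secant_cubics V d X"
    unfolding secant_cubics_def by blast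
  from 0[OF this] show "det3 (\<lambda>a b. pair z (a * b)) a1 a2 a3 b1 b2 b3 = 0"
    by (simp add: eval_det3)
qed

section \<open>The cubics vanish on every secant line\<close>

lemma restr_shift: "restr (u + scale a w) w p = pcompose (restr u w p) [:a, 1:]"
proof -
  have "u + scale a w + scale x w = u + scale (a + x) w" for x
    by (simp add: lin.scale_left_distrib add.assoc)
  then have "poly (restr (u + scale a w) w p) x = poly (pcompose (restr u w p) [:a, 1:]) x" for x
    by (simp add: poly_restr poly_pcompose add.assoc)
  then show ?thesis
    by (simp add: poly_eq_poly_eq_iff[symmetric] fun_eq_iff)
qed

text \<open>The second equation is the value at \<open>c\<close> of the quotient by x, so it also
  holds at a double root, \<open>c = 0\<close>.\<close>

lemma quad_dvd_quad:
  assumes "[:0, 1:] * [:- c, 1:] dvd [:r0, r1, r2 :: complex:]"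
  shows "r0 = 0" "r1 + c * r2 = 0"
proof -
  obtain s where s: "[:r0, r1, r2:] = [:0, 1:] * [:- c, 1:] * s"
    using assms by blast
  have "poly [:r0, r1, r2:] 0 = 0"
    unfolding s by simp
  then show "r0 = 0" by simp
  then have "pCons 0 [:r1, r2:] = pCons 0 ([:- c, 1:] * s)"
    using s by (simp add: algebra_simps)
  then have "[:r1, r2:] = [:- c, 1:] * s"
    by simp
  then have "poly [:r1, r2:] c = poly ([:- c, 1:] * s) c"
    by simp
  then show "r1 + c * r2 = 0" by simp
qed

text \<open>The catalecticant along the line has 2x2 minors vanishing on the length two scheme. For
  distinct roots it is a combination of two matrices of rank one; for a double root it is a
  combination of a matrix of rank one and a tangent direction to the matrices of rank one. Either
  way its rank is at most two.\<close>

lemma secant_line_eqs: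
  assumes V: "finite V" and X: "0 \<in> X"
    and L: "secant_line (monoms V d) (veronese_image V d X) L" and v: "v \<in> L"
  shows "secant_eqs V d X v"
proof -
  let ?M = "monoms V d" and ?Y = "veronese_image V d X"
  obtain J n where J: "closed_subscheme ?M J" "has_length ?M J n" "n \<ge> 2"
    and LJ: "scheme_inter ?M ?Y (line_ideal ?M L) \<subseteq> J" and Lp: "L \<in> proj_lines ?M"
    using L by (auto simp: secant_line_def subscheme_def)
  have "?Y \<union> line_ideal ?M L \<subseteq> scheme_inter ?M ?Y (line_ideal ?M L)"
    unfolding scheme_inter_def
    by (rule ideal_gen_subset_saturation) (auto simp: veronese_image_def line_ideal_def)
  with LJ have YJ: "?Y \<subseteq> J" and line: "line_ideal ?M L \<subseteq> J" by auto
  obtain y z l m a b where fr: "frame ?M y z l m" and Lyz: "L = lin.span {y, z}"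
    and dvd: "\<And>p. p \<in> J \<Longrightarrow> [:- a, 1:] * [:- b, 1:] dvd restr y z p"
    using length_two_on_line[OF finite_monoms[OF V] J Lp line] by blast
  \<comment> \<open>With the origin of the line moved to the root \<open>a\<close>, the roots are 0
    and \<open>c\<close>.\<close>
  define y' where "y' = y + scale a z"
  define c where "c = b - a"
  have y'M: "y' \<in> vecs ?M" and y'0: "y' \<noteq> 0"
    using fr frame_unique[OF fr, of 1 a] by (auto simp: y'_def frame_def)
  obtain s0 t0 where "v = scale s0 y + scale t0 z"
    using v unfolding Lyz span_pair by blast
  moreover define t1 where "t1 = t0 - s0 * a"
  ultimately have vst: "v = scale s0 y' + scale t1 z"
    unfolding y'_def t1_def by (intro poly_mapping_eqI) (simp add: lookup_add lookup_scale algebra_simps)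
  have dvd': "[:0, 1:] * [:- c, 1:] dvd restr y' z p" if pY: "p \<in> ?Y" for p
  proof -
    obtain f where "restr y z p = [:- a, 1:] * [:- b, 1:] * f"
      using dvd[of p] YJ pY by (metis dvdE subsetD)
    then have "restr y' z p = ([:0, 1:] * [:- c, 1:]) * pcompose f [:a, 1:]"
    proof -
      have "pcompose [:- a, 1:] [:a, 1:] = [:0, 1:]" "pcompose [:- b, 1:] [:a, 1:] = [:- c, 1:]"
        by (simp_all add: pcompose_pCons c_def)
      then show ?thesis
        unfolding y'_def restr_shift \<open>restr y z p = _\<close> pcompose_mult by simp
    qed
    then show ?thesis by (metis dvd_triv_left)
  qed
  \<comment> \<open>A linear polynomial divisible by a quadratic one is zero, so these linear forms
    vanish on the whole line.\<close>
  have lin: "pair y' p = 0 \<and> pair z p = 0" if "p \<in> X \<inter> forms V d" for p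
  proof -
    have "lform p \<in> ?Y"
      using that lform_forms[of p V d] by (auto simp: veronese_image_def forms_polys)
    from dvd'[OF this] have "[:0, 1:] * [:- c, 1:] dvd [:pair y' p, pair z p, 0:]"
      using that restr_lform[of p V d y' z] by simp
    then show ?thesis
      using quad_dvd_quad[of c "pair y' p" "pair z p" 0] by simp
  qed
  have "det3 (\<lambda>a b. pair v (a * b)) a1 a2 a3 b1 b2 b3 = 0"
    if k: "k \<le> d" and as: "{a1, a2, a3} \<subseteq> forms V k" and bs: "{b1, b2, b3} \<subseteq> forms V (d - k)"
    for k a1 a2 a3 b1 b2 b3
  proof -
    define A where "A a b = pair y' (a * b)" for a b
    define B where "B a b = pair z (a * b)" for a b
    have pv: "pair v (a * b) = s0 * A a b + t1 * B a b" for a b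
      by (simp add: vst A_def B_def)
    have minors: "A a b * A a' b' - A a b' * A a' b = 0"
      "A a b * B a' b' + B a b * A a' b' - A a b' * B a' b - B a b' * A a' b +
         c * (B a b * B a' b' - B a b' * B a' b) = 0"
      if ab: "a \<in> forms V k" "a' \<in> forms V k" "b \<in> forms V (d - k)" "b' \<in> forms V (d - k)" for a a' b b'
    proof -
      have F: "x * y \<in> forms V d" if "x \<in> forms V k" "y \<in> forms V (d - k)" for x y
        using forms_mult'[OF that] k by simp
      \<comment> \<open>Commutativity puts this minor into the kernel of
        \<open>veronese_hom\<close>, thus into the ideal of the image.\<close>
      let ?p = "lform (a * b) * lform (a' * b') - lform (a * b') * lform (a' * b)"
      have "?p \<in> polys ?M"
        using forms_polys[OF lform_forms[OF F]] ab by simp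
      then have "?p \<in> ?Y"
        using X by (simp add: veronese_image_def mult_ac)
      then have "[:0, 1:] * [:- c, 1:] dvd restr y' z ?p"
        by (rule dvd')
      also have "restr y' z ?p = [:A a b, B a b:] * [:A a' b', B a' b':] - [:A a b', B a b':] * [:A a' b, B a' b:]"
        using ab by (simp add: restr_lform[OF F] A_def B_def)
      also have "\<dots> = [:A a b * A a' b' - A a b' * A a' b,
          A a b * B a' b' + B a b * A a' b' - A a b' * B a' b - B a b' * A a' b,
          B a b * B a' b' - B a b' * B a' b:]"
        by (simp add: algebra_simps)
      finally have "[:0, 1:] * [:- c, 1:] dvd \<dots>" .
      from quad_dvd_quad[OF this]
      show "A a b * A a' b' - A a b' * A a' b = 0"
        "A a b * B a' b' + B a b * A a' b' - A a b' * B a' b - B a b' * A a' b +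
           c * (B a b * B a' b' - B a b' * B a' b) = 0" by blast+
    qed
    obtain \<alpha> \<beta> where ab: "\<alpha> \<in> forms V k" "\<beta> \<in> forms V (d - k)" "A \<alpha> \<beta> \<noteq> 0"
      using pair_nonzero[OF y'M y'0 k] A_def by metis
    \<comment> \<open>A matrix with vanishing 2x2 minors is the product of a column and a row
      through a nonzero entry.\<close>
    have A: "A a b = A a \<beta> * (A \<alpha> b / A \<alpha> \<beta>)" if "a \<in> forms V k" "b \<in> forms V (d - k)" for a b
      using minors(1)[OF that(1) ab(1) that(2) ab(2)] ab(3) by (simp add: field_simps)
    have "\<exists>r s r' s'. \<forall>a\<in>forms V k. \<forall>b\<in>forms V (d - k). pair v (a * b) = r a * s b + r' a * s' b"
    proof (cases "c = 0")
      case True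
      \<comment> \<open>The mixed minor is the derivative of the rank one condition at
        \<open>A\<close>: it writes \<open>B\<close> as a column of \<open>A\<close> times a row,
        plus a column times a row of \<open>A\<close>.\<close>
      have B: "B a b = A a \<beta> * ((B \<alpha> b - B \<alpha> \<beta> * A \<alpha> b / A \<alpha> \<beta>) / A \<alpha> \<beta>) + B a \<beta> * (A \<alpha> b / A \<alpha> \<beta>)"
        if "a \<in> forms V k" "b \<in> forms V (d - k)" for a b
      proof -
        have "B a b * A \<alpha> \<beta> = A a \<beta> * B \<alpha> b + B a \<beta> * A \<alpha> b - A a b * B \<alpha> \<beta>"
          using minors(2)[OF that(1) ab(1) that(2) ab(2)] True by (simp add: algebra_simps)
        also have "A a b = A a \<beta> * (A \<alpha> b / A \<alpha> \<beta>)"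
          by (rule A[OF that])
        finally show ?thesis
          using ab(3) by (simp add: field_simps)
      qed
      have "pair v (a * b) =
          A a \<beta> * (s0 * (A \<alpha> b / A \<alpha> \<beta>) + t1 * ((B \<alpha> b - B \<alpha> \<beta> * A \<alpha> b / A \<alpha> \<beta>) / A \<alpha> \<beta>)) +
          B a \<beta> * (t1 * (A \<alpha> b / A \<alpha> \<beta>))"
        if "a \<in> forms V k" "b \<in> forms V (d - k)" for a b
        unfolding pv by (subst A[OF that], subst B[OF that]) (simp only: ring_distribs mult_ac add_ac)
      then show ?thesis
        by (intro exI[of _ "\<lambda>a. A a \<beta>"] exI[of _ "\<lambda>a. B a \<beta>"] ballI
            exI[of _ "\<lambda>b. s0 * (A \<alpha> b / A \<alpha> \<beta>) + t1 * ((B \<alpha> b - B \<alpha> \<beta> * A \<alpha> b / A \<alpha> \<beta>) / A \<alpha> \<beta>)"]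
            exI[of _ "\<lambda>b. t1 * (A \<alpha> b / A \<alpha> \<beta>)"])
    next
      case False
      \<comment> \<open>The catalecticant at the second root. Its minors are combinations of the two
        relations in \<open>minors\<close>, so it has rank one as well.\<close>
      define C where "C a b = A a b + c * B a b" for a b
      have C_pair: "C a b = pair (scale 1 y' + scale c z) (a * b)" for a b
        unfolding C_def A_def B_def pair_lincomb by simp
      have "scale 1 y' + scale c z \<noteq> 0"
        using frame_unique[OF fr, of 1 "a + c"]
        by (simp add: y'_def lin.scale_left_distrib add.assoc)
      moreover have "scale 1 y' + scale c z \<in> vecs ?M"
        using y'M fr by (simp add: frame_def)
      ultimately obtain \<gamma> \<delta> where cd: "\<gamma> \<in> forms V k" "\<delta> \<in> forms V (d - k)" "C \<gamma> \<delta> \<noteq> 0"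
        using pair_nonzero[of "scale 1 y' + scale c z" V d k] k C_pair by metis
      have C: "C a b = C a \<delta> * (C \<gamma> b / C \<gamma> \<delta>)" if "a \<in> forms V k" "b \<in> forms V (d - k)" for a b
      proof -
        have "C a b * C \<gamma> \<delta> - C a \<delta> * C \<gamma> b =
          (A a b * A \<gamma> \<delta> - A a \<delta> * A \<gamma> b) +
          c * (A a b * B \<gamma> \<delta> + B a b * A \<gamma> \<delta> - A a \<delta> * B \<gamma> b - B a \<delta> * A \<gamma> b +
            c * (B a b * B \<gamma> \<delta> - B a \<delta> * B \<gamma> b))"
          by (simp add: C_def algebra_simps)
        then have "C a b * C \<gamma> \<delta> = C a \<delta> * C \<gamma> b"
          using minors[OF that(1) cd(1) that(2) cd(2)] by simp
        then show ?thesis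
          using cd(3) by (simp add: field_simps)
      qed
      \<comment> \<open>The weights come from solving for \<open>B\<close> as (C - A) / c.\<close>
      have "pair v (a * b) = A a \<beta> * ((s0 - t1 / c) * (A \<alpha> b / A \<alpha> \<beta>)) + C a \<delta> * (t1 / c * (C \<gamma> b / C \<gamma> \<delta>))"
        if "a \<in> forms V k" "b \<in> forms V (d - k)" for a b
      proof -
        have "pair v (a * b) = (s0 - t1 / c) * A a b + t1 / c * C a b"
          using False unfolding pv by (simp add: C_def field_simps)
        also have "\<dots> = A a \<beta> * ((s0 - t1 / c) * (A \<alpha> b / A \<alpha> \<beta>)) + C a \<delta> * (t1 / c * (C \<gamma> b / C \<gamma> \<delta>))"
          by (subst A[OF that], subst C[OF that]) (simp only: mult_ac)
        finally show ?thesis .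
      qed
      then show ?thesis
        by (intro exI[of _ "\<lambda>a. A a \<beta>"] exI[of _ "\<lambda>a. C a \<delta>"] ballI
            exI[of _ "\<lambda>b. (s0 - t1 / c) * (A \<alpha> b / A \<alpha> \<beta>)"]
            exI[of _ "\<lambda>b. t1 / c * (C \<gamma> b / C \<gamma> \<delta>)"])
    qed
    then obtain r s r' s' where
      "\<And>a b. a \<in> forms V k \<Longrightarrow> b \<in> forms V (d - k) \<Longrightarrow> pair v (a * b) = r a * s b + r' a * s' b"
      by blast
    then show ?thesis
      using as bs by (intro det3_rank_2[where r = r and s = s and r' = r' and s' = s']) auto
  qed
  moreover have "pair v p = 0" if "p \<in> X \<inter> forms V d" for p
    using lin[OF that] by (simp add: vst)
  ultimately show ?thesis
    unfolding secant_eqs_def by blast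
qed

section \<open>Functionals of rank at most two\<close>

lemma point_of_functional:
  assumes V: "finite V" and add: "\<And>p q. f (p + q) = f p + f q" and mult: "\<And>c p. f (const c * p) = c * f p"
  obtains u where "u \<in> vecs V" "\<And>p. p \<in> forms V 1 \<Longrightarrow> eval_poly u p = f p"
proof
  let ?u = "\<Sum>i\<in>V. Poly_Mapping.single i (f (var i))"
  have f0: "f 0 = 0" using mult[of 0 0] by simp
  have u: "Poly_Mapping.lookup ?u i = (f (var i) when i \<in> V)" for i
    using V by (simp add: lookup_sum lookup_single when_def)
  then show "?u \<in> vecs V"
    by (auto simp: vecs_def in_keys_iff)
  fix p assume "p \<in> forms V 1"
  then have "p \<in> forms V (Suc 0)" by (simp add: One_nat_def)
  then show "eval_poly ?u p = f p"
  proof (induction p rule: forms_Suc_induct)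
    case (var i q)
    then obtain c where "q = const c" using forms_0_cases by blast
    then show ?case
      using var u[of i] mult[of c "var i"] by (simp add: mult.commute)
  qed (simp_all add: f0 add)
qed

text \<open>By \<open>lin\<close> each variable may be replaced, one at a time, by its combination
  of \<open>a1\<close> and \<open>a2\<close>. Doing this to all factors of \<open>p\<close> produces
  the homogenised restriction of \<open>p\<close> in \<open>a1\<close> and
  \<open>a2\<close>.\<close>

lemma pair_via_plane:
  assumes a: "a1 \<in> forms V 1" "a2 \<in> forms V 1"
    and lin: "\<And>i b. i \<in> V \<Longrightarrow> b \<in> forms V (d - 1) \<Longrightarrow> pair z (var i * b) =
      Poly_Mapping.lookup u i * pair z (a1 * b) + Poly_Mapping.lookup w i * pair z (a2 * b)"
    and "k \<le> d" "p \<in> forms V k" "b \<in> forms V (d - k)"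
  shows "pair z (p * b) = pair z (bform a1 a2 k (restr u w p) * b)"
  using assms(4-)
proof (induction k arbitrary: p b)
  case 0
  then obtain c where "p = const c" using forms_0_cases by blast
  then show ?case by (simp add: bform_def)
next
  case (Suc k)
  from Suc.prems(2) show ?case
  proof (induction p rule: forms_Suc_induct)
    case (var i q)
    have qb: "q * b \<in> forms V (d - 1)"
      using Suc.prems by (intro forms_mult'[OF var(2) Suc.prems(3)]) simp
    have ab: "a1 * b \<in> forms V (d - k)" "a2 * b \<in> forms V (d - k)"
      using Suc.prems by (auto intro: forms_mult'[OF a(1) Suc.prems(3)] forms_mult'[OF a(2) Suc.prems(3)])
    let ?u = "Poly_Mapping.lookup u i" and ?w = "Poly_Mapping.lookup w i"
    let ?r = "bform a1 a2 k (restr u w q)"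
    have "pair z (var i * q * b) = ?u * pair z (q * (a1 * b)) + ?w * pair z (q * (a2 * b))"
      using lin[OF var(1) qb] by (simp add: mult_ac)
    also have "pair z (q * (a1 * b)) = pair z (?r * (a1 * b))"
      using Suc.prems by (intro Suc.IH var ab) simp
    also have "pair z (q * (a2 * b)) = pair z (?r * (a2 * b))"
      using Suc.prems by (intro Suc.IH var ab) simp
    also have "?u * pair z (?r * (a1 * b)) + ?w * pair z (?r * (a2 * b)) =
        pair z (const ?u * (?r * (a1 * b)) + const ?w * (?r * (a2 * b)))"
      by simp
    also have "const ?u * (?r * (a1 * b)) + const ?w * (?r * (a2 * b)) =
        (const ?u * a1 + const ?w * a2) * ?r * b"
      by (simp add: algebra_simps)
    also have "(const ?u * a1 + const ?w * a2) * ?r = bform a1 a2 (Suc k) (restr u w (var i * q))"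
      by (simp only: restr_simps bform_Suc[OF degree_restr[OF var(2)]])
    finally show ?case .
  qed (simp_all add: bform_add distrib_right)
qed

text \<open>
  The plane spanned by \<open>u\<close> and \<open>w\<close> is the smallest subspace through which \<open>z\<close> factors.
\<close>

definition essential_plane where
  "essential_plane V d z u w l m \<longleftrightarrow> frame V u w l m \<and>
     (\<forall>p\<in>forms V d. restr u w p = 0 \<longrightarrow> pair z p = 0) \<and>
     (\<forall>a\<in>forms V 1. (\<forall>b\<in>forms V (d - 1). pair z (a * b) = 0) \<longrightarrow> restr u w a = 0)"

text \<open>The rank of the catalecticant whose rows are indexed by linear forms decides. At rank
  one the functional is a multiple of evaluation at a point; at rank two the rows \<open>a1\<close>,
  \<open>a2\<close> are coordinates on the plane through which it factors.\<close>

lemma rank_dichotomy: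
  assumes V: "finite V" and d: "d \<ge> 1" and z: "z \<in> vecs (monoms V d)" "z \<noteq> 0"
    and eqs: "secant_eqs V d X z"
  obtains (one) u l c where "u \<in> vecs V" "l \<in> forms V 1" "eval_poly u l = 1" "c \<noteq> 0"
      "\<And>p. p \<in> forms V d \<Longrightarrow> pair z p = c * eval_poly u p"
    | (two) u w l m where "essential_plane V d z u w l m"
proof -
  let ?S = "forms V 1" and ?T = "forms V (d - 1)"
  have b1: "1 \<in> forms V (d - d)" by simp
  show ?thesis
  proof (cases "\<forall>a\<in>?S. \<forall>a'\<in>?S. \<forall>b\<in>?T. \<forall>b'\<in>?T.
      pair z (a * b) * pair z (a' * b') = pair z (a * b') * pair z (a' * b)")
    case True
    obtain a1 b1 where ab: "a1 \<in> ?S" "b1 \<in> ?T" "pair z (a1 * b1) \<noteq> 0"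
      using pair_nonzero[OF z d] .
    define f where "f a = pair z (a * b1) / pair z (a1 * b1)" for a
    obtain u where u: "u \<in> vecs V" "\<And>p. p \<in> ?S \<Longrightarrow> eval_poly u p = f p"
      by (rule point_of_functional[OF V, of f])
        (simp_all add: f_def distrib_right add_divide_distrib mult.assoc)
    \<comment> \<open>The second summand is zero: rank one is treated as a plane whose second basis
      vector and coordinate are both 0.\<close>
    have "pair z (var i * b) = Poly_Mapping.lookup u i * pair z (a1 * b) +
        Poly_Mapping.lookup 0 i * pair z (0 * b)" if "i \<in> V" "b \<in> ?T" for i b
    proof -
      have "pair z (var i * b) * pair z (a1 * b1) = pair z (var i * b1) * pair z (a1 * b)"
        using True ab that by simp
      moreover have "Poly_Mapping.lookup u i = f (var i)"
        using u(2)[of "var i"] that by simp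
      moreover have "x = l * e" if "x * c = y * e" "l = y / c" "c \<noteq> 0" for x y l e c :: complex
        using that by (metis nonzero_mult_div_cancel_right times_divide_eq_left)
      ultimately have "pair z (var i * b) = Poly_Mapping.lookup u i * pair z (a1 * b)"
        using ab(3) f_def by metis
      then show ?thesis by simp
    qed
    from pair_via_plane[OF ab(1) forms_0 this order_refl _ b1]
    have *: "pair z p = pair z (bform a1 0 d (restr u 0 p))" if "p \<in> forms V d" for p
      using that by simp
    have "restr u 0 p = [:eval_poly u p:]" for p
      by (simp add: poly_eq_poly_eq_iff[symmetric] fun_eq_iff poly_restr)
    moreover have "bform a1 0 d [:c:] = const c * a1 ^ d" for c
    proof -
      have "bform a1 0 d [:c:] = (\<Sum>j\<le>d. if j = 0 then const c * a1 ^ d else 0)"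
        unfolding bform_def by (intro sum.cong) (auto simp: coeff_pCons split: nat.split)
      then show ?thesis by simp
    qed
    ultimately have p: "pair z p = pair z (a1 ^ d) * eval_poly u p" if "p \<in> forms V d" for p
      using *[OF that] by simp
    have "pair z (a1 ^ d) \<noteq> 0"
      using p[of "a1 * b1"] ab forms_mult'[OF ab(1,2)] d by auto
    moreover have "eval_poly u a1 = 1"
      using u(2)[OF ab(1)] ab(3) by (simp add: f_def)
    ultimately show ?thesis
      using one[OF u(1) ab(1)] p by blast
  next
    case False
    then obtain a1 a2 b1 b2 where ab: "a1 \<in> ?S" "a2 \<in> ?S" "b1 \<in> ?T" "b2 \<in> ?T"
      and minor: "pair z (a1 * b1) * pair z (a2 * b2) \<noteq> pair z (a1 * b2) * pair z (a2 * b1)"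
      by blast
    define D where "D = pair z (a1 * b1) * pair z (a2 * b2) - pair z (a1 * b2) * pair z (a2 * b1)"
    have D: "D \<noteq> 0"
      using minor by (simp add: D_def)
    \<comment> \<open>Cramer's rule for the coordinates of row \<open>a\<close> with respect to the
      rows \<open>a1\<close> and \<open>a2\<close>. Their values on the variables are the
      coordinates of \<open>u\<close> and \<open>w\<close>.\<close>
    define f1 where "f1 a = (pair z (a * b1) * pair z (a2 * b2) - pair z (a * b2) * pair z (a2 * b1)) / D" for a
    define f2 where "f2 a = (pair z (a1 * b1) * pair z (a * b2) - pair z (a1 * b2) * pair z (a * b1)) / D" for a
    have exp: "pair z (a * b) = f1 a * pair z (a1 * b) + f2 a * pair z (a2 * b)"
      if "a \<in> ?S" "b \<in> ?T" for a b
    proof -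
      have "det3 (\<lambda>a b. pair z (a * b)) a a1 a2 b b1 b2 = 0"
        using eqs d ab that unfolding secant_eqs_def by simp
      then have "D * pair z (a * b) = (D * f1 a) * pair z (a1 * b) + (D * f2 a) * pair z (a2 * b)"
        using D by (simp add: det3_def f1_def f2_def) (simp add: D_def algebra_simps)
      then have "D * pair z (a * b) = D * (f1 a * pair z (a1 * b) + f2 a * pair z (a2 * b))"
        by (simp only: distrib_left mult.assoc)
      then show ?thesis using D by simp
    qed
    have cm: "pair z (const c * p * b) = c * pair z (p * b)" for c p b
      by (simp add: mult.assoc)
    have add: "f1 (p + q) = f1 p + f1 q" "f2 (p + q) = f2 p + f2 q" for p q
      by (simp_all add: f1_def f2_def distrib_left distrib_right flip: add_divide_distrib)
    have mult: "f1 (const c * p) = c * f1 p" "f2 (const c * p) = c * f2 p" for c p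
      by (simp_all add: f1_def f2_def cm right_diff_distrib mult.left_commute)
    obtain u where u: "u \<in> vecs V" "\<And>p. p \<in> ?S \<Longrightarrow> eval_poly u p = f1 p"
      using point_of_functional[OF V, of f1] add(1) mult(1) by metis
    obtain w where w: "w \<in> vecs V" "\<And>p. p \<in> ?S \<Longrightarrow> eval_poly w p = f2 p"
      using point_of_functional[OF V, of f2] add(2) mult(2) by metis
    have fr: "frame V u w a1 a2"
      using u w ab D unfolding frame_def by (simp add: f1_def f2_def) (simp add: D_def mult_ac)
    have lu: "Poly_Mapping.lookup u i = f1 (var i)" "Poly_Mapping.lookup w i = f2 (var i)" if "i \<in> V" for i
      using u(2)[of "var i"] w(2)[of "var i"] that by simp_all
    have "pair z (var i * b) = Poly_Mapping.lookup u i * pair z (a1 * b) +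
        Poly_Mapping.lookup w i * pair z (a2 * b)" if "i \<in> V" "b \<in> ?T" for i b
      using exp[of "var i" b] lu that by simp
    from pair_via_plane[OF ab(1,2) this order_refl _ b1]
    have *: "pair z p = pair z (bform a1 a2 d (restr u w p))" if "p \<in> forms V d" for p
      using that by simp
    have "restr u w a = 0" if "a \<in> ?S" "\<forall>b\<in>?T. pair z (a * b) = 0" for a
      using that ab u(2)[OF that(1)] w(2)[OF that(1)] by (simp add: restr_linear f1_def f2_def)
    then have "essential_plane V d z u w a1 a2"
      unfolding essential_plane_def using fr * by simp
    then show ?thesis by (rule two)
  qed
qed

section \<open>Change of basis and apolar quadrics\<close>

lemma essential_plane_change:
  assumes ep: "essential_plane V d z u w l m" and fr: "frame V u' w' l' m'"
    and new: "u' = scale a u + scale b w" "w' = scale c u + scale e w"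
    and old: "u = scale a' u' + scale b' w'" "w = scale c' u' + scale e' w'"
  shows "essential_plane V d z u' w' l' m'"
    and "p \<in> forms V k \<Longrightarrow> restr u w p = 0 \<Longrightarrow> restr u' w' p = 0"
proof -
  have 1: "restr u' w' p = 0" if "p \<in> forms V k" "restr u w p = 0" for p k
    unfolding new by (rule restr_change_eq_0[OF that])
  moreover have "restr u w p = 0" if "p \<in> forms V k" "restr u' w' p = 0" for p k
    using restr_change_eq_0[OF that, of a' b' c' e'] by (simp flip: old)
  ultimately show "essential_plane V d z u' w' l' m'"
    using ep fr unfolding essential_plane_def by meson
  show "p \<in> forms V k \<Longrightarrow> restr u w p = 0 \<Longrightarrow> restr u' w' p = 0"
    by (rule 1)
qed

text \<open>Expanding the determinant along the column \<open>b\<close>, the cofactors are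
  coefficients independent of \<open>b\<close>, and one of them is a 2x2 minor chosen to be nonzero.
  If all such minors vanish, already the first two rows are dependent.\<close>

lemma linear_dependence_3:
  fixes f :: "nat \<Rightarrow> 'b \<Rightarrow> complex"
  assumes "\<And>b1 b2 b3. {b1, b2, b3} \<subseteq> T \<Longrightarrow> det3 f 0 1 2 b1 b2 b3 = 0"
  shows "\<exists>q0 q1 q2. (q0, q1, q2) \<noteq> (0, 0, 0) \<and> (\<forall>b\<in>T. q0 * f 0 b + q1 * f 1 b + q2 * f 2 b = 0)"
proof (cases "\<exists>b1\<in>T. \<exists>b2\<in>T. f 0 b1 * f 1 b2 - f 0 b2 * f 1 b1 \<noteq> 0")
  case True
  then obtain b1 b2 where b: "b1 \<in> T" "b2 \<in> T" "f 0 b1 * f 1 b2 - f 0 b2 * f 1 b1 \<noteq> 0"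
    by blast
  have "(f 1 b1 * f 2 b2 - f 1 b2 * f 2 b1) * f 0 b + (f 0 b2 * f 2 b1 - f 0 b1 * f 2 b2) * f 1 b +
      (f 0 b1 * f 1 b2 - f 0 b2 * f 1 b1) * f 2 b = 0" if "b \<in> T" for b
    using assms[of b b1 b2] that b by (simp add: det3_def algebra_simps)
  moreover have "(f 1 b1 * f 2 b2 - f 1 b2 * f 2 b1, f 0 b2 * f 2 b1 - f 0 b1 * f 2 b2,
      f 0 b1 * f 1 b2 - f 0 b2 * f 1 b1) \<noteq> (0, 0, 0)"
    using b(3) by (simp only: prod.inject simp_thms)
  ultimately show ?thesis
    by blast
next
  case False
  show ?thesis
  proof (cases "\<exists>b\<in>T. f 0 b \<noteq> 0 \<or> f 1 b \<noteq> 0")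
    case True
    then obtain b' where b': "b' \<in> T" "f 0 b' \<noteq> 0 \<or> f 1 b' \<noteq> 0" by blast
    then have "\<forall>b\<in>T. f 1 b' * f 0 b + (- f 0 b') * f 1 b + 0 * f 2 b = 0"
      using False by (simp add: algebra_simps)
    with b'(2) show ?thesis
      by (metis prod.inject neg_equal_0_iff_equal)
  next
    case False
    then have "\<forall>b\<in>T. 1 * f 0 b + 0 * f 1 b + 0 * f 2 b = 0"
      by simp
    then show ?thesis
      by (metis prod.inject one_neq_zero)
  qed
qed

text \<open>Three rows of the catalecticant are dependent, and \<open>Q\<close> is the combination
  with these coefficients. It stays nonzero on the line because the three products restrict to 1, x
  and x^2.\<close>

lemma apolar_quadric:
  assumes fr: "frame V u w l m" and d: "d \<ge> 2" and eqs: "secant_eqs V d X z"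
  obtains Q where "Q \<in> forms V 2" "restr u w Q \<noteq> 0" "\<And>G. G \<in> forms V (d - 2) \<Longrightarrow> pair z (Q * G) = 0"
proof -
  have l: "l \<in> forms V 1" and m: "m \<in> forms V 1"
    using fr by (auto simp: frame_def)
  have q: "l\<^sup>2 \<in> forms V 2" "l * m \<in> forms V 2" "m\<^sup>2 \<in> forms V 2"
    using l m forms_mult[OF l m] by simp_all
  define f where "f i b = pair z ([l\<^sup>2, l * m, m\<^sup>2] ! i * b)" for i b
  have "det3 f 0 1 2 b1 b2 b3 = 0" if "{b1, b2, b3} \<subseteq> forms V (d - 2)" for b1 b2 b3
  proof -
    have "det3 f 0 1 2 b1 b2 b3 = det3 (\<lambda>a b. pair z (a * b)) (l\<^sup>2) (l * m) (m\<^sup>2) b1 b2 b3"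
      by (simp add: det3_def f_def One_nat_def numeral_2_eq_2)
    also have "\<dots> = 0"
      using eqs d q that unfolding secant_eqs_def by simp
    finally show ?thesis .
  qed
  then have "\<exists>q0 q1 q2. (q0, q1, q2) \<noteq> (0, 0, 0) \<and>
      (\<forall>b\<in>forms V (d - 2). q0 * f 0 b + q1 * f 1 b + q2 * f 2 b = 0)"
    by (rule linear_dependence_3)
  then obtain q0 q1 q2 where nz: "(q0, q1, q2) \<noteq> (0, 0, 0)"
    and 0: "\<forall>b\<in>forms V (d - 2). q0 * f 0 b + q1 * f 1 b + q2 * f 2 b = 0"
    by (elim exE conjE)
  let ?Q = "const q0 * l\<^sup>2 + const q1 * (l * m) + const q2 * m\<^sup>2"
  show ?thesis
  proof
    show "?Q \<in> forms V 2"
      using q by simp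
    have "restr u w ?Q = [:q0, q1, q2:]"
      by (simp add: frame_restr[OF fr] power2_eq_square)
    then show "restr u w ?Q \<noteq> 0"
      using nz by auto
    fix G assume "G \<in> forms V (d - 2)"
    from 0[rule_format, OF this] show "pair z (?Q * G) = 0"
      by (simp add: f_def distrib_right mult.assoc One_nat_def numeral_2_eq_2)
  qed
qed

text \<open>A root of \<open>Q\<close> at infinity would lower the degree of its restriction, so the
  new second basis vector is a point where \<open>Q\<close> does not vanish.\<close>

lemma essential_plane_root:
  assumes ep: "essential_plane V d z u w l m" and Q: "Q \<in> forms V 2" "restr u w Q \<noteq> 0"
  obtains u' w' l' m' where "essential_plane V d z u' w' l' m'" "degree (restr u' w' Q) = 2"
    "\<And>p k. p \<in> forms V k \<Longrightarrow> restr u w p = 0 \<Longrightarrow> restr u' w' p = 0"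
proof -
  obtain x where x: "eval_poly (u + scale x w) Q \<noteq> 0"
    using Q(2) by (metis poly_all_0_iff_0 poly_restr)
  define u' where "u' = scale 0 u + scale 1 w"
  define w' where "w' = scale 1 u + scale x w"
  have fr: "frame V u w l m"
    using ep by (simp add: essential_plane_def)
  obtain l' m' where fr': "frame V u' w' l' m'"
    using frame_change[OF fr _ u'_def w'_def] by auto
  have "u = scale (- x) u' + scale 1 w'" "w = scale 1 u' + scale 0 w'"
    unfolding u'_def w'_def
    by (rule poly_mapping_eqI, simp only: lookup_add lookup_scale, simp add: algebra_simps)+
  note change = essential_plane_change[OF ep fr' u'_def w'_def this]
  have "coeff (restr u' w' Q) 2 \<noteq> 0"
    using coeff_restr_top[OF Q(1), of u' w'] x by (simp add: w'_def)
  then have "degree (restr u' w' Q) = 2"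
    using degree_restr[OF Q(1), of u' w'] le_degree by (metis le_antisym)
  with change show ?thesis
    by (intro that[of u' w' l' m']) auto
qed

text \<open>A restriction divisible by that of \<open>Q\<close> is the restriction of a multiple of
  \<open>Q\<close> by a form of degree \<open>d - 2\<close>, which \<open>z\<close> kills. Hence
  \<open>z\<close> sees only the remainder, represented by \<open>l ^ d\<close> and
  \<open>l ^ (d - 1) * m\<close>.\<close>

lemma pair_mod_quadric:
  assumes ep: "essential_plane V d z u w l m" and d: "d \<ge> 2"
    and Q: "Q \<in> forms V 2" "degree (restr u w Q) = 2"
      "\<And>G. G \<in> forms V (d - 2) \<Longrightarrow> pair z (Q * G) = 0"
  shows "p \<in> forms V d \<Longrightarrow> restr u w Q dvd restr u w p \<Longrightarrow> pair z p = 0"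
    and "p \<in> forms V d \<Longrightarrow> pair z p = pair z (l ^ d) * coeff (restr u w p mod restr u w Q) 0 +
      pair z (l ^ (d - 1) * m) * coeff (restr u w p mod restr u w Q) 1"
proof -
  let ?g = "restr u w Q"
  have fr: "frame V u w l m" and plane: "\<And>p. p \<in> forms V d \<Longrightarrow> restr u w p = 0 \<Longrightarrow> pair z p = 0"
    using ep by (auto simp: essential_plane_def)
  have l: "l \<in> forms V 1" and m: "m \<in> forms V 1"
    using fr by (auto simp: frame_def)
  have kill: "pair z p = 0" if p: "p \<in> forms V d" and dvd: "?g dvd restr u w p" for p
  proof (cases "restr u w p = 0")
    case True
    with p show ?thesis by (rule plane)
  next
    case False
    obtain h where h: "restr u w p = ?g * h"
      using dvd by blast
    with False have "degree (restr u w p) = 2 + degree h"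
      using Q(2) by (auto simp: degree_mult_eq)
    then have "degree h \<le> d - 2"
      using degree_restr[OF p, of u w] by linarith
    then have H: "restr u w (bform l m (d - 2) h) = h"
      by (rule restr_bform[OF fr])
    let ?H = "bform l m (d - 2) h"
    have HF: "?H \<in> forms V (d - 2)"
      by (rule bform_forms[OF l m])
    have "Q * ?H \<in> forms V d"
      using d by (intro forms_mult'[OF Q(1) HF]) simp
    then have "pair z (p - Q * ?H) = 0"
      using p by (intro plane) (simp_all add: H h)
    then show ?thesis
      using Q(3)[OF HF] by simp
  qed
  then show "p \<in> forms V d \<Longrightarrow> ?g dvd restr u w p \<Longrightarrow> pair z p = 0" .
  assume p: "p \<in> forms V d"
  define c0 where "c0 = coeff (restr u w p mod ?g) 0"
  define c1 where "c1 = coeff (restr u w p mod ?g) 1"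
  have lm: "l ^ d \<in> forms V d" "l ^ (d - 1) * m \<in> forms V d"
    using l m d by (auto intro!: forms_mult'[of _ V "d - 1"])
  have "restr u w (const c0 * l ^ d + const c1 * (l ^ (d - 1) * m)) = restr u w p mod ?g"
    using quad_mod_coeff(1)[OF Q(2), of "restr u w p"]
    by (simp add: frame_restr[OF fr] c0_def c1_def)
  then have "?g dvd restr u w (p - (const c0 * l ^ d + const c1 * (l ^ (d - 1) * m)))"
    by (simp add: dvd_minus_mod del: restr_simps(4,6))
  then have "pair z (p - (const c0 * l ^ d + const c1 * (l ^ (d - 1) * m))) = 0"
    using p lm by (intro kill) simp_all
  then have "pair z p = c0 * pair z (l ^ d) + c1 * pair z (l ^ (d - 1) * m)"
    by simp
  then show "pair z p = pair z (l ^ d) * coeff (restr u w p mod restr u w Q) 0 +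
      pair z (l ^ (d - 1) * m) * coeff (restr u w p mod restr u w Q) 1"
    by (simp only: c0_def c1_def mult.commute[of "pair z _"])
qed

text \<open>Lift the remainder of \<open>F\<close> modulo \<open>Q\<close> to a linear form a. For
  every b of degree \<open>d - 1\<close> the product a b agrees modulo \<open>Q\<close> with
  \<open>F\<close> times a lift of the remainder of b, so \<open>z\<close> kills it. Minimality of
  the plane then makes a vanish on it.\<close>

lemma quadric_vanishes:
  assumes ep: "essential_plane V d z u w l m" and d: "d \<ge> 3"
    and Q: "Q \<in> forms V 2" "degree (restr u w Q) = 2"
      "\<And>G. G \<in> forms V (d - 2) \<Longrightarrow> pair z (Q * G) = 0"
    and F: "\<And>G. G \<in> forms V (d - 2) \<Longrightarrow> pair z (F * G) = 0" "F \<in> forms V 2"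
  shows "restr u w Q dvd restr u w F"
proof -
  let ?g = "restr u w Q"
  have fr: "frame V u w l m"
    using ep by (auto simp: essential_plane_def)
  have l: "l \<in> forms V 1" and m: "m \<in> forms V 1"
    using fr by (auto simp: frame_def)
  define c0 where "c0 = coeff (restr u w F mod ?g) 0"
  define c1 where "c1 = coeff (restr u w F mod ?g) 1"
  let ?a = "const c0 * l + const c1 * m"
  have ra: "restr u w ?a = restr u w F mod ?g"
    using quad_mod_coeff(1)[OF Q(2), of "restr u w F"]
    by (simp add: frame_restr[OF fr] c0_def c1_def)
  have aF: "?a \<in> forms V 1" using l m by simp
  have "pair z (?a * b) = 0" if b: "b \<in> forms V (d - 1)" for b
  proof -
    define b0 where "b0 = coeff (restr u w b mod ?g) 0"
    define b1 where "b1 = coeff (restr u w b mod ?g) 1"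
    \<comment> \<open>A linear remainder is realised in degree \<open>d - 2\<close> only if this is
      at least 1; here \<open>d \<ge> 3\<close> enters.\<close>
    let ?G = "const b0 * l ^ (d - 2) + const b1 * (l ^ (d - 3) * m)"
    have G: "?G \<in> forms V (d - 2)"
      using l m d by (auto intro!: forms_add forms_cmult forms_mult'[of _ V "d - 3" _ 1])
    have rG: "restr u w ?G = restr u w b mod ?g"
      using quad_mod_coeff(1)[OF Q(2), of "restr u w b"]
      by (simp add: frame_restr[OF fr] b0_def b1_def)
    have FG: "F * ?G \<in> forms V d"
      using d by (intro forms_mult'[OF F(2) G]) simp
    have ab: "?a * b \<in> forms V d"
      using d by (intro forms_mult'[OF aF b]) simp
    let ?f = "restr u w F" and ?b = "restr u w b"
    have "restr u w (F * ?G - ?a * b) = ?f * (?b mod ?g) - (?f mod ?g) * ?b"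
      by (simp only: restr_simps(5,6) rG ra)
    also have "\<dots> = (?f - ?f mod ?g) * ?b - ?f * (?b - ?b mod ?g)"
      by (simp add: algebra_simps)
    finally have "?g dvd restr u w (F * ?G - ?a * b)"
      by (simp only: dvd_diff dvd_mult dvd_mult2 dvd_minus_mod)
    then have "pair z (F * ?G - ?a * b) = 0"
      using FG ab by (intro pair_mod_quadric(1)[OF ep _ Q]) (use d in simp_all)
    then show ?thesis
      using F(1)[OF G] by (simp only: pair_simps diff_0 neg_equal_0_iff_equal)
  qed
  then have "restr u w ?a = 0"
    using ep aF unfolding essential_plane_def by blast
  then show ?thesis
    using ra by (simp add: dvd_eq_mod_eq_0)
qed

section \<open>Schemes cut out by quadrics with linear Koszul syzygies\<close>

text \<open>A linear form sent to 1 undoes the saturation. With \<open>h\<close> abstract, this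
  covers restriction to a line as well as evaluation at a point.\<close>

lemma dvd_of_generators:
  fixes h :: "'v mpoly \<Rightarrow> 'r::comm_ring_1"
  assumes h: "h 0 = 0" "h 1 = 1" "\<And>p q. h (p + q) = h p + h q" "\<And>p q. h (p * q) = h p * h q"
    and gen: "\<And>F. F \<in> A \<Longrightarrow> g dvd h F"
    and l: "l \<in> forms V 1" "h l = 1"
    and p: "p \<in> saturation V (ideal_gen V A)"
  shows "g dvd h p"
proof -
  have "submodule_over (polys V) (*) {p. g dvd h p}"
    by (auto simp: submodule_over_def h)
  then have *: "ideal_gen V A \<subseteq> {p. g dvd h p}"
    unfolding ideal_gen_def using gen by (intro hull_minimal) auto
  obtain k where "\<And>f. f \<in> forms V k \<Longrightarrow> f * p \<in> ideal_gen V A"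
    using p by (auto simp: saturation_def)
  from this[OF forms_power_1[OF l(1)]] have "g dvd h (l ^ k * p)"
    using * by auto
  moreover have "h (l ^ k) = 1"
    by (induction k) (simp_all add: h l)
  ultimately show ?thesis by (simp add: h)
qed

section \<open>Degree two: the functional as a binary quadratic form\<close>

lemma pair_binary_quadric:
  assumes ep: "essential_plane V 2 z u w l m" and p: "p \<in> forms V 2"
  shows "pair z p = coeff (restr u w p) 0 * pair z (l\<^sup>2) + coeff (restr u w p) 1 * pair z (l * m) +
    coeff (restr u w p) 2 * pair z (m\<^sup>2)"
proof -
  have fr: "frame V u w l m"
    using ep by (simp add: essential_plane_def)
  then have l: "l \<in> forms V 1" and m: "m \<in> forms V 1"
    by (auto simp: frame_def)
  define q where "q = const (coeff (restr u w p) 0) * l\<^sup>2 + const (coeff (restr u w p) 1) * (l * m) +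
    const (coeff (restr u w p) 2) * m\<^sup>2"
  have q: "q \<in> forms V 2"
    using l m forms_mult[OF l m] by (simp add: q_def)
  have rq: "restr u w q = [:coeff (restr u w p) 0, coeff (restr u w p) 1, coeff (restr u w p) 2:]"
    by (simp add: q_def frame_restr[OF fr] power2_eq_square)
  have "restr u w p = restr u w q"
  proof (rule poly_eqI)
    fix n
    have "n > 2 \<Longrightarrow> coeff (restr u w p) n = 0"
      using degree_restr[OF p, of u w] by (intro coeff_eq_0) simp
    then show "coeff (restr u w p) n = coeff (restr u w q) n"
      unfolding rq by (auto simp: coeff_pCons numeral_2_eq_2 One_nat_def split: nat.split)
  qed
  then have "p - q \<in> forms V 2" "restr u w (p - q) = 0"
    using p q by simp_all
  then have "pair z (p - q) = 0"
    using ep unfolding essential_plane_def by blast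
  then show ?thesis by (simp add: q_def)
qed

text \<open>A vector in the kernel of the Gram matrix is a linear form all of whose multiples are
  killed by \<open>z\<close>; by minimality of the plane it vanishes there.\<close>

lemma binary_quadric_nondegenerate:
  assumes ep: "essential_plane V 2 z u w l m"
    and 0: "a * pair z (l\<^sup>2) + b * pair z (l * m) = 0" "a * pair z (l * m) + b * pair z (m\<^sup>2) = 0"
  shows "a = 0 \<and> b = 0"
proof -
  have fr: "frame V u w l m"
    using ep by (simp add: essential_plane_def)
  then have l: "l \<in> forms V 1" and m: "m \<in> forms V 1"
    by (auto simp: frame_def)
  let ?c = "const a * l + const b * m"
  have c: "?c \<in> forms V 1" using l m by simp
  have "pair z (?c * q) = 0" if q: "q \<in> forms V (2 - 1)" for q
  proof -
    have q1: "q \<in> forms V 1" using q by (simp add: One_nat_def)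
    have cq: "?c * q \<in> forms V 2"
      using forms_mult[OF c q1] by simp
    have "restr u w (?c * q) = [:a * eval_poly u q, a * eval_poly w q + b * eval_poly u q, b * eval_poly w q:]"
      by (simp add: frame_restr[OF fr] restr_linear[OF q1])
    then have "pair z (?c * q) = a * eval_poly u q * pair z (l\<^sup>2) +
        (a * eval_poly w q + b * eval_poly u q) * pair z (l * m) + b * eval_poly w q * pair z (m\<^sup>2)"
      using pair_binary_quadric[OF ep cq] by (simp add: numeral_2_eq_2 One_nat_def)
    also have "\<dots> = eval_poly u q * (a * pair z (l\<^sup>2) + b * pair z (l * m)) +
        eval_poly w q * (a * pair z (l * m) + b * pair z (m\<^sup>2))"
      by (simp add: algebra_simps)
    finally show ?thesis using 0 by simp
  qed
  then have "restr u w ?c = 0"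
    using ep c unfolding essential_plane_def by blast
  then show ?thesis
    by (simp add: frame_restr[OF fr])
qed

text \<open>Gram-Schmidt for the bilinear form z(ab) on linear forms, with the dual basis of the
  plane carried along. Nondegeneracy makes the second diagonal entry nonzero.\<close>

lemma binary_quadric_diagonal:
  assumes ep: "essential_plane V 2 z u w l m"
  obtains u' w' l' m' where "essential_plane V 2 z u' w' l' m'"
    "pair z (l'\<^sup>2) \<noteq> 0" "pair z (l' * m') = 0" "pair z (m'\<^sup>2) \<noteq> 0"
proof -
  have "\<exists>u w l m. essential_plane V 2 z u w l m \<and> pair z (l\<^sup>2) \<noteq> 0"
  proof (cases "pair z (l\<^sup>2) = 0 \<and> pair z (m\<^sup>2) = 0")
    case True
    \<comment> \<open>If both coordinates are isotropic, their sum is not, since its square has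
      value \<open>2 * pair z (l * m)\<close>. The basis dual to \<open>l + m\<close>,
      \<open>m\<close> is \<open>u\<close>, \<open>w - u\<close>.\<close>
    define w' where "w' = scale (- 1) u + scale 1 w"
    have fr: "frame V u w l m"
      using ep by (simp add: essential_plane_def)
    then have lm: "l \<in> forms V 1" "m \<in> forms V 1" "u \<in> vecs V" "w \<in> vecs V"
      by (auto simp: frame_def)
    have "frame V u w' (l + m) m"
      using fr lm vecs_lincomb[of u V w "- 1" 1] eval_poly_linear[of _ V "- 1" u 1 w]
      unfolding frame_def w'_def by simp
    moreover have "u = scale 1 u + scale 0 w'" "w = scale 1 u + scale 1 w'" "u = scale 1 u + scale 0 w"
      unfolding w'_def
      by (rule poly_mapping_eqI, simp only: lookup_add lookup_scale, simp add: algebra_simps)+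
    ultimately have "essential_plane V 2 z u w' (l + m) m"
      using essential_plane_change(1)[OF ep] w'_def by blast
    moreover have "pair z (l * m) \<noteq> 0"
      using binary_quadric_nondegenerate[OF ep, of 1 0] True by auto
    moreover have "(l + m)\<^sup>2 = l\<^sup>2 + l * m + l * m + m\<^sup>2"
      by (simp add: power2_eq_square algebra_simps)
    then have "pair z ((l + m)\<^sup>2) = pair z (l\<^sup>2) + pair z (l * m) + pair z (l * m) + pair z (m\<^sup>2)"
      by (simp only: pair_simps)
    then have "pair z ((l + m)\<^sup>2) = 2 * pair z (l * m)"
      using True by simp
    ultimately show ?thesis by (metis mult_eq_0_iff zero_neq_numeral)
  next
    case False
    have "essential_plane V 2 z w u m l"
    proof (rule essential_plane_change(1)[OF ep])
      show "frame V w u m l"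
        using ep frame_swap by (auto simp: essential_plane_def)
      show "w = scale 0 u + scale 1 w" "u = scale 1 u + scale 0 w"
        "u = scale 0 w + scale 1 u" "w = scale 1 w + scale 0 u" by simp_all
    qed
    with ep False show ?thesis by blast
  qed
  then obtain u w l m where ep: "essential_plane V 2 z u w l m" and nz: "pair z (l\<^sup>2) \<noteq> 0"
    by blast
  \<comment> \<open>The projection coefficient that makes \<open>m - t l\<close> orthogonal to
    \<open>l\<close>; dually, \<open>u\<close> becomes \<open>u + t w\<close>.\<close>
  define t where "t = pair z (l * m) / pair z (l\<^sup>2)"
  define u' where "u' = scale 1 u + scale t w"
  have fr: "frame V u w l m"
    using ep by (simp add: essential_plane_def)
  then have lm: "l \<in> forms V 1" "m \<in> forms V 1"
    by (auto simp: frame_def)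
  have "frame V u' w l (m - const t * l)"
    using fr eval_poly_linear[OF lm(1), of 1 u t w] eval_poly_linear[OF lm(2), of 1 u t w]
    unfolding frame_def u'_def by simp
  moreover have "w = scale 0 u + scale 1 w" "u = scale 1 u' + scale (- t) w" "w = scale 0 u' + scale 1 w"
    unfolding u'_def
    by (rule poly_mapping_eqI, simp only: lookup_add lookup_scale, simp add: algebra_simps)+
  ultimately have ep': "essential_plane V 2 z u' w l (m - const t * l)"
    using essential_plane_change(1)[OF ep] u'_def by blast
  have "l * (m - const t * l) = l * m - const t * l\<^sup>2"
    by (simp add: power2_eq_square algebra_simps)
  then have 0: "pair z (l * (m - const t * l)) = 0"
    using nz by (simp add: t_def)
  moreover have "pair z ((m - const t * l)\<^sup>2) \<noteq> 0"
    using binary_quadric_nondegenerate[OF ep', of 0 1] 0 by auto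
  ultimately show ?thesis
    using that[OF ep' nz] by blast
qed

locale quadric_scheme =
  fixes V :: "'v set" and X :: "'v mpoly set" and s :: nat and F :: "nat \<Rightarrow> 'v mpoly"
  assumes finite_V: "finite V" and closed: "closed_subscheme V X"
    and quadrics: "i \<le> s \<Longrightarrow> F i \<in> forms V 2"
    and cut_out: "cut_out_by V X (F ` {..s})"
    and koszul: "i \<le> s \<Longrightarrow> j \<le> s \<Longrightarrow> koszul_syzygy F i j \<in> syzygies_gen V (linear_syzygies V s F)"
begin

lemma homogeneous: "homogeneous_ideal V X"
  using closed by (simp add: closed_subscheme_def)

lemma generators_in: "i \<le> s \<Longrightarrow> F i \<in> X"
  using ideal_gen_subset_saturation[of "F ` {..s}" V] quadrics cut_out forms_polys
  unfolding cut_out_by_def by blast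

lemma mult_generator_in:
  assumes "i \<le> s" "G \<in> forms V (d - 2)" "d \<ge> 2"
  shows "F i * G \<in> X \<inter> forms V d"
proof -
  interpret proj_scheme V X by unfold_locales (rule closed)
  have "G * F i \<in> X"
    using assms by (intro mult_in generators_in forms_polys)
  moreover have "F i * G \<in> forms V d"
    using assms by (intro forms_mult'[OF quadrics assms(2)]) auto
  ultimately show ?thesis by (simp add: mult.commute)
qed

lemma dvd_restr:
  assumes "frame V u w l m" "\<And>i. i \<le> s \<Longrightarrow> g dvd restr u w (F i)" "p \<in> X"
  shows "g dvd restr u w p"
proof (rule dvd_of_generators[of "restr u w" "F ` {..s}" g l V])
  show "p \<in> saturation V (ideal_gen V (F ` {..s}))"
    using assms(3) cut_out by (simp add: cut_out_by_def)
qed (use assms(1,2) frame_restr[OF assms(1)] in \<open>auto simp: frame_def\<close>)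

text \<open>The instance of \<open>dvd_of_generators\<close> with divisor 0, which divides only
  0.\<close>

lemma eval_zero:
  assumes "l \<in> forms V 1" "eval_poly u l = 1" "\<And>i. i \<le> s \<Longrightarrow> eval_poly u (F i) = 0" "p \<in> X"
  shows "eval_poly u p = 0"
proof -
  have "0 dvd eval_poly u p"
  proof (rule dvd_of_generators[of "eval_poly u" "F ` {..s}" 0 l V])
    show "p \<in> saturation V (ideal_gen V (F ` {..s}))"
      using assms(4) cut_out by (simp add: cut_out_by_def)
  qed (use assms(1-3) in auto)
  then show ?thesis by simp
qed

text \<open>
  Each linear syzygy, contracted with \<open>F(u)\<close>, is a linear form vanishing at \<open>u\<close> and at \<open>w\<close>, hence on
  the line through them. So the Koszul syzygies contracted with \<open>F(u)\<close> vanish on this line as well.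
\<close>

lemma restr_proportional:
  assumes same: "\<And>i. i \<le> s \<Longrightarrow> eval_poly u (F i) = c * eval_poly w (F i)"
    and "i \<le> s" "j \<le> s"
  shows "smult (eval_poly u (F i)) (restr u w (F j)) = smult (eval_poly u (F j)) (restr u w (F i))"
proof -
  let ?y = "\<lambda>i. eval_poly u (F i)"
  \<comment> \<open>The kernel of the contraction with F(u) followed by restriction to the line. It
    is a submodule, so it suffices to put the linear syzygies into it.\<close>
  define M where "M = {a. (\<Sum>i\<le>s. smult (?y i) (restr u w (Poly_Mapping.lookup a i))) = 0}"
  have act: "Poly_Mapping.lookup (Poly_Mapping.map ((*) r) a) i = r * Poly_Mapping.lookup a i"
    for r :: "'v mpoly" and a :: "nat \<Rightarrow>\<^sub>0 'v mpoly" and i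
    by (simp add: Poly_Mapping.map.rep_eq when_def)
  have "submodule_over (polys V) (\<lambda>p. Poly_Mapping.map ((*) p)) M"
    unfolding submodule_over_def M_def
    by (auto simp: lookup_add smult_add_right sum.distrib act simp flip: mult_smult_right sum_distrib_left)
  moreover have "linear_syzygies V s F \<subseteq> M"
  proof
    fix a assume a: "a \<in> linear_syzygies V s F"
    then have lin: "Poly_Mapping.lookup a i \<in> forms V 1" for i
      by (auto simp: linear_syzygies_def)
    have syz: "(\<Sum>i\<le>s. Poly_Mapping.lookup a i * F i) = 0"
      using a by (auto simp: linear_syzygies_def syzygies_def)
    have ev: "(\<Sum>i\<le>s. eval_poly v (Poly_Mapping.lookup a i) * eval_poly v (F i)) = 0" for v
      using arg_cong[OF syz, of "eval_poly v"] by (simp add: eval_poly_sum)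
    have u: "(\<Sum>i\<le>s. ?y i * eval_poly u (Poly_Mapping.lookup a i)) = 0"
      using ev[of u] by (simp add: mult.commute)
    \<comment> \<open>Proportionality of F(u) and F(w) turns the contraction at \<open>w\<close>
      into the syzygy evaluated at \<open>w\<close>.\<close>
    have "(\<Sum>i\<le>s. ?y i * eval_poly w (Poly_Mapping.lookup a i)) =
        c * (\<Sum>i\<le>s. eval_poly w (Poly_Mapping.lookup a i) * eval_poly w (F i))"
      by (simp add: same sum_distrib_left mult_ac)
    then have w: "(\<Sum>i\<le>s. ?y i * eval_poly w (Poly_Mapping.lookup a i)) = 0"
      by (simp add: ev)
    have "(\<Sum>i\<le>s. smult (?y i) (restr u w (Poly_Mapping.lookup a i))) =
        (\<Sum>i\<le>s. [:?y i * eval_poly u (Poly_Mapping.lookup a i), ?y i * eval_poly w (Poly_Mapping.lookup a i):])"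
      by (simp add: restr_linear[OF lin])
    also have "\<dots> = [:\<Sum>i\<le>s. ?y i * eval_poly u (Poly_Mapping.lookup a i),
        \<Sum>i\<le>s. ?y i * eval_poly w (Poly_Mapping.lookup a i):]"
      by (induction s) simp_all
    finally show "a \<in> M"
      using u w by (simp add: M_def)
  qed
  ultimately have "syzygies_gen V (linear_syzygies V s F) \<subseteq> M"
    unfolding syzygies_gen_def by (intro hull_minimal)
  with koszul[OF assms(2,3)] have "koszul_syzygy F i j \<in> M"
    by blast
  moreover have "(\<Sum>k\<le>s. smult (?y k) (restr u w (Poly_Mapping.lookup (koszul_syzygy F i j) k))) =
      (\<Sum>k\<le>s. (if k = i then smult (?y i) (restr u w (F j)) else 0) -
        (if k = j then smult (?y j) (restr u w (F i)) else 0))"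
    by (intro sum.cong refl) (simp add: koszul_syzygy_def lookup_minus lookup_single when_def smult_diff_right)
  ultimately show ?thesis
    using assms(2,3) by (simp add: M_def sum_subtractf)
qed

lemma bisecant_of_essential_plane:
  assumes ep: "essential_plane V d z u w l m" and d: "d \<ge> 2" and eqs: "secant_eqs V d X z"
  obtains u' w' g a b where "bisecant V X u' w' g"
    "\<And>p. p \<in> forms V d \<Longrightarrow> pair z p =
      a * coeff (restr u' w' p mod g) 0 + b * coeff (restr u' w' p mod g) 1"
proof -
  have ann: "pair z (F i * G) = 0" if "i \<le> s" "G \<in> forms V (d - 2)" for i G
    using eqs mult_generator_in[OF that d] unfolding secant_eqs_def by blast
  have "\<exists>u w l m Q. essential_plane V d z u w l m \<and> Q \<in> forms V 2 \<and> degree (restr u w Q) = 2 \<and>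
      (\<forall>G\<in>forms V (d - 2). pair z (Q * G) = 0) \<and> (\<forall>i\<le>s. restr u w Q dvd restr u w (F i))"
  proof (cases "d = 2")
    case False
    then have d3: "d \<ge> 3" using d by simp
    obtain Q where Q: "Q \<in> forms V 2" "restr u w Q \<noteq> 0" "\<And>G. G \<in> forms V (d - 2) \<Longrightarrow> pair z (Q * G) = 0"
      using apolar_quadric[OF _ d eqs] ep unfolding essential_plane_def by metis
    obtain u' w' l' m' where ep': "essential_plane V d z u' w' l' m'" and deg: "degree (restr u' w' Q) = 2"
      using essential_plane_root[OF ep Q(1,2)] by metis
    have "restr u' w' Q dvd restr u' w' (F i)" if "i \<le> s" for i
      using quadric_vanishes[OF ep' d3 Q(1) deg Q(3) ann[OF that] quadrics[OF that]] by blast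
    with ep' deg Q show ?thesis by blast
  next
    case True
    obtain u w l m where ep: "essential_plane V 2 z u w l m"
      and nz: "pair z (l\<^sup>2) \<noteq> 0" "pair z (m\<^sup>2) \<noteq> 0" and lm0: "pair z (l * m) = 0"
      using binary_quadric_diagonal[of V z u w l m] ep True by metis
    have fr: "frame V u w l m"
      using ep by (simp add: essential_plane_def)
    then have l: "l \<in> forms V 1" and m: "m \<in> forms V 1"
      by (auto simp: frame_def)
    have diag: "pair z p = eval_poly u p * pair z (l\<^sup>2) + eval_poly w p * pair z (m\<^sup>2)" if "p \<in> forms V 2" for p
      using pair_binary_quadric[OF ep that] coeff_restr_top[OF that, of u w] poly_restr[of u w p 0] lm0
      by (simp add: poly_0_coeff_0)
    have F0: "pair z (F i) = 0" if "i \<le> s" for i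
      using ann[OF that, of 1] True by simp
    \<comment> \<open>The equation \<open>pair z (F i) = 0\<close> in diagonal form; it supplies the
      factor that \<open>restr_proportional\<close> expects.\<close>
    have Fw: "eval_poly u (F i) = - (pair z (m\<^sup>2) / pair z (l\<^sup>2)) * eval_poly w (F i)" if "i \<le> s" for i
      using diag[OF quadrics[OF that]] F0[OF that] nz by (simp add: field_simps eq_neg_iff_add_eq_0)
    obtain Q where Q: "Q \<in> forms V 2" "restr u w Q \<noteq> 0" "pair z Q = 0"
      "\<And>i. i \<le> s \<Longrightarrow> \<exists>c. restr u w (F i) = smult c (restr u w Q)"
    proof (cases "\<exists>i\<le>s. eval_poly u (F i) \<noteq> 0")
      case True
      then obtain i0 where i0: "i0 \<le> s" "eval_poly u (F i0) \<noteq> 0" by blast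
      show ?thesis
      proof (rule that[of "F i0"])
        show "restr u w (F i0) \<noteq> 0"
          using i0(2) poly_restr[of u w "F i0" 0] by auto
        fix i assume i: "i \<le> s"
        have "smult (eval_poly u (F i0)) (restr u w (F i)) = smult (eval_poly u (F i)) (restr u w (F i0))"
          by (rule restr_proportional[OF Fw i0(1) i])
        then have "smult (1 / eval_poly u (F i0)) (smult (eval_poly u (F i0)) (restr u w (F i))) =
            smult (1 / eval_poly u (F i0)) (smult (eval_poly u (F i)) (restr u w (F i0)))"
          by simp
        then show "\<exists>c. restr u w (F i) = smult c (restr u w (F i0))"
          using i0(2) by auto
      qed (use quadrics i0 F0 in auto)
    next
      case False
      \<comment> \<open>All quadrics vanish at \<open>u\<close>, hence by \<open>Fw\<close> also at
        \<open>w\<close>. On the line they are then multiples of \<open>l * m\<close>, which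
        \<open>z\<close> kills by orthogonality.\<close>
      show ?thesis
      proof (rule that[of "l * m"])
        show "l * m \<in> forms V 2"
          using forms_mult[OF l m] by simp
        show "restr u w (l * m) \<noteq> 0"
          by (simp add: frame_restr[OF fr])
        fix i assume i: "i \<le> s"
        have 0: "coeff (restr u w (F i)) 0 = 0"
          using False i poly_restr[of u w "F i" 0] by (simp add: poly_0_coeff_0)
        have "eval_poly w (F i) = 0"
          using False i Fw[OF i] nz by auto
        then have 2: "coeff (restr u w (F i)) 2 = 0"
          using coeff_restr_top[OF quadrics[OF i]] by simp
        have "restr u w (F i) = smult (coeff (restr u w (F i)) 1) (restr u w (l * m))"
        proof (rule poly_eqI)
          fix n :: nat
          consider "n = 0" | "n = 1" | "n = 2" | "n > 2" by linarith
          then show "coeff (restr u w (F i)) n = coeff (smult (coeff (restr u w (F i)) 1) (restr u w (l * m))) n"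
          proof cases
            case 4
            then have "coeff (restr u w (F i)) n = 0"
              using degree_restr[OF quadrics[OF i], of u w] by (intro coeff_eq_0) simp
            then show ?thesis
              using 4 by (simp add: frame_restr[OF fr] coeff_pCons split: nat.split)
          qed (use 0 2 in \<open>simp_all add: frame_restr[OF fr] One_nat_def numeral_2_eq_2\<close>)
        qed
        then show "\<exists>c. restr u w (F i) = smult c (restr u w (l * m))" ..
      qed (rule lm0)
    qed
    obtain u' w' l' m' where ep': "essential_plane V 2 z u' w' l' m'" and deg: "degree (restr u' w' Q) = 2"
      and plane: "\<And>p k. p \<in> forms V k \<Longrightarrow> restr u w p = 0 \<Longrightarrow> restr u' w' p = 0"
      using essential_plane_root[OF ep Q(1,2)] by metis
    have "restr u' w' Q dvd restr u' w' (F i)" if i: "i \<le> s" for i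
    proof -
      obtain c where "restr u w (F i) = smult c (restr u w Q)"
        using Q(4)[OF i] by blast
      \<comment> \<open>Vanishing of a form on the plane survives the change of frame, so the
        proportionality is carried over as the vanishing of this difference.\<close>
      then have "restr u w (F i - const c * Q) = 0" by simp
      then have "restr u' w' (F i - const c * Q) = 0"
        using quadrics[OF i] Q(1) by (intro plane[of _ 2]) simp_all
      then have "restr u' w' (F i) = smult c (restr u' w' Q)" by simp
      then show ?thesis by (simp add: dvd_smult)
    qed
    moreover have "pair z (Q * G) = 0" if "G \<in> forms V 0" for G
      using forms_0_cases[OF that] Q(3) by (auto simp: mult.commute[of Q])
    ultimately show ?thesis
      unfolding True diff_self_eq_0 using ep' deg Q(1) by blast
  qed
  then obtain u w l m Q where ep: "essential_plane V d z u w l m"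
    and Q: "Q \<in> forms V 2" "degree (restr u w Q) = 2" "\<And>G. G \<in> forms V (d - 2) \<Longrightarrow> pair z (Q * G) = 0"
    and dvd: "\<And>i. i \<le> s \<Longrightarrow> restr u w Q dvd restr u w (F i)"
    by blast
  have fr: "frame V u w l m"
    using ep by (simp add: essential_plane_def)
  then have "bisecant V X u w (restr u w Q)"
    unfolding bisecant_def using Q(2) dvd_restr[OF fr dvd] by blast
  then show ?thesis
    using pair_mod_quadric(2)[OF ep d Q] by (rule that)
qed

section \<open>Secant lines through points of the Veronese image\<close>

lemma bisecant_two_points:
  assumes uw: "u \<in> vecs V" "w \<in> vecs V" and indep: "\<And>a b. scale a u + scale b w = 0 \<Longrightarrow> a = 0 \<and> b = 0"
    and zero: "\<And>p. p \<in> X \<Longrightarrow> eval_poly u p = 0" "\<And>p. p \<in> X \<Longrightarrow> eval_poly w p = 0"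
  shows "bisecant V X u (scale (- 1) u + scale 1 w) ([:0, 1:] * [:- 1, 1:])"
proof -
  let ?w = "scale (- 1) u + scale 1 w"
  have "a = 0 \<and> b = 0" if "scale a u + scale b ?w = 0" for a b
  proof -
    have "scale a u + scale b ?w = scale (a - b) u + scale b w"
      by (rule poly_mapping_eqI, simp only: lookup_add lookup_scale, simp add: algebra_simps)
    with that indep[of "a - b" b] show ?thesis by simp
  qed
  then obtain l m where "frame V u ?w l m"
    using frame_exists[OF uw(1) vecs_lincomb[OF uw], of "- 1" 1] by metis
  moreover have "[:0, 1:] * [:- 1, 1:] dvd restr u ?w p" if p: "p \<in> X" for p
  proof -
    \<comment> \<open>The direction is chosen so that the two points sit at x = 0 and x = 1, the
      roots of the quadratic polynomial.\<close>
    have "u + scale 1 ?w = w" by simp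
    then have "poly (restr u ?w p) 0 = 0" "poly (restr u ?w p) 1 = 0"
      unfolding poly_restr using zero[OF p] by simp_all
    then obtain r where r: "restr u ?w p = [:0, 1:] * r"
      using poly_eq_0_iff_dvd[of "restr u ?w p" 0] by auto
    with \<open>poly (restr u ?w p) 1 = 0\<close> have "poly r 1 = 0"
      by simp
    then have "[:- 1, 1:] dvd r"
      by (simp add: poly_eq_0_iff_dvd)
    then show ?thesis
      unfolding r by (rule mult_dvd_mono[OF dvd_refl])
  qed
  moreover have "degree ([:0, 1:] * [:- 1, 1 :: complex:]) = 2"
    by simp
  ultimately show ?thesis
    unfolding bisecant_def by blast
qed

text \<open>The value of a polynomial at a root of \<open>g\<close> depends only on its remainder
  modulo \<open>g\<close>, so the image of this point lies on the secant line of the pair.\<close>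

lemma bisecant_root:
  assumes bi: "bisecant V X u w g" and root: "poly g x = 0" and d: "d \<ge> 1"
    and z: "z \<in> vecs (monoms V d)"
    and pz: "\<And>p. p \<in> forms V d \<Longrightarrow> pair z p = c * eval_poly (u + scale x w) p"
  shows "\<exists>L. secant_line (monoms V d) (veronese_image V d X) L \<and> lin.span {z} \<subseteq> L"
proof (rule bisecant_point[OF finite_V homogeneous d bi z])
  fix p assume "p \<in> forms V d"
  have deg: "degree g = 2"
    using bi by (simp add: bisecant_def)
  let ?r = "restr u w p mod g"
  have "poly (restr u w p) x = poly ?r x"
    using root by (simp add: poly_mod)
  also have "\<dots> = coeff ?r 0 + coeff ?r 1 * x"
    by (subst quad_mod_coeff(1)[OF deg]) (simp add: mult.commute)
  finally show "pair z p = c * coeff ?r 0 + c * x * coeff ?r 1"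
    using pz[OF \<open>p \<in> forms V d\<close>] by (simp add: poly_restr algebra_simps)
qed

lemma rank_one_point:
  assumes u: "l \<in> forms V 1" "eval_poly u l = 1" and c: "c \<noteq> 0" and d: "d \<ge> 2"
    and eqs: "secant_eqs V d X z"
    and pz: "\<And>p. p \<in> forms V d \<Longrightarrow> pair z p = c * eval_poly u p" and p: "p \<in> X"
  shows "eval_poly u p = 0"
proof (rule eval_zero[OF u _ p])
  fix i assume i: "i \<le> s"
  have "F i * l ^ (d - 2) \<in> X \<inter> forms V d"
    using u by (intro mult_generator_in[OF i _ d]) simp
  then have "pair z (F i * l ^ (d - 2)) = 0" "F i * l ^ (d - 2) \<in> forms V d"
    using eqs unfolding secant_eqs_def by blast+
  with pz[of "F i * l ^ (d - 2)"] c u(2) show "eval_poly u (F i) = 0"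
    by simp
qed

text \<open>The given bisecant has a root, which is a point of the scheme. If it differs from
  \<open>u\<close>, the line joining the two is a bisecant through \<open>u\<close>; if it is
  \<open>u\<close>, the given bisecant already serves.\<close>

lemma point_on_secant_line:
  assumes d: "d \<ge> 2" and u: "u \<in> vecs V" "u \<noteq> 0" "\<And>p. p \<in> X \<Longrightarrow> eval_poly u p = 0"
    and z: "z \<in> vecs (monoms V d)" and pz: "\<And>p. p \<in> forms V d \<Longrightarrow> pair z p = c * eval_poly u p"
    and bi: "bisecant V X u0 w0 g"
  shows "\<exists>L. secant_line (monoms V d) (veronese_image V d X) L \<and> lin.span {z} \<subseteq> L"
proof -
  obtain l0 m0 where fr: "frame V u0 w0 l0 m0" and deg: "degree g = 2"
    and dvd: "\<And>p. p \<in> X \<Longrightarrow> g dvd restr u0 w0 p"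
    using bi by (auto simp: bisecant_def)
  obtain x where x: "poly g x = 0"
    using fundamental_theorem_of_algebra[of g] deg by (auto simp: constant_degree)
  define w where "w = u0 + scale x w0"
  have w: "w \<in> vecs V"
    using fr by (simp add: w_def frame_def)
  have wX: "eval_poly w p = 0" if "p \<in> X" for p
  proof -
    have "poly (restr u0 w0 p) x = 0"
      using dvd[OF that] x by (auto elim!: dvdE)
    then show ?thesis
      by (simp add: poly_restr w_def)
  qed
  show ?thesis
  proof (cases "\<forall>a b. scale a u + scale b w = 0 \<longrightarrow> a = 0 \<and> b = 0")
    case True
    then have bi': "bisecant V X u (scale (- 1) u + scale 1 w) ([:0, 1:] * [:- 1, 1:])"
      using u w wX by (intro bisecant_two_points) auto
    show ?thesis
      using d pz by (intro bisecant_root[OF bi' _ _ z, of 0 c]) simp_all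
  next
    case False
    then obtain a b where ab: "scale a u + scale b w = 0" "a \<noteq> 0 \<or> b \<noteq> 0" by blast
    have "w \<noteq> 0"
      using frame_unique[OF fr, of 1 x] by (auto simp: w_def)
    then have a: "a \<noteq> 0"
      using ab by auto
    have "u = scale (- b / a) w"
    proof (rule poly_mapping_eqI)
      fix i
      have "Poly_Mapping.lookup (scale a u + scale b w) i = 0"
        by (simp add: ab)
      then show "Poly_Mapping.lookup u i = Poly_Mapping.lookup (scale (- b / a) w) i"
        using a by (simp add: lookup_add lookup_scale field_simps eq_neg_iff_add_eq_0)
    qed
    then have "pair z p = c * (- b / a) ^ d * eval_poly (u0 + scale x w0) p" if "p \<in> forms V d" for p
      using pz[OF that] eval_poly_scale[OF that, of "- b / a" w] by (simp only: w_def mult.assoc)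
    then show ?thesis
      using d by (intro bisecant_root[OF bi x _ z, of "c * (- b / a) ^ d"]) simp_all
  qed
qed

lemma secant_eqs_secant_line:
  assumes d: "d \<ge> 2" and z: "z \<in> vecs (monoms V d)" "z \<noteq> 0" and eqs: "secant_eqs V d X z"
    and bi: "bisecant V X u0 w0 g0"
  shows "\<exists>L. secant_line (monoms V d) (veronese_image V d X) L \<and> lin.span {z} \<subseteq> L"
proof -
  have d1: "d \<ge> 1" using d by simp
  show ?thesis
  proof (cases rule: rank_dichotomy[OF finite_V d1 z eqs, case_names one two])
    case (one u l c)
    have "u \<noteq> 0"
      using one(2,3) eval_poly_scale[OF one(2), of 0 u] by auto
    then show ?thesis
      using rank_one_point[OF one(2-4) d eqs one(5)]
      by (intro point_on_secant_line[OF d one(1) _ _ z(1) one(5) bi])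
  next
    case (two u w l m)
    obtain u' w' g a b where "bisecant V X u' w' g"
      "\<And>p. p \<in> forms V d \<Longrightarrow> pair z p =
        a * coeff (restr u' w' p mod g) 0 + b * coeff (restr u' w' p mod g) 1"
      using bisecant_of_essential_plane[OF two d eqs] by metis
    then show ?thesis
      by (intro bisecant_point[OF finite_V homogeneous d1 _ z(1)])
  qed
qed

text \<open>Points of a secant line satisfy the cubics. Without a bisecant each of them would have
  rank one and so be the image of a point of the scheme; but two such points of the scheme span a
  bisecant.\<close>

lemma bisecant_of_secant_line:
  assumes d: "d \<ge> 2" and L: "secant_line (monoms V d) (veronese_image V d X) L"
  shows "\<exists>u w g. bisecant V X u w g"
proof (rule ccontr)
  assume no: "\<not> (\<exists>u w g. bisecant V X u w g)"
  have d1: "d \<ge> 1" using d by simp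
  have X0: "0 \<in> X"
    using closed by (auto simp: closed_subscheme_def homogeneous_ideal_def ideal_of_def submodule_over_def)
  have point: "\<exists>u l c. u \<in> vecs V \<and> l \<in> forms V 1 \<and> eval_poly u l = 1 \<and> c \<noteq> 0 \<and>
      (\<forall>p\<in>forms V d. pair y p = c * eval_poly u p) \<and> (\<forall>p\<in>X. eval_poly u p = 0)"
    if y: "y \<in> L" "y \<in> vecs (monoms V d)" "y \<noteq> 0" for y
  proof -
    have eqs: "secant_eqs V d X y"
      by (rule secant_line_eqs[OF finite_V X0 L y(1)])
    show ?thesis
    proof (cases rule: rank_dichotomy[OF finite_V d1 y(2,3) eqs, case_names one two])
      case (one u l c)
      then show ?thesis
        using rank_one_point[OF one(2-4) d eqs one(5)] by blast
    next
      case (two u w l m)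
      show ?thesis
        using bisecant_of_essential_plane[OF two d eqs] no by metis
    qed
  qed
  obtain y z k n where fr: "frame (monoms V d) y z k n" and Lyz: "L = lin.span {y, z}"
    using L line_frame unfolding secant_line_def by metis
  have yz: "y \<in> vecs (monoms V d)" "y \<noteq> 0" "z \<in> vecs (monoms V d)" "z \<noteq> 0"
    using fr frame_unique[OF fr, of 1 0] frame_unique[OF fr, of 0 1] by (auto simp: frame_def)
  have "y \<in> L" "z \<in> L"
    by (auto simp: Lyz intro: lin.span_base)
  obtain u l c where u: "u \<in> vecs V" "l \<in> forms V 1" "eval_poly u l = 1" "c \<noteq> 0"
    "\<And>p. p \<in> forms V d \<Longrightarrow> pair y p = c * eval_poly u p" "\<And>p. p \<in> X \<Longrightarrow> eval_poly u p = 0"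
    using point[OF \<open>y \<in> L\<close> yz(1,2)] by blast
  obtain w m e where w: "w \<in> vecs V" "m \<in> forms V 1" "eval_poly w m = 1" "e \<noteq> 0"
    "\<And>p. p \<in> forms V d \<Longrightarrow> pair z p = e * eval_poly w p" "\<And>p. p \<in> X \<Longrightarrow> eval_poly w p = 0"
    using point[OF \<open>z \<in> L\<close> yz(3,4)] by blast
  \<comment> \<open>Proportional points would have proportional images, contrary to \<open>y\<close>
    and \<open>z\<close> spanning a line.\<close>
  have "a = 0 \<and> b = 0" if ab: "scale a u + scale b w = 0" for a b
  proof (rule ccontr)
    assume nz: "\<not> (a = 0 \<and> b = 0)"
    have "a * eval_poly u m + b = 0" "a + b * eval_poly w l = 0"
      using eval_poly_linear[OF w(2), of a u b w] eval_poly_linear[OF u(2), of a u b w] ab u(3) w(3)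
        eval_poly_scale[OF w(2), of 0 u] eval_poly_scale[OF u(2), of 0 u] by auto
    with nz have "a \<noteq> 0" by auto
    define t where "t = - b / a"
    have "u = scale t w"
    proof (rule poly_mapping_eqI)
      fix i
      have "Poly_Mapping.lookup (scale a u + scale b w) i = 0"
        by (simp add: ab)
      then show "Poly_Mapping.lookup u i = Poly_Mapping.lookup (scale t w) i"
        using \<open>a \<noteq> 0\<close> by (simp add: t_def lookup_add lookup_scale field_simps eq_neg_iff_add_eq_0)
    qed
    then have "pair y p = c * t ^ d / e * pair z p" if "p \<in> forms V d" for p
      using u(5)[OF that] w(4) w(5)[OF that] eval_poly_scale[OF that, of t w] by simp
    then have "scale 1 y + scale (- (c * t ^ d / e)) z = 0"
      using yz by (intro pair_eqI[of _ V d]) (auto simp: pair_def[of 0] simp del: lin.scale_one lin.scale_minus_left)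
    then show False
      using frame_unique[OF fr] by (metis one_neq_zero)
  qed
  then have "bisecant V X u (scale (- 1) u + scale 1 w) ([:0, 1:] * [:- 1, 1:])"
    using u w by (intro bisecant_two_points) auto
  then show False
    using no by blast
qed

text \<open>The secant line \<open>L\<close> is turned into a bisecant of the scheme, which gives
  every point of rank one in the zero locus a secant line through it.\<close>

lemma Sec_eq_zero_locus:
  assumes d: "d \<ge> 2" and L: "secant_line (monoms V d) (veronese_image V d X) L"
  shows "Sec (monoms V d) (veronese_image V d X) = zero_locus (monoms V d) (secant_cubics V d X)"
proof (intro equalityI subsetI)
  have X0: "0 \<in> X"
    using closed by (auto simp: closed_subscheme_def homogeneous_ideal_def ideal_of_def submodule_over_def)
  fix P assume "P \<in> Sec (monoms V d) (veronese_image V d X)"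
  then show "P \<in> zero_locus (monoms V d) (secant_cubics V d X)"
    using secant_eqs_eval[OF secant_line_eqs[OF finite_V X0]] unfolding Sec_def zero_locus_def by blast
next
  obtain u0 w0 g0 where bi: "bisecant V X u0 w0 g0"
    using bisecant_of_secant_line[OF d L] by blast
  fix P assume P: "P \<in> zero_locus (monoms V d) (secant_cubics V d X)"
  then obtain z where z: "z \<in> vecs (monoms V d)" "z \<noteq> 0" "P = lin.span {z}"
    by (auto simp: zero_locus_def proj_point_iff)
  have "z \<in> P"
    by (simp add: z lin.span_base)
  then have "secant_eqs V d X z"
    using P by (intro secant_cubics_eqs z) (auto simp: zero_locus_def)
  from secant_eqs_secant_line[OF d z(1,2) this bi] P
  show "P \<in> Sec (monoms V d) (veronese_image V d X)"
    unfolding Sec_def zero_locus_def z(3) by blast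
qed

end

lemma zero_locus_all_forms: "k > 0 \<Longrightarrow> zero_locus M (forms M k) = {}"
proof -
  assume k: "k > 0"
  have "P \<notin> zero_locus M (forms M k)" for P
  proof
    assume P: "P \<in> zero_locus M (forms M k)"
    then obtain z where z: "z \<in> vecs M" "z \<noteq> 0" "P = lin.span {z}"
      by (auto simp: zero_locus_def proj_point_iff)
    obtain i where i: "Poly_Mapping.lookup z i \<noteq> 0"
      using z(2) by (metis poly_mapping_eqI lookup_zero)
    then have "i \<in> M"
      using z(1) by (auto simp: vecs_def in_keys_iff)
    then have "var i ^ k \<in> forms M k" by simp
    moreover have "z \<in> P"
      by (simp add: z lin.span_base)
    ultimately have "eval_poly z (var i ^ k) = 0"
      using P by (auto simp: zero_locus_def)
    then show False using i k by simp
  qed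
  then show ?thesis by blast
qed

theorem theorem3p2:
  fixes s0 d :: nat and X :: "nat mpoly set"
  assumes "closed_subscheme {..s0} X"
    and "cond_K {..s0} 2 X"
    and "d \<ge> 2"
  shows "\<exists>C \<subseteq> forms (monoms {..s0} d) 3.
           Sec (monoms {..s0} d) (veronese_image {..s0} d X) = zero_locus (monoms {..s0} d) C"
proof (cases "\<exists>L. secant_line (monoms {..s0} d) (veronese_image {..s0} d X) L")
  case True
  then obtain L where L: "secant_line (monoms {..s0} d) (veronese_image {..s0} d X) L" ..
  obtain s F where F: "\<forall>i\<le>s. F i \<in> forms {..s0} 2" "cut_out_by {..s0} X (F ` {..s})"
    "\<forall>i\<le>s. \<forall>j\<le>s. koszul_syzygy F i j \<in> syzygies_gen {..s0} (linear_syzygies {..s0} s F)"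
    using assms(2) unfolding cond_K_def by metis
  interpret quadric_scheme "{..s0}" X s F
    by unfold_locales (use assms(1) F in auto)
  show ?thesis
    by (rule exI[of _ "secant_cubics {..s0} d X"], rule conjI[OF secant_cubics_forms])
      (rule Sec_eq_zero_locus[OF assms(3) L])
next
  case False
  then have "Sec (monoms {..s0} d) (veronese_image {..s0} d X) = {}"
    by (simp add: Sec_def)
  then show ?thesis
    using zero_locus_all_forms[of 3 "monoms {..s0} d"] by auto
qed

end
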